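(* Let $\Omega\subset\mathbb{R}$ be a bounded open interval, let $d\in C^0(\overline{\Omega})$ be nonnegative with $d\in C^1(\{d>0\})$ and $\int_\Omega\frac1d<\infty$, let $g\in C^2([0,\infty))$ satisfy $g(0)=0$ and $\underline{\gamma}\le g'\le\overline{\gamma}$ on $[0,\infty)$ with constants $\underline\gamma,\overline\gamma>0$, and let $0\le u_0\in C^0(\overline\Omega)$, $u_0\not\equiv0$, and $0\le w_0\in C^0(\overline\Omega)$ with $\sqrt{w_0}\in W^{1,2}(\Omega)$ and $\int_\Omega\frac{d_x^2}{d}w_0<\infty$. Let $(u,w)$ be the constructed solution (as defined in the context) of $$u_t=(d(x)u)_{xx}-(d(x)uw_x)_x,\qquad w_t=-ug(w)\qquad(x\in\Omega,\ t>0),$$ with no-flux boundary condition $(d(x)u)_x-d(x)uw_x=0$ on $\partial\Omega$ and initial data $(u_0,w_0)$. Then, with the positive number $$\mu_\infty:=\frac{\int_\Omega u_0}{\int_\Omega\frac1d},$$ one has $$u(\cdot,t)\rightharpoonup\frac{\mu_\infty}{d}\quad\text{weakly in }L^1(\Omega)\qquad\text{and}\qquad w(\cdot,t)\to0\quad\text{in }L^\infty(\Omega)\qquad\text{as }t\to\infty.$$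
   Context: Notation: $\{d>0\}:=\{x\in\overline\Omega:d(x)>0\}$ (of full measure because $\int_\Omega\frac1d<\infty$; integrals involving $d_x$ are over this set). $C^0_w([0,\infty);L^1(\Omega))$: functions $[0,\infty)\to L^1(\Omega)$ continuous for the weak topology. For a function $w\ge0$ with $\sqrt w\in W^{1,2}(\Omega)$, $\frac{w_x^2}{w}$ means $4((\sqrt w)_x)^2$. Approximating data. $(d_\varepsilon)_{\varepsilon\in(0,1)}\subset C^\infty(\overline\Omega)$ is a family such that, as $\varepsilon\searrow0$, $d_\varepsilon\to d$ in $L^\infty(\Omega)$ and $d_{\varepsilon x}\to d_x$ in $L^\infty_{loc}(\{d>0\}\cap\Omega)$ and in $L^p_{loc}(\{d>0\})$ for all $p\in[1,\infty)$; $d_\varepsilon\le d_{\varepsilon'}$ for $0<\varepsilon\le\varepsilon'<1$ (hence $d_\varepsilon\ge d$); and for all $\varepsilon\in(0,1)$: $d_\varepsilon>0$ in $\overline\Omega$, $d_{\varepsilon x}=0$ on $\partial\Omega$, $d_\varepsilon\le\|d\|_{L^\infty(\Omega)}+1$, $\varepsilon^2\int_\Omega\frac{d_{\varepsilon x}^2}{d_\varepsilon^3}\le1$, $\sqrt\varepsilon\int_\Omega\frac{d_{\varepsilon x}^4}{d_\varepsilon^2}\le1$, $\varepsilon^{1/4}\frac1{\inf_\Omega d_\varepsilon}\le1$, $\varepsilon^{1/4}\|\frac{d_{\varepsilon x}}{d_\varepsilon}\|_{L^\infty(\Omega)}\le1$. $(w_{0j})_{j\in\mathbb N}\subset L^\infty(\Omega)$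 is a sequence of nonnegative functions with $\sqrt{w_{0j}}\in W^{1,2}(\Omega)$, $\operatorname{supp}w_{0j}\subset\{d>0\}$, $w_{0j}\nearrow w_0$ in $\Omega$ as $j\to\infty$, and $\sup_j\int_\Omega d\frac{w_{0jx}^2}{w_{0j}}<\infty$. $(\varepsilon_j)_{j\in\mathbb N}\subset(0,1)$ is a sequence decreasing to $0$ such that $w_{0\varepsilon}:=w_{0j}+\varepsilon^{1/4}$ for $\varepsilon=\varepsilon_j$ satisfies $\sup_{\varepsilon\in(\varepsilon_j)}\int_\Omega d_\varepsilon\frac{w_{0\varepsilon x}^2}{w_{0\varepsilon}}<\infty$ and $\sup_{\varepsilon\in(\varepsilon_j)}\int_\Omega\frac{d_{\varepsilon x}^2}{d_\varepsilon}w_{0\varepsilon}<\infty$. Regularized problems. For $\varepsilon\in(\varepsilon_j)_{j\in\mathbb N}$, $(u_\varepsilon,w_\varepsilon)$ is the global classical solution of $$u_{\varepsilon t}=(d_\varepsilon u_\varepsilon)_{xx}-(d_\varepsilon u_\varepsilon w_{\varepsilon x})_x,\qquad w_{\varepsilon t}=\varepsilon\Big(d_\varepsilon\frac{w_{\varepsilon x}}{\sqrt{g(w_\varepsilon)}}\Big)_x-u_\varepsilon g(w_\varepsilon)\qquad(x\in\Omega,\ t>0),$$ $u_{\varepsilon x}=w_{\varepsilon x}=0$ on $\partial\Omega$, $u_\varepsilon(\cdot,0)=u_0$, $w_\varepsilon(\cdot,0)=w_{0\varepsilon}$, with $u_\varepsilon\in C^0(\overline\Omega\times[0,\infty))\cap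 C^{2,1}(\overline\Omega\times(0,\infty))$, $w_\varepsilon\in C^0([0,\infty);W^{1,2}(\Omega))\cap C^{2,1}(\overline\Omega\times(0,\infty))$, $u_\varepsilon>0$ in $\overline\Omega\times(0,\infty)$ and $w_\varepsilon>0$ in $\overline\Omega\times[0,\infty)$. Constructed solution. This is a pair $(u,w)$ of nonnegative functions, $u\in C^0_w([0,\infty);L^1(\Omega))\cap L^\infty((0,\infty);L^1(\Omega))\cap C^0([0,\infty);(W^{1,\infty}(\Omega))^\star)$, $w\in C^0(\overline\Omega\times[0,\infty))\cap L^\infty(\Omega\times(0,\infty))\cap L^1_{loc}([0,\infty);W^{1,1}(\Omega))$, obtained as limit along a subsequence $\varepsilon=\varepsilon_{j_k}\searrow0$ of $(\varepsilon_j)$ in the sense that $u_\varepsilon\to u$ a.e. in $\Omega\times(0,\infty)$, in $L^1_{loc}(\overline\Omega\times[0,\infty))$ and in $C^0_{loc}([0,\infty);(W^{1,\infty}(\Omega))^\star)$, $w_\varepsilon\to w$ in $C^0_{loc}(\overline\Omega\times[0,\infty))$, $w_{\varepsilon x}\rightharpoonup w_x$ in $L^1_{loc}(\overline\Omega\times[0,\infty))$ and $\sqrt{d_\varepsilon}w_{\varepsilon x}\rightharpoonup\sqrt d\,w_x$ in $L^2_{loc}(\overline\Omega\times[0,\infty))$. Such data, solutions and limits exist under the stated hypotheses, and $(u,w)$ is then a global weak solution of the limit problem. *)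

theory Defs
  imports "HOL-Analysis.Analysis" "HOL-Probability.Essential_Supremum" "HOL-Library.Extended_Nat"
begin

text \<open>
  The spatial domain is the open interval \<open>{a<..<b}\<close> with closure \<open>{a..b}\<close>. Elements of
  Lebesgue and Sobolev spaces are represented by functions, and the notions concerning them
  depend only on the values almost everywhere. A function of space and time is curried, with space first.
\<close>

section \<open>Classical derivatives and smoothness\<close>

text \<open>At the endpoints of the interval this is the one-sided derivative.\<close>

definition dx :: "real \<Rightarrow> real \<Rightarrow> (real \<Rightarrow> real) \<Rightarrow> real \<Rightarrow> real" where
  "dx a b f x = vector_derivative f (at x within {a..b})"

text \<open>The class \<open>C^k(S)\<close>, with \<open>k = \<infinity>\<close> allowed; \<open>D n\<close> is the derivative of order \<open>n\<close>, taken
  relative to \<open>S\<close>, so that derivatives are one-sided at boundary points belonging to \<open>S\<close>.\<close>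

definition Ck_on :: "enat \<Rightarrow> real set \<Rightarrow> (real \<Rightarrow> real) \<Rightarrow> bool" where
  "Ck_on k S f \<longleftrightarrow> (\<exists>D :: nat \<Rightarrow> real \<Rightarrow> real. D 0 = f \<and>
     (\<forall>n. enat n < k \<longrightarrow> (\<forall>x\<in>S. (D n has_real_derivative D (Suc n) x) (at x within S))) \<and>
     (\<forall>n. enat n \<le> k \<longrightarrow> continuous_on S (D n)))"

text \<open>\<open>C^{2,1}\<close> on \<open>{a..b} \<times> {0<..}\<close>: two space derivatives and one time derivative.\<close>

definition C21_on :: "real \<Rightarrow> real \<Rightarrow> (real \<Rightarrow> real \<Rightarrow> real) \<Rightarrow> bool" where
  "C21_on a b v \<longleftrightarrow> (\<exists>vx vxx vt.
     (\<forall>x\<in>{a..b}. \<forall>t>0.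
        ((\<lambda>y. v y t) has_real_derivative vx x t) (at x within {a..b}) \<and>
        ((\<lambda>y. vx y t) has_real_derivative vxx x t) (at x within {a..b}) \<and>
        ((\<lambda>s. v x s) has_real_derivative vt x t) (at t)) \<and>
     continuous_on ({a..b} \<times> {0<..}) (\<lambda>(x, t). v x t) \<and>
     continuous_on ({a..b} \<times> {0<..}) (\<lambda>(x, t). vx x t) \<and>
     continuous_on ({a..b} \<times> {0<..}) (\<lambda>(x, t). vxx x t) \<and>
     continuous_on ({a..b} \<times> {0<..}) (\<lambda>(x, t). vt x t))"

definition pos_set :: "real \<Rightarrow> real \<Rightarrow> (real \<Rightarrow> real) \<Rightarrow> real set" where
  "pos_set a b d = {x \<in> {a..b}. 0 < d x}"

section \<open>Lebesgue spaces\<close>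

definition Lp :: "real \<Rightarrow> 'a::euclidean_space set \<Rightarrow> ('a \<Rightarrow> real) set" where
  "Lp p S = {f \<in> borel_measurable (lebesgue_on S).
     (\<integral>\<^sup>+x. ennreal (\<bar>f x\<bar> powr p) \<partial>lebesgue_on S) < \<infinity>}"

text \<open>The values are taken in \<^typ>\<open>ennreal\<close>, so that the essential supremum over a null set
  is \<open>0\<close> (and not \<open>-\<infinity>\<close>).\<close>

definition Linf_norm :: "'a::euclidean_space set \<Rightarrow> ('a \<Rightarrow> real) \<Rightarrow> ennreal" where
  "Linf_norm S f = esssup (lebesgue_on S) (\<lambda>x. ennreal \<bar>f x\<bar>)"

definition Linf :: "'a::euclidean_space set \<Rightarrow> ('a \<Rightarrow> real) set" where
  "Linf S = {f \<in> borel_measurable (lebesgue_on S). Linf_norm S f < \<infinity>}"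

definition Lp_tendsto ::
  "real \<Rightarrow> 'a::euclidean_space set \<Rightarrow> ('k \<Rightarrow> 'a \<Rightarrow> real) \<Rightarrow> ('a \<Rightarrow> real) \<Rightarrow> 'k filter \<Rightarrow> bool" where
  "Lp_tendsto p S f l F \<longleftrightarrow> l \<in> Lp p S \<and> (\<forall>\<^sub>F k in F. f k \<in> Lp p S) \<and>
     ((\<lambda>k. \<integral>\<^sup>+x. ennreal (\<bar>f k x - l x\<bar> powr p) \<partial>lebesgue_on S) \<longlongrightarrow> 0) F"

text \<open>Weak convergence in \<open>L^1\<close> and in \<open>L^2\<close>; the dual spaces are \<open>L^\<infinity>\<close> and \<open>L^2\<close>.\<close>

definition weak_L1_tendsto ::
  "'a::euclidean_space set \<Rightarrow> ('k \<Rightarrow> 'a \<Rightarrow> real) \<Rightarrow> ('a \<Rightarrow> real) \<Rightarrow> 'k filter \<Rightarrow> bool" where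
  "weak_L1_tendsto S f l F \<longleftrightarrow> l \<in> Lp 1 S \<and> (\<forall>\<^sub>F k in F. f k \<in> Lp 1 S) \<and>
     (\<forall>\<phi>\<in>Linf S. ((\<lambda>k. LINT x|lebesgue_on S. f k x * \<phi> x) \<longlongrightarrow>
        (LINT x|lebesgue_on S. l x * \<phi> x)) F)"

definition weak_L2_tendsto ::
  "'a::euclidean_space set \<Rightarrow> ('k \<Rightarrow> 'a \<Rightarrow> real) \<Rightarrow> ('a \<Rightarrow> real) \<Rightarrow> 'k filter \<Rightarrow> bool" where
  "weak_L2_tendsto S f l F \<longleftrightarrow> l \<in> Lp 2 S \<and> (\<forall>\<^sub>F k in F. f k \<in> Lp 2 S) \<and>
     (\<forall>\<phi>\<in>Lp 2 S. ((\<lambda>k. LINT x|lebesgue_on S. f k x * \<phi> x) \<longlongrightarrow>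
        (LINT x|lebesgue_on S. l x * \<phi> x)) F)"

text \<open>The support, relative to \<open>{a..b}\<close>, of an almost-everywhere class of functions on the
  interval: the complement of the largest relatively open set on which the function vanishes
  almost everywhere. For continuous functions this is the usual support.\<close>

definition ess_supp :: "real \<Rightarrow> real \<Rightarrow> (real \<Rightarrow> real) \<Rightarrow> real set" where
  "ess_supp a b f = {x \<in> {a..b}. \<forall>U. open U \<and> x \<in> U \<longrightarrow>
     \<not> (AE y in lebesgue_on ({a<..<b} \<inter> U). f y = 0)}"

section \<open>Sobolev spaces on an interval\<close>

definition test_fun :: "real \<Rightarrow> real \<Rightarrow> (real \<Rightarrow> real) \<Rightarrow> bool" where
  "test_fun a b \<phi> \<longleftrightarrow> Ck_on \<infinity> UNIV \<phi> \<and>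
     (\<exists>K. compact K \<and> K \<subseteq> {a<..<b} \<and> (\<forall>x. x \<notin> K \<longrightarrow> \<phi> x = 0))"

definition has_weak_deriv :: "real \<Rightarrow> real \<Rightarrow> (real \<Rightarrow> real) \<Rightarrow> (real \<Rightarrow> real) \<Rightarrow> bool" where
  "has_weak_deriv a b f v \<longleftrightarrow>
     (\<forall>K. compact K \<and> K \<subseteq> {a<..<b} \<longrightarrow> f \<in> Lp 1 K \<and> v \<in> Lp 1 K) \<and>
     (\<forall>\<phi>. test_fun a b \<phi> \<longrightarrow>
        (LINT x|lebesgue_on {a<..<b}. f x * deriv \<phi> x) =
        - (LINT x|lebesgue_on {a<..<b}. v x * \<phi> x))"

text \<open>Some representative of the weak derivative, which is unique almost everywhere.\<close>

definition wderiv :: "real \<Rightarrow> real \<Rightarrow> (real \<Rightarrow> real) \<Rightarrow> real \<Rightarrow> real" where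
  "wderiv a b f = (SOME v. has_weak_deriv a b f v)"

definition W1p :: "real \<Rightarrow> real \<Rightarrow> real \<Rightarrow> (real \<Rightarrow> real) set" where
  "W1p p a b = {f \<in> Lp p {a<..<b}. \<exists>v\<in>Lp p {a<..<b}. has_weak_deriv a b f v}"

definition W1inf :: "real \<Rightarrow> real \<Rightarrow> (real \<Rightarrow> real) set" where
  "W1inf a b = {f \<in> Linf {a<..<b}. \<exists>v\<in>Linf {a<..<b}. has_weak_deriv a b f v}"

definition W1inf_norm :: "real \<Rightarrow> real \<Rightarrow> (real \<Rightarrow> real) \<Rightarrow> ennreal" where
  "W1inf_norm a b f = Linf_norm {a<..<b} f + Linf_norm {a<..<b} (wderiv a b f)"

text \<open>The norm in the dual of \<open>W^{1,\<infinity>}\<close> of the functional \<open>\<phi> \<mapsto> \<integral> f \<phi>\<close> induced by an integrable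
  function.\<close>

definition W1inf_dual_norm :: "real \<Rightarrow> real \<Rightarrow> (real \<Rightarrow> real) \<Rightarrow> ennreal" where
  "W1inf_dual_norm a b f = (SUP \<phi>\<in>{\<phi> \<in> W1inf a b. W1inf_norm a b \<phi> \<le> 1}.
     ennreal \<bar>LINT x|lebesgue_on {a<..<b}. f x * \<phi> x\<bar>)"

text \<open>The quantity \<open>w_x^2 / w\<close> for nonnegative \<open>w\<close> with weakly differentiable square root.\<close>

definition fisher :: "real \<Rightarrow> real \<Rightarrow> (real \<Rightarrow> real) \<Rightarrow> real \<Rightarrow> real" where
  "fisher a b w x = 4 * (wderiv a b (\<lambda>y. sqrt (w y)) x)\<^sup>2"

section \<open>Spaces of time-dependent functions\<close>

definition Cw_L1 :: "real \<Rightarrow> real \<Rightarrow> (real \<Rightarrow> real \<Rightarrow> real) \<Rightarrow> bool" where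
  "Cw_L1 a b u \<longleftrightarrow>
     (\<forall>t\<ge>0. weak_L1_tendsto {a<..<b} (\<lambda>s x. u x s) (\<lambda>x. u x t) (at t within {0..}))"

definition Linf_L1 :: "real \<Rightarrow> real \<Rightarrow> (real \<Rightarrow> real \<Rightarrow> real) \<Rightarrow> bool" where
  "Linf_L1 a b u \<longleftrightarrow>
     esssup (lebesgue_on {0<..}) (\<lambda>t. \<integral>\<^sup>+x. ennreal \<bar>u x t\<bar> \<partial>lebesgue_on {a<..<b}) < \<infinity>"

definition C0_W1inf_dual :: "real \<Rightarrow> real \<Rightarrow> (real \<Rightarrow> real \<Rightarrow> real) \<Rightarrow> bool" where
  "C0_W1inf_dual a b u \<longleftrightarrow> (\<forall>t\<ge>0. (\<lambda>x. u x t) \<in> Lp 1 {a<..<b} \<and>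
     ((\<lambda>s. W1inf_dual_norm a b (\<lambda>x. u x s - u x t)) \<longlongrightarrow> 0) (at t within {0..}))"

definition C0_W12 :: "real \<Rightarrow> real \<Rightarrow> (real \<Rightarrow> real \<Rightarrow> real) \<Rightarrow> bool" where
  "C0_W12 a b w \<longleftrightarrow> (\<forall>t\<ge>0. (\<lambda>x. w x t) \<in> W1p 2 a b \<and>
     Lp_tendsto 2 {a<..<b} (\<lambda>s x. w x s) (\<lambda>x. w x t) (at t within {0..}) \<and>
     Lp_tendsto 2 {a<..<b} (\<lambda>s. wderiv a b (\<lambda>x. w x s)) (wderiv a b (\<lambda>x. w x t))
       (at t within {0..}))"

text \<open>\<open>w\<close> belongs to \<open>L^1_loc([0,\<infinity>); W^{1,1})\<close> with spatial derivative \<open>wx\<close>; Bochner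
  integrability with values in \<open>L^1\<close> is expressed as integrability on the product.\<close>

definition L1loc_W11 ::
  "real \<Rightarrow> real \<Rightarrow> (real \<Rightarrow> real \<Rightarrow> real) \<Rightarrow> (real \<Rightarrow> real \<Rightarrow> real) \<Rightarrow> bool" where
  "L1loc_W11 a b w wx \<longleftrightarrow>
     (\<forall>T>0. (\<lambda>(x, t). w x t) \<in> Lp 1 ({a<..<b} \<times> {0<..<T}) \<and>
            (\<lambda>(x, t). wx x t) \<in> Lp 1 ({a<..<b} \<times> {0<..<T})) \<and>
     (AE t in lebesgue_on {0<..}. (\<lambda>x. w x t) \<in> W1p 1 a b \<and>
        has_weak_deriv a b (\<lambda>x. w x t) (\<lambda>x. wx x t))"

section \<open>Approximating data\<close>

definition approx_d :: "real \<Rightarrow> real \<Rightarrow> (real \<Rightarrow> real) \<Rightarrow> (real \<Rightarrow> real \<Rightarrow> real) \<Rightarrow> bool" where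
  "approx_d a b d de \<longleftrightarrow>
     (\<forall>e\<in>{0<..<1}. Ck_on \<infinity> {a..b} (de e)) \<and>
     ((\<lambda>e. Linf_norm {a<..<b} (\<lambda>x. de e x - d x)) \<longlongrightarrow> 0) (at_right 0) \<and>
     (\<forall>K. compact K \<and> K \<subseteq> pos_set a b d \<inter> {a<..<b} \<longrightarrow>
        ((\<lambda>e. Linf_norm K (\<lambda>x. dx a b (de e) x - dx a b d x)) \<longlongrightarrow> 0) (at_right 0)) \<and>
     (\<forall>p\<ge>1. \<forall>K. compact K \<and> K \<subseteq> pos_set a b d \<longrightarrow>
        Lp_tendsto p K (\<lambda>e. dx a b (de e)) (dx a b d) (at_right 0)) \<and>
     (\<forall>e e'. 0 < e \<and> e \<le> e' \<and> e' < 1 \<longrightarrow> (\<forall>x\<in>{a..b}. de e x \<le> de e' x)) \<and>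
     (\<forall>e\<in>{0<..<1}.
        (\<forall>x\<in>{a..b}. 0 < de e x) \<and>
        dx a b (de e) a = 0 \<and> dx a b (de e) b = 0 \<and>
        (\<forall>x\<in>{a..b}. ennreal (de e x) \<le> Linf_norm {a<..<b} d + 1) \<and>
        ennreal (e\<^sup>2) *
          (\<integral>\<^sup>+x. ennreal ((dx a b (de e) x)\<^sup>2 / de e x ^ 3) \<partial>lebesgue_on {a<..<b}) \<le> 1 \<and>
        ennreal (sqrt e) *
          (\<integral>\<^sup>+x. ennreal (dx a b (de e) x ^ 4 / (de e x)\<^sup>2) \<partial>lebesgue_on {a<..<b}) \<le> 1 \<and>
        e powr (1/4) * (1 / (INF x\<in>{a<..<b}. de e x)) \<le> 1 \<and>
        ennreal (e powr (1/4)) * Linf_norm {a<..<b} (\<lambda>x. dx a b (de e) x / de e x) \<le> 1)"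

definition approx_w0 ::
  "real \<Rightarrow> real \<Rightarrow> (real \<Rightarrow> real) \<Rightarrow> (real \<Rightarrow> real) \<Rightarrow> (nat \<Rightarrow> real \<Rightarrow> real) \<Rightarrow> bool" where
  "approx_w0 a b d w0 w0j \<longleftrightarrow>
     (\<forall>j. w0j j \<in> Linf {a<..<b} \<and>
        (AE x in lebesgue_on {a<..<b}. 0 \<le> w0j j x) \<and>
        (\<lambda>x. sqrt (w0j j x)) \<in> W1p 2 a b \<and>
        ess_supp a b (w0j j) \<subseteq> pos_set a b d) \<and>
     (AE x in lebesgue_on {a<..<b}.
        incseq (\<lambda>j. w0j j x) \<and> (\<lambda>j. w0j j x) \<longlonglongrightarrow> w0 x) \<and>
     (SUP j. \<integral>\<^sup>+x. ennreal (d x * fisher a b (w0j j) x) \<partial>lebesgue_on {a<..<b}) < \<infinity>"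

definition w0_reg :: "(nat \<Rightarrow> real \<Rightarrow> real) \<Rightarrow> (nat \<Rightarrow> real) \<Rightarrow> nat \<Rightarrow> real \<Rightarrow> real" where
  "w0_reg w0j eps j x = w0j j x + eps j powr (1/4)"

definition approx_eps ::
  "real \<Rightarrow> real \<Rightarrow> (real \<Rightarrow> real \<Rightarrow> real) \<Rightarrow> (nat \<Rightarrow> real \<Rightarrow> real) \<Rightarrow> (nat \<Rightarrow> real) \<Rightarrow> bool" where
  "approx_eps a b de w0j eps \<longleftrightarrow>
     range eps \<subseteq> {0<..<1} \<and> decseq eps \<and> eps \<longlonglongrightarrow> 0 \<and>
     (SUP j. \<integral>\<^sup>+x. ennreal (de (eps j) x * fisher a b (w0_reg w0j eps j) x)
        \<partial>lebesgue_on {a<..<b}) < \<infinity> \<and>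
     (SUP j. \<integral>\<^sup>+x. ennreal ((dx a b (de (eps j)) x)\<^sup>2 / de (eps j) x * w0_reg w0j eps j x)
        \<partial>lebesgue_on {a<..<b}) < \<infinity>"

section \<open>The regularized problems\<close>

text \<open>Here \<open>d\<close> and \<open>w0\<close> are the regularized diffusion coefficient and initial datum. Since \<open>w\<close> is
  continuous in time with values in \<open>W^{1,2}\<close>, which embeds into the continuous functions on
  \<open>{a..b}\<close>, it is represented by a function that is continuous up to \<open>t = 0\<close>.\<close>

definition regularized_solution ::
  "real \<Rightarrow> real \<Rightarrow> real \<Rightarrow> (real \<Rightarrow> real) \<Rightarrow> (real \<Rightarrow> real) \<Rightarrow> (real \<Rightarrow> real) \<Rightarrow> (real \<Rightarrow> real) \<Rightarrow>
   (real \<Rightarrow> real \<Rightarrow> real) \<Rightarrow> (real \<Rightarrow> real \<Rightarrow> real) \<Rightarrow> bool" where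
  "regularized_solution a b e d g u0 w0 u w \<longleftrightarrow>
     continuous_on ({a..b} \<times> {0..}) (\<lambda>(x, t). u x t) \<and> C21_on a b u \<and>
     C0_W12 a b w \<and> continuous_on ({a..b} \<times> {0..}) (\<lambda>(x, t). w x t) \<and> C21_on a b w \<and>
     (\<forall>x\<in>{a..b}. \<forall>t>0. 0 < u x t) \<and>
     (\<forall>x\<in>{a..b}. \<forall>t\<ge>0. 0 < w x t) \<and>
     (\<forall>x\<in>{a<..<b}. \<forall>t>0.
        deriv (\<lambda>s. u x s) t =
          dx a b (dx a b (\<lambda>y. d y * u y t)) x
          - dx a b (\<lambda>y. d y * u y t * dx a b (\<lambda>z. w z t) y) x \<and>
        deriv (\<lambda>s. w x s) t =
          e * dx a b (\<lambda>y. d y * (dx a b (\<lambda>z. w z t) y / sqrt (g (w y t)))) x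
          - u x t * g (w x t)) \<and>
     (\<forall>x\<in>{a, b}. \<forall>t>0. dx a b (\<lambda>y. u y t) x = 0 \<and> dx a b (\<lambda>y. w y t) x = 0) \<and>
     (\<forall>x\<in>{a..b}. u x 0 = u0 x) \<and>
     (AE x in lebesgue_on {a<..<b}. w x 0 = w0 x)"

section \<open>The constructed solution\<close>

definition constructed_solution ::
  "real \<Rightarrow> real \<Rightarrow> (real \<Rightarrow> real) \<Rightarrow> (real \<Rightarrow> real) \<Rightarrow> (real \<Rightarrow> real) \<Rightarrow> (real \<Rightarrow> real) \<Rightarrow>
   (real \<Rightarrow> real \<Rightarrow> real) \<Rightarrow> (real \<Rightarrow> real \<Rightarrow> real) \<Rightarrow> bool" where
  "constructed_solution a b d g u0 w0 u w \<longleftrightarrow>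
     (\<forall>t\<ge>0. AE x in lebesgue_on {a<..<b}. 0 \<le> u x t) \<and>
     Cw_L1 a b u \<and> Linf_L1 a b u \<and> C0_W1inf_dual a b u \<and>
     (\<forall>x\<in>{a..b}. \<forall>t\<ge>0. 0 \<le> w x t) \<and>
     continuous_on ({a..b} \<times> {0..}) (\<lambda>(x, t). w x t) \<and>
     (\<lambda>(x, t). w x t) \<in> Linf ({a<..<b} \<times> {0<..}) \<and>
     (\<exists>wx. L1loc_W11 a b w wx \<and>
       (\<exists>de w0j eps ue we r.
          approx_d a b d de \<and> approx_w0 a b d w0 w0j \<and> approx_eps a b de w0j eps \<and>
          (\<forall>j. regularized_solution a b (eps j) (de (eps j)) g u0 (w0_reg w0j eps j)
             (ue j) (we j)) \<and>
          strict_mono (r :: nat \<Rightarrow> nat) \<and>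
          (AE z in lebesgue_on ({a<..<b} \<times> {0<..}).
             (\<lambda>k. ue (r k) (fst z) (snd z)) \<longlonglongrightarrow> u (fst z) (snd z)) \<and>
          (\<forall>K. compact K \<and> K \<subseteq> {a..b} \<times> {0..} \<longrightarrow>
             Lp_tendsto 1 K (\<lambda>k (x, t). ue (r k) x t) (\<lambda>(x, t). u x t) sequentially) \<and>
          (\<forall>K. compact K \<and> K \<subseteq> {0..} \<longrightarrow>
             (\<lambda>k. SUP t\<in>K. W1inf_dual_norm a b (\<lambda>x. ue (r k) x t - u x t))
               \<longlonglongrightarrow> 0) \<and>
          (\<forall>K. compact K \<and> K \<subseteq> {a..b} \<times> {0..} \<longrightarrow>
             uniform_limit K (\<lambda>k (x, t). we (r k) x t) (\<lambda>(x, t). w x t) sequentially) \<and>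
          (\<forall>K. compact K \<and> K \<subseteq> {a..b} \<times> {0..} \<longrightarrow>
             weak_L1_tendsto K (\<lambda>k (x, t). dx a b (\<lambda>y. we (r k) y t) x)
               (\<lambda>(x, t). wx x t) sequentially) \<and>
          (\<forall>K. compact K \<and> K \<subseteq> {a..b} \<times> {0..} \<longrightarrow>
             weak_L2_tendsto K
               (\<lambda>k (x, t). sqrt (de (eps (r k)) x) * dx a b (\<lambda>y. we (r k) y t) x)
               (\<lambda>(x, t). sqrt (d x) * wx x t) sequentially)))"

end

theory Submission
  imports Defs
begin

text \<open>
  With \<open>U = d u\<close> the first equation reads \<open>u_t = (U_x - U w_x)_x\<close>, and along solutions
  \<open>(\<integral> u ln U + 1/2 \<integral> d w_x^2 / g(w))' = - \<integral> U_x^2 / U + \<integral> d_x u w_x - 1/2 \<integral> (g'(w)/g(w)) U w_x^2\<close>.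
  The indefinite integral is absorbed by Young's inequality at the price of a multiple of
  \<open>\<integral> (d_x^2/d) u g(w)\<close>, which is the rate at which \<open>\<integral> (d_x^2/d) w\<close> decreases. Hence the energy
  \<open>\<integral> u ln U + 1/2 \<integral> d w_x^2 / g(w) + 1/\<gamma>1 \<integral> (d_x^2/d) w\<close> decreases at least at the rate
  \<open>D = \<integral> U_x^2 / U + \<kappa> \<integral> U w_x^2\<close>. It is bounded below, because \<open>s ln s \<ge> -1\<close> gives
  \<open>u ln U \<ge> -1/d\<close> and \<open>1/d\<close> is integrable; so its total drop is finite. This yields the theorem in
  three ways.

  \<^item> If \<open>D\<close> is small, then \<open>U\<close> is nearly constant, so that \<open>u\<close> is near \<open>\<mu>/d\<close> by conservation of
    mass; and the flux \<open>U_x - U w_x\<close> is bounded in \<open>L^1\<close> by a multiple of \<open>sqrt D\<close>. Together: the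
    drop of the energy over \<open>[t-1, t]\<close> controls the distance between \<open>u(t)\<close> and \<open>\<mu>/d\<close>, tested
    with a function of class \<open>C^1\<close> (\<open>dissipation_controls_distance\<close>). A finite total drop leaves no
    room for infinitely many times with a distance bounded away from \<open>0\<close>
    (\<open>tendsto_zero_of_lyapunov_drop\<close>).
  \<^item> The bound for \<open>\<integral> u (ln U)_+\<close> makes the functions \<open>u(t)\<close> uniformly integrable, and bounded test
    functions are almost everywhere limits of bounded sequences of polynomials; so the convergence
    extends to all test functions in \<open>L^\<infinity>\<close> (\<open>u_weak_limit\<close>).
  \<^item> Since \<open>(\<integral> w)' = - \<integral> u g(w) \<le> 0\<close>, there are times at which both \<open>\<integral> u g(w)\<close> and \<open>D\<close> are small.
    Then \<open>\<integral> g(w)/d\<close> is small, hence so is \<open>\<integral> w\<close>, which is monotone (\<open>nutrient_decay\<close>). The bound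
    for \<open>\<integral> d w_x^2 / g(w)\<close> and the integrability of \<open>1/d\<close> give a modulus of continuity of \<open>w\<close> in
    space that does not depend on time, which turns smallness of the mean into smallness of the
    maximum (\<open>uniform_limit_zero_of_mean\<close>).

  The computation is carried out for the regularized solutions. There the artificial diffusion
  contributes an error of order \<open>sqrt \<epsilon>\<close> per unit of time, which is harmless on a bounded interval
  \<open>[0, T]\<close>; on such an interval \<open>w_\<epsilon>\<close> is bounded by a constant that does not depend on \<open>T\<close>,
  because it converges uniformly to the bounded function \<open>w\<close>. Only consequences at single times,
  not integrals over time, are passed to the limit. The remaining point is that the energy of the
  regularized solutions is bounded as \<open>t\<close> tends to \<open>0\<close>; this connects the trace of \<open>w_{\<epsilon>x}\<close> with
  the weak derivative of \<open>sqrt w_{0\<epsilon>}\<close> and rests on the uniqueness of weak derivatives.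
\<close>

section \<open>Calculus on a compact interval\<close>

lemma integral_by_parts_zero_boundary:
  fixes F G :: "real \<Rightarrow> real"
  assumes "a \<le> b"
    and F: "\<And>x. x \<in> {a..b} \<Longrightarrow> (F has_real_derivative F' x) (at x within {a..b})"
    and G: "\<And>x. x \<in> {a..b} \<Longrightarrow> (G has_real_derivative G' x) (at x within {a..b})"
    and F': "continuous_on {a..b} F'" and G': "continuous_on {a..b} G'"
    and bd: "F a * G a = 0" "F b * G b = 0"
  shows "integral {a..b} (\<lambda>x. F' x * G x) = - integral {a..b} (\<lambda>x. F x * G' x)"
proof -
  have cF: "continuous_on {a..b} F" and cG: "continuous_on {a..b} G"
    by (rule DERIV_continuous_on[OF F] DERIV_continuous_on[OF G]; assumption)+
  have "((\<lambda>x. F x * G x) has_vector_derivative F' x * G x + F x * G' x) (at x within {a..b})"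
    if "x \<in> {a..b}" for x
    using DERIV_mult[OF F[OF that] G[OF that]]
    by (simp add: has_real_derivative_iff_has_vector_derivative[symmetric] algebra_simps)
  from fundamental_theorem_of_calculus[OF \<open>a \<le> b\<close> this]
  have "((\<lambda>x. F' x * G x + F x * G' x) has_integral F b * G b - F a * G a) {a..b}"
    by simp
  then have "integral {a..b} (\<lambda>x. F' x * G x + F x * G' x) = 0"
    using bd by (simp add: integral_unique)
  moreover have "integral {a..b} (\<lambda>x. F' x * G x + F x * G' x) =
      integral {a..b} (\<lambda>x. F' x * G x) + integral {a..b} (\<lambda>x. F x * G' x)"
    by (intro Henstock_Kurzweil_Integration.integral_add integrable_continuous_interval
        continuous_intros cF cG F' G')
  ultimately show ?thesis by simp
qed

lemma discriminant_nonpos_if_nonneg: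
  fixes A B C :: real
  assumes "\<And>l. 0 \<le> A + 2 * l * B + l\<^sup>2 * C"
  shows "B\<^sup>2 \<le> A * C"
proof (cases "C = 0")
  case True
  have "B = 0"
  proof (rule ccontr)
    assume "B \<noteq> 0"
    then show False
      using assms[of "- (A + 1) / (2 * B)"] True by (simp add: field_simps)
  qed
  then show ?thesis using True by simp
next
  case False
  have "0 \<le> C"
  proof (rule ccontr)
    assume "\<not> 0 \<le> C"
    define l where "l = (2 * \<bar>B\<bar> + \<bar>A\<bar> + 1) / (- C) + 1"
    have C: "C < 0" using \<open>\<not> 0 \<le> C\<close> by simp
    have l: "l \<ge> 1" using C divide_nonneg_neg[of "2 * \<bar>B\<bar> + \<bar>A\<bar> + 1" C] by (simp add: l_def)

    have lC: "l * C = - (2 * \<bar>B\<bar> + \<bar>A\<bar> + 1) + C" using C by (simp add: l_def field_simps)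
    have "A + 2 * l * B + l\<^sup>2 * C = A + l * (2 * B + l * C)"
      by (simp add: algebra_simps power2_eq_square)
    also have "\<dots> \<le> A + l * (- \<bar>A\<bar> - 1)"
      using l C by (intro add_left_mono mult_left_mono) (auto simp: lC)
    also have "\<dots> \<le> A + 1 * (- \<bar>A\<bar> - 1)"
      using l by (intro add_left_mono mult_right_mono_neg) auto
    also have "\<dots> < 0" by simp
    finally show False using assms[of l] by simp
  qed
  then have C: "0 < C" using False by simp
  have "0 \<le> A + 2 * (- B / C) * B + (- B / C)\<^sup>2 * C" by (rule assms)
  also have "\<dots> = A - B\<^sup>2 / C" using C by (simp add: field_simps power2_eq_square)
  finally show ?thesis using C by (simp add: field_simps)
qed

text \<open>Nonnegativity of \<open>\<integral> (f + l h)^2\<close> for all \<open>l\<close>.\<close>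

lemma integral_Cauchy_Schwarz:
  fixes f h :: "real \<Rightarrow> real"
  assumes f: "continuous_on {a..b} f" and h: "continuous_on {a..b} h"
  shows "(integral {a..b} (\<lambda>x. f x * h x))\<^sup>2
    \<le> integral {a..b} (\<lambda>x. (f x)\<^sup>2) * integral {a..b} (\<lambda>x. (h x)\<^sup>2)"
proof (rule discriminant_nonpos_if_nonneg)
  fix l :: real
  have i: "(\<lambda>x. (f x)\<^sup>2) integrable_on {a..b}" "(\<lambda>x. f x * h x) integrable_on {a..b}"
    "(\<lambda>x. (h x)\<^sup>2) integrable_on {a..b}"
    by (intro integrable_continuous_interval continuous_intros f h)+
  have "0 \<le> integral {a..b} (\<lambda>x. (f x + l * h x)\<^sup>2)"
    by (rule Henstock_Kurzweil_Integration.integral_nonneg)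
      (auto intro!: integrable_continuous_interval continuous_intros f h)
  also have "(\<lambda>x. (f x + l * h x)\<^sup>2) = (\<lambda>x. (f x)\<^sup>2 + (2 * l) * (f x * h x) + l\<^sup>2 * (h x)\<^sup>2)"
    by (auto simp: power2_eq_square algebra_simps)
  finally have nonneg: "0 \<le> integral {a..b} (\<lambda>x. (f x)\<^sup>2 + (2 * l) * (f x * h x) + l\<^sup>2 * (h x)\<^sup>2)" .
  have "((\<lambda>x. (f x)\<^sup>2 + (2 * l) * (f x * h x) + l\<^sup>2 * (h x)\<^sup>2) has_integral
      integral {a..b} (\<lambda>x. (f x)\<^sup>2) + (2 * l) * integral {a..b} (\<lambda>x. f x * h x)
        + l\<^sup>2 * integral {a..b} (\<lambda>x. (h x)\<^sup>2)) {a..b}"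
    by (intro has_integral_add has_integral_mult_right integrable_integral i)
  from integral_unique[OF this]
  have "integral {a..b} (\<lambda>x. (f x)\<^sup>2 + (2 * l) * (f x * h x) + l\<^sup>2 * (h x)\<^sup>2)
      = integral {a..b} (\<lambda>x. (f x)\<^sup>2) + 2 * l * integral {a..b} (\<lambda>x. f x * h x)
        + l\<^sup>2 * integral {a..b} (\<lambda>x. (h x)\<^sup>2)"
    .
  with nonneg show "0 \<le> integral {a..b} (\<lambda>x. (f x)\<^sup>2) + 2 * l * integral {a..b} (\<lambda>x. f x * h x)
        + l\<^sup>2 * integral {a..b} (\<lambda>x. (h x)\<^sup>2)" by simp
qed

lemma integral_has_derivative_param:
  fixes v vt :: "real \<Rightarrow> real \<Rightarrow> real"
  assumes v: "\<And>x s. x \<in> {a..b} \<Longrightarrow> 0 < s \<Longrightarrow> (v x has_real_derivative vt x s) (at s)"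
    and i: "\<And>s. 0 < s \<Longrightarrow> continuous_on {a..b} (\<lambda>x. v x s)"
    and vt: "continuous_on ({a..b} \<times> {0<..}) (\<lambda>z. vt (fst z) (snd z))"
    and t: "0 < t"
  shows "((\<lambda>s. integral {a..b} (\<lambda>x. v x s)) has_real_derivative
    integral {a..b} (\<lambda>x. vt x t)) (at t)"
proof -
  have "continuous_on ({0<..} \<times> cbox a b) (\<lambda>(s, x). vt x s)"
    using continuous_on_compose2[OF vt, of "{0<..} \<times> cbox a b" "\<lambda>z. (snd z, fst z)"]
    by (force simp: case_prod_unfold intro!: continuous_intros)
  then have "((\<lambda>s. integral (cbox a b) (\<lambda>x. v x s)) has_real_derivative
      integral (cbox a b) (\<lambda>x. vt x t)) (at t within {0<..})"
  proof (intro leibniz_rule_field_derivative[where fx="\<lambda>s x. vt x s"])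
    fix s x assume "s \<in> {0::real<..}" "x \<in> cbox a b"
    then show "((\<lambda>s. v x s) has_real_derivative vt x s) (at s within {0<..})"
      using v[of x s] by (simp add: has_field_derivative_at_within)
  next
    fix s assume "s \<in> {0::real<..}"
    then show "(\<lambda>x. v x s) integrable_on cbox a b"
      using i[of s] by (simp add: integrable_continuous_interval)
  qed (use t in auto)
  moreover have "at t within {0<..} = at t" using t by (intro at_within_open) auto
  ultimately show ?thesis by simp
qed

text \<open>
  The mixed second derivative of \<open>z\<close> need not exist, so one cannot differentiate under the integral.
  Integration by parts in space turns the increment of \<open>1/2 \<integral> d z_x^2\<close> into
  \<open>- 1/2 \<integral> (R(s) + R(t)) (z(s) - z(t))\<close> with \<open>R = (d z_x)_x\<close>. Replacing \<open>R(s)\<close> by \<open>R(t)\<close> leaves the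
  increment of \<open>s \<mapsto> - \<integral> R(t) z(s)\<close>, which only involves \<open>z_t\<close>; the error is \<open>o(\<bar>s - t\<bar>)\<close>,
  since \<open>z\<close> is Lipschitz in time and \<open>R\<close> is continuous.
\<close>

lemma gradient_energy_derivative:
  fixes d :: "real \<Rightarrow> real" and z zx zt R :: "real \<Rightarrow> real \<Rightarrow> real"
  assumes ab: "a \<le> b"
    and zx: "\<And>x s. x \<in> {a..b} \<Longrightarrow> 0 < s \<Longrightarrow>
      ((\<lambda>y. z y s) has_real_derivative zx x s) (at x within {a..b})"
    and zt: "\<And>x s. x \<in> {a..b} \<Longrightarrow> 0 < s \<Longrightarrow> (z x has_real_derivative zt x s) (at s)"
    and R: "\<And>x s. x \<in> {a..b} \<Longrightarrow> 0 < s \<Longrightarrow>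
      ((\<lambda>y. d y * zx y s) has_real_derivative R x s) (at x within {a..b})"
    and bd: "\<And>s. 0 < s \<Longrightarrow> zx a s = 0" "\<And>s. 0 < s \<Longrightarrow> zx b s = 0"
    and d: "continuous_on {a..b} d"
    and czx: "\<And>s. 0 < s \<Longrightarrow> continuous_on {a..b} (\<lambda>x. zx x s)"
    and czt: "continuous_on ({a..b} \<times> {0<..}) (\<lambda>z. zt (fst z) (snd z))"
    and cR: "continuous_on ({a..b} \<times> {0<..}) (\<lambda>z. R (fst z) (snd z))"
    and t: "0 < t"
  shows "((\<lambda>s. 1 / 2 * integral {a..b} (\<lambda>x. d x * (zx x s)\<^sup>2)) has_real_derivative
    - integral {a..b} (\<lambda>x. R x t * zt x t)) (at t)"
proof -
  let ?I = "\<lambda>s. 1 / 2 * integral {a..b} (\<lambda>x. d x * (zx x s)\<^sup>2)"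
  have cR1: "continuous_on {a..b} (\<lambda>x. R x s)" if "0 < s" for s
    using continuous_on_compose2[OF cR, of "{a..b}" "\<lambda>x. (x, s)"] that by (force intro!: continuous_intros)
  have cz: "continuous_on {a..b} (\<lambda>x. z x s)" if "0 < s" for s
    by (rule DERIV_continuous_on[OF zx[OF _ that]])
  define A where "A s = integral {a..b} (\<lambda>x. R x t * z x s)" for s
  define \<rho> where "\<rho> s = - 1 / 2 * integral {a..b} (\<lambda>x. (R x s - R x t) * (z x s - z x t))" for s
  have A: "(A has_real_derivative integral {a..b} (\<lambda>x. R x t * zt x t)) (at t)"
    unfolding A_def[abs_def]
  proof (rule integral_has_derivative_param[where vt = "\<lambda>x s. R x t * zt x s", OF _ _ _ t])
    show "continuous_on ({a..b} \<times> {0<..}) (\<lambda>z. R (fst z) t * zt (fst z) (snd z))"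
      by (intro continuous_intros czt continuous_on_compose2[OF cR1[OF t], of _ fst]) auto
    show "((\<lambda>s. R x t * z x s) has_real_derivative R x t * zt x s) (at s)"
      if "x \<in> {a..b}" "0 < s" for x s
      by (rule DERIV_cmult[OF zt[OF that]])
  qed (intro continuous_intros cR1 cz t; assumption)
  have eq: "?I s - ?I t = - (A s - A t) + \<rho> s" if s: "0 < s" for s
  proof -
    have i: "(\<lambda>x. d x * (zx x s)\<^sup>2) integrable_on {a..b}"
      "(\<lambda>x. d x * (zx x t)\<^sup>2) integrable_on {a..b}"
      "(\<lambda>x. (R x s + R x t) * (z x s - z x t)) integrable_on {a..b}"
      "(\<lambda>x. (R x s - R x t) * (z x s - z x t)) integrable_on {a..b}"
      "(\<lambda>x. R x t * z x s) integrable_on {a..b}" "(\<lambda>x. R x t * z x t) integrable_on {a..b}"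
      by (intro integrable_continuous_interval continuous_intros d czx cR1 cz s t)+
    have "?I s - ?I t = 1 / 2 * integral {a..b} (\<lambda>x. d x * (zx x s)\<^sup>2 - d x * (zx x t)\<^sup>2)"
      using i by (simp add: Henstock_Kurzweil_Integration.integral_diff algebra_simps)
    also have "(\<lambda>x. d x * (zx x s)\<^sup>2 - d x * (zx x t)\<^sup>2)
        = (\<lambda>x. (d x * zx x s + d x * zx x t) * (zx x s - zx x t))"
      by (auto simp: algebra_simps power2_eq_square)
    also have "integral {a..b} \<dots> = - integral {a..b} (\<lambda>x. (R x s + R x t) * (z x s - z x t))"
    proof -
      have "integral {a..b} (\<lambda>x. (R x s + R x t) * (z x s - z x t))
          = - integral {a..b} (\<lambda>x. (d x * zx x s + d x * zx x t) * (zx x s - zx x t))"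
        by (rule integral_by_parts_zero_boundary[OF ab])
          (rule DERIV_add[OF R[OF _ s] R[OF _ t]] DERIV_diff[OF zx[OF _ s] zx[OF _ t]]
            | simp add: bd s t | intro continuous_intros cR1 czx s t)+
      then show ?thesis by simp
    qed
    also have "(\<lambda>x. (R x s + R x t) * (z x s - z x t))
        = (\<lambda>x. 2 * (R x t * z x s - R x t * z x t) + (R x s - R x t) * (z x s - z x t))"
      by (auto simp: algebra_simps)
    also have "integral {a..b} \<dots> = 2 * (A s - A t)
        + integral {a..b} (\<lambda>x. (R x s - R x t) * (z x s - z x t))"
      unfolding A_def using i
      by (subst Henstock_Kurzweil_Integration.integral_add)
        (auto intro!: integrable_diff integrable_on_mult_right
          simp: Henstock_Kurzweil_Integration.integral_diff)
    finally show ?thesis unfolding \<rho>_def by (simp add: field_simps)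
  qed
  obtain B where B: "\<And>x s. x \<in> {a..b} \<Longrightarrow> s \<in> {t / 2..2 * t} \<Longrightarrow> \<bar>zt x s\<bar> \<le> B"
  proof -
    have "compact ((\<lambda>z. zt (fst z) (snd z)) ` ({a..b} \<times> {t / 2..2 * t}))"
      using t by (intro compact_continuous_image continuous_on_subset[OF czt] compact_Times) auto
    then obtain B where "\<forall>y\<in>(\<lambda>z. zt (fst z) (snd z)) ` ({a..b} \<times> {t / 2..2 * t}). \<bar>y\<bar> \<le> B"
      by (auto dest!: compact_imp_bounded simp: bounded_iff)
    then show ?thesis by (intro that[of B]) force
  qed
  have Lip: "\<bar>z x s - z x t\<bar> \<le> B * \<bar>s - t\<bar>" if "x \<in> {a..b}" "s \<in> {t / 2..2 * t}" for x s
  proof -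
    have t': "t \<in> {t / 2..2 * t}" using t by simp
    have D: "(z x has_field_derivative zt x r) (at r within {t / 2..2 * t})"
      if "r \<in> {t / 2..2 * t}" for r
    proof -
      have "0 < r" using that t by simp
      from zt[OF \<open>x \<in> {a..b}\<close> this] show ?thesis by (rule has_field_derivative_at_within)
    qed
    have N: "norm (zt x r) \<le> B" if "r \<in> {t / 2..2 * t}" for r
      using B[OF \<open>x \<in> {a..b}\<close> that] by simp
    have "norm (z x s - z x t) \<le> B * norm (s - t)"
      by (rule field_differentiable_bound[OF convex_real_interval(5) D N \<open>s \<in> {t / 2..2 * t}\<close> t'])
    then show ?thesis by simp
  qed
  define H where "H s = integral {a..b} (\<lambda>x. \<bar>R x s - R x t\<bar>)" for s
  have "continuous_on {0<..} H"
  proof -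
    have "continuous_on ({0<..} \<times> cbox a b) (\<lambda>(s, x). R x s)"
      using continuous_on_compose2[OF cR, of "{0<..} \<times> cbox a b" "\<lambda>z. (snd z, fst z)"]
      by (force simp: case_prod_unfold intro!: continuous_intros)
    then have "continuous_on ({0<..} \<times> cbox a b) (\<lambda>(s, x). \<bar>R x s - R x t\<bar>)"
      unfolding case_prod_unfold
      by (intro continuous_intros continuous_on_compose2[OF cR1[OF t], of _ snd]) auto
    from integral_continuous_on_param[OF this] show ?thesis
      by (simp add: H_def[abs_def])
  qed
  then have H: "(H \<longlongrightarrow> 0) (at t)"
    using t unfolding continuous_on_eq_continuous_at[OF open_greaterThan] isCont_def
    by (auto simp: H_def dest!: bspec[of _ _ t])
  have "((\<lambda>s. \<rho> s / (s - t)) \<longlongrightarrow> 0) (at t)"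
  proof (rule tendsto_rabs_zero_cancel, rule tendsto_sandwich[OF _ _ tendsto_const])
    show "((\<lambda>s. 1 / 2 * (B * H s)) \<longlongrightarrow> 0) (at t)"
      using tendsto_mult_right_zero[OF tendsto_mult_right_zero[OF H], of "1/2" B] by simp
    have "\<forall>\<^sub>F s in at t. s \<in> {t / 2<..<2 * t}"
      using t by (intro eventually_at_in_open') auto
    then show "\<forall>\<^sub>F s in at t. \<bar>\<rho> s / (s - t)\<bar> \<le> 1 / 2 * (B * H s)"
      using eventually_neq_at_within[of t t UNIV]
    proof eventually_elim
      case (elim s)
      then have s: "s \<in> {t / 2..2 * t}" "0 < s" "s \<noteq> t" using t by auto
      have "\<bar>integral {a..b} (\<lambda>x. (R x s - R x t) * (z x s - z x t))\<bar>
          \<le> integral {a..b} (\<lambda>x. \<bar>R x s - R x t\<bar> * (B * \<bar>s - t\<bar>))"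
        unfolding real_norm_def[symmetric]
        using Lip s(1)
        by (intro integral_norm_bound_integral integrable_continuous_interval continuous_intros
            cR1 cz s t) (auto simp: abs_mult intro!: mult_left_mono)
      also have "\<dots> = B * H s * \<bar>s - t\<bar>" by (simp add: H_def)
      finally have "\<bar>\<rho> s\<bar> \<le> 1 / 2 * (B * H s) * \<bar>s - t\<bar>"
        unfolding \<rho>_def by (simp add: abs_mult)
      then show ?case using s by (simp add: abs_divide pos_divide_le_eq)
    qed
  qed auto
  moreover have "((\<lambda>s. (A s - A t) / (s - t)) \<longlongrightarrow> integral {a..b} (\<lambda>x. R x t * zt x t)) (at t)"
    using A by (simp add: has_field_derivative_iff)
  ultimately have "((\<lambda>s. - ((A s - A t) / (s - t)) + \<rho> s / (s - t))
      \<longlongrightarrow> - integral {a..b} (\<lambda>x. R x t * zt x t) + 0) (at t)"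
    by (intro tendsto_intros)
  moreover have "\<forall>\<^sub>F s in at t. s \<in> {0<..}"
    using t by (intro eventually_at_in_open') auto
  then have "\<forall>\<^sub>F s in at t. - ((A s - A t) / (s - t)) + \<rho> s / (s - t) = (?I s - ?I t) / (s - t)"
    by eventually_elim (simp only: greaterThan_iff eq add_divide_distrib minus_divide_left)
  ultimately have "((\<lambda>s. (?I s - ?I t) / (s - t)) \<longlongrightarrow> - integral {a..b} (\<lambda>x. R x t * zt x t) + 0) (at t)"
    by (rule Lim_transform_eventually)
  then show ?thesis by (simp add: has_field_derivative_iff)
qed

section \<open>Energy identities for the regularized system\<close>

text \<open>
  The regularized problem in divergence form: \<open>ut\<close> is the derivative of the flux, and
  \<open>R = (d w_x / sqrt (g w))_x\<close>. In this form no second space derivative of \<open>u\<close>, \<open>w\<close> or \<open>d\<close> occurs.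
\<close>

locale regularized_flow =
  fixes a b e \<gamma>1 \<gamma>2 :: real and d d1 g g1 :: "real \<Rightarrow> real"
    and u ux ut w wx wt R :: "real \<Rightarrow> real \<Rightarrow> real"
  assumes ab: "a < b" and e_pos: "0 < e" and \<gamma>_pos: "0 < \<gamma>1" "0 < \<gamma>2"
    and d_deriv: "\<And>x. x \<in> {a..b} \<Longrightarrow> (d has_real_derivative d1 x) (at x within {a..b})"
    and d1_cont: "continuous_on {a..b} d1"
    and d_pos: "\<And>x. x \<in> {a..b} \<Longrightarrow> 0 < d x"
    and g_deriv: "\<And>s. 0 < s \<Longrightarrow> (g has_real_derivative g1 s) (at s)"
    and g1_cont: "continuous_on {0<..} g1"
    and g1_bound: "\<And>s. 0 < s \<Longrightarrow> \<gamma>1 \<le> g1 s"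
    and g_bounds: "\<And>s. 0 < s \<Longrightarrow> \<gamma>1 * s \<le> g s" "\<And>s. 0 < s \<Longrightarrow> g s \<le> \<gamma>2 * s"
    and u_pos: "\<And>x t. x \<in> {a..b} \<Longrightarrow> 0 < t \<Longrightarrow> 0 < u x t"
    and w_pos: "\<And>x t. x \<in> {a..b} \<Longrightarrow> 0 < t \<Longrightarrow> 0 < w x t"
    and u_dx: "\<And>x t. x \<in> {a..b} \<Longrightarrow> 0 < t \<Longrightarrow>
      ((\<lambda>y. u y t) has_real_derivative ux x t) (at x within {a..b})"
    and w_dx: "\<And>x t. x \<in> {a..b} \<Longrightarrow> 0 < t \<Longrightarrow>
      ((\<lambda>y. w y t) has_real_derivative wx x t) (at x within {a..b})"
    and u_dt: "\<And>x t. x \<in> {a..b} \<Longrightarrow> 0 < t \<Longrightarrow> (u x has_real_derivative ut x t) (at t)"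
    and w_dt: "\<And>x t. x \<in> {a..b} \<Longrightarrow> 0 < t \<Longrightarrow> (w x has_real_derivative wt x t) (at t)"
    and u_cont: "continuous_on ({a..b} \<times> {0<..}) (\<lambda>z. u (fst z) (snd z))"
    and ux_cont: "continuous_on ({a..b} \<times> {0<..}) (\<lambda>z. ux (fst z) (snd z))"
    and ut_cont: "continuous_on ({a..b} \<times> {0<..}) (\<lambda>z. ut (fst z) (snd z))"
    and w_cont: "continuous_on ({a..b} \<times> {0<..}) (\<lambda>z. w (fst z) (snd z))"
    and wx_cont: "continuous_on ({a..b} \<times> {0<..}) (\<lambda>z. wx (fst z) (snd z))"
    and wt_cont: "continuous_on ({a..b} \<times> {0<..}) (\<lambda>z. wt (fst z) (snd z))"
    and R_cont: "continuous_on ({a..b} \<times> {0<..}) (\<lambda>z. R (fst z) (snd z))"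
    and flux_dx: "\<And>x t. x \<in> {a..b} \<Longrightarrow> 0 < t \<Longrightarrow>
      ((\<lambda>y. d1 y * u y t + d y * ux y t - d y * u y t * wx y t)
        has_real_derivative ut x t) (at x within {a..b})"
    and R_dx: "\<And>x t. x \<in> {a..b} \<Longrightarrow> 0 < t \<Longrightarrow>
      ((\<lambda>y. d y * (wx y t / sqrt (g (w y t)))) has_real_derivative R x t) (at x within {a..b})"
    and wt_eq: "\<And>x t. x \<in> {a..b} \<Longrightarrow> 0 < t \<Longrightarrow> wt x t = e * R x t - u x t * g (w x t)"
    and boundary: "d1 a = 0" "d1 b = 0"
      "\<And>t. 0 < t \<Longrightarrow> ux a t = 0" "\<And>t. 0 < t \<Longrightarrow> ux b t = 0"
      "\<And>t. 0 < t \<Longrightarrow> wx a t = 0" "\<And>t. 0 < t \<Longrightarrow> wx b t = 0"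
begin

text \<open>
  Membership in the space interval stays atomic, so that the pointwise hypotheses apply as they
  stand.
\<close>

declare atLeastAtMost_iff [simp del]

lemma endpoints: "a \<in> {a..b}" "b \<in> {a..b}"
  using ab by (auto simp: atLeastAtMost_iff)

definition flux :: "real \<Rightarrow> real \<Rightarrow> real" where
  "flux x t = d1 x * u x t + d x * ux x t - d x * u x t * wx x t"

text \<open>
  The entropy production \<open>\<integral> U_x^2 / U\<close> for \<open>U = d u\<close>, with the derivative of \<open>d u\<close> written out.
\<close>

definition production :: "real \<Rightarrow> real" where
  "production t = integral {a..b} (\<lambda>x. (d1 x * u x t + d x * ux x t)\<^sup>2 / (d x * u x t))"

definition drift :: "real \<Rightarrow> real" where
  "drift t = integral {a..b} (\<lambda>x. d x * u x t * (wx x t)\<^sup>2)"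

text \<open>
  The weight \<open>1/\<gamma>1\<close> is the one for which the decrease of the last integral compensates the
  indefinite term in the derivative of the first two.
\<close>

definition energy :: "real \<Rightarrow> real" where
  "energy t = integral {a..b} (\<lambda>x. u x t * ln (d x * u x t))
    + 1 / 2 * integral {a..b} (\<lambda>x. d x * (wx x t)\<^sup>2 / g (w x t))
    + 1 / \<gamma>1 * integral {a..b} (\<lambda>x. (d1 x)\<^sup>2 / d x * w x t)"

lemma g_pos: "0 < s \<Longrightarrow> 0 < g s"
  using g_bounds(1)[of s] \<gamma>_pos(1) by (smt (verit) mult_pos_pos)

lemma d_cont: "continuous_on {a..b} d"
  by (rule DERIV_continuous_on[OF d_deriv])

lemma g_cont: "continuous_on {0<..} g"
  by (rule DERIV_continuous_on[where D=g1]) (simp add: g_deriv has_field_derivative_at_within)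

lemma d_cont2: "continuous_on ({a..b} \<times> {0<..}) (\<lambda>z. d (fst z))"
  and d1_cont2: "continuous_on ({a..b} \<times> {0<..}) (\<lambda>z. d1 (fst z))"
  by (rule continuous_on_compose2[OF d_cont] continuous_on_compose2[OF d1_cont];
      auto intro!: continuous_intros)+

lemma g_cont2: "continuous_on ({a..b} \<times> {0<..}) (\<lambda>z. g (w (fst z) (snd z)))"
  and g1_cont2: "continuous_on ({a..b} \<times> {0<..}) (\<lambda>z. g1 (w (fst z) (snd z)))"
  by (rule continuous_on_compose2[OF g_cont w_cont] continuous_on_compose2[OF g1_cont w_cont];
      auto intro!: w_pos)+

lemma flux_cont: "continuous_on ({a..b} \<times> {0<..}) (\<lambda>z. flux (fst z) (snd z))"
  unfolding flux_def
  by (intro continuous_intros u_cont ux_cont wx_cont d_cont2 d1_cont2)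

lemma slice:
  assumes "continuous_on ({a..b} \<times> {0<..}) (\<lambda>z. f (fst z) (snd z))" "0 < t"
  shows "continuous_on {a..b} (\<lambda>x. f x t)"
  using continuous_on_compose2[OF assms(1), of "{a..b}" "\<lambda>x. (x, t)"] assms(2)
  by (force intro!: continuous_intros)

lemmas conts = d_cont d1_cont u_cont[THEN slice] ux_cont[THEN slice] ut_cont[THEN slice]
  w_cont[THEN slice] wx_cont[THEN slice] wt_cont[THEN slice] R_cont[THEN slice]
  g_cont2[THEN slice] g1_cont2[THEN slice] flux_cont[THEN slice]

lemmas conts2 = d_cont2 d1_cont2 u_cont ux_cont ut_cont w_cont wx_cont wt_cont R_cont
  g_cont2 g1_cont2 flux_cont

lemma flux_boundary: "0 < t \<Longrightarrow> flux a t = 0" "0 < t \<Longrightarrow> flux b t = 0"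
  by (auto simp: flux_def boundary)

lemma nonzero: "x \<in> {a..b} \<Longrightarrow> d x \<noteq> 0" "x \<in> {a..b} \<Longrightarrow> 0 < t \<Longrightarrow> u x t \<noteq> 0"
  "x \<in> {a..b} \<Longrightarrow> 0 < t \<Longrightarrow> w x t \<noteq> 0" "x \<in> {a..b} \<Longrightarrow> 0 < t \<Longrightarrow> g (w x t) \<noteq> 0"
  using d_pos u_pos w_pos g_pos by (auto simp: less_le)

lemma weighted_mass_derivative:
  assumes \<phi>: "\<And>x. x \<in> {a..b} \<Longrightarrow> (\<phi> has_real_derivative \<phi>1 x) (at x within {a..b})"
    and \<phi>1: "continuous_on {a..b} \<phi>1" and t: "0 < t"
  shows "((\<lambda>s. integral {a..b} (\<lambda>x. u x s * \<phi> x)) has_real_derivative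
    - integral {a..b} (\<lambda>x. flux x t * \<phi>1 x)) (at t)"
proof -
  have c: "continuous_on {a..b} \<phi>" by (rule DERIV_continuous_on[OF \<phi>])
  have "((\<lambda>s. integral {a..b} (\<lambda>x. u x s * \<phi> x)) has_real_derivative
      integral {a..b} (\<lambda>x. ut x t * \<phi> x)) (at t)"
  proof (rule integral_has_derivative_param[OF _ _ _ t])
    show "continuous_on ({a..b} \<times> {0<..}) (\<lambda>z. ut (fst z) (snd z) * \<phi> (fst z))"
      by (intro continuous_intros conts2 continuous_on_compose2[OF c, of _ fst]) auto
  qed (auto intro!: derivative_eq_intros u_dt continuous_intros conts c)
  also have "integral {a..b} (\<lambda>x. ut x t * \<phi> x) = - integral {a..b} (\<lambda>x. flux x t * \<phi>1 x)"
    using t ab flux_dx[of _ t, folded flux_def] flux_boundary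
    by (intro integral_by_parts_zero_boundary \<phi> \<phi>1 conts) auto
  finally show ?thesis .
qed

lemma mass_derivative: "0 < t \<Longrightarrow> ((\<lambda>s. integral {a..b} (\<lambda>x. u x s)) has_real_derivative 0) (at t)"
  using weighted_mass_derivative[of "\<lambda>_. 1" "\<lambda>_. 0" t] by simp

lemma entropy_derivative:
  assumes t: "0 < t"
  shows "((\<lambda>s. integral {a..b} (\<lambda>x. u x s * ln (d x * u x s))) has_real_derivative
    - production t + integral {a..b} (\<lambda>x. (d1 x * u x t + d x * ux x t) * wx x t)) (at t)"
proof -
  have "((\<lambda>s. integral {a..b} (\<lambda>x. u x s * ln (d x * u x s))) has_real_derivative
      integral {a..b} (\<lambda>x. ut x t * (ln (d x * u x t) + 1))) (at t)"
  proof (rule integral_has_derivative_param[OF _ _ _ t])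
    show "continuous_on ({a..b} \<times> {0<..})
        (\<lambda>z. ut (fst z) (snd z) * (ln (d (fst z) * u (fst z) (snd z)) + 1))"
      by (intro continuous_intros conts2) (auto simp: nonzero)
    show "((\<lambda>s. u x s * ln (d x * u x s)) has_real_derivative
        ut x s * (ln (d x * u x s) + 1)) (at s)" if "x \<in> {a..b}" "0 < s" for x s
      using that by (auto intro!: derivative_eq_intros u_dt simp: nonzero u_pos d_pos field_simps)
  qed (auto intro!: continuous_intros conts simp: nonzero)
  also have "integral {a..b} (\<lambda>x. ut x t * (ln (d x * u x t) + 1))
      = - integral {a..b} (\<lambda>x. flux x t * ((d1 x * u x t + d x * ux x t) / (d x * u x t)))"
    using t ab flux_dx[of _ t, folded flux_def] flux_boundary
    by (intro integral_by_parts_zero_boundary conts continuous_intros)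
      (auto intro!: derivative_eq_intros d_deriv u_dx simp: nonzero d_pos u_pos field_simps)
  also have "\<dots> = - integral {a..b} (\<lambda>x. (d1 x * u x t + d x * ux x t)\<^sup>2 / (d x * u x t)
      - (d1 x * u x t + d x * ux x t) * wx x t)"
    using t by (intro arg_cong[where f=uminus] integral_cong)
      (auto simp: flux_def nonzero field_simps power2_eq_square)
  also have "\<dots> = - production t + integral {a..b} (\<lambda>x. (d1 x * u x t + d x * ux x t) * wx x t)"
    unfolding production_def using t
    by (subst Henstock_Kurzweil_Integration.integral_diff)
      (auto intro!: integrable_continuous_interval continuous_intros conts simp: nonzero)
  finally show ?thesis .
qed

text \<open>
  The artificial diffusion has the factor \<open>1 / sqrt (g w)\<close> so that \<open>w_x / sqrt (g w)\<close> is the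
  gradient \<open>z_x\<close> of \<open>z = G(w)\<close> with \<open>G' = 1 / sqrt g\<close>, and \<open>(d z_x)_x\<close> appears in the equation of \<open>w\<close>.
\<close>

lemma gradient_derivative:
  assumes t: "0 < t"
  shows "((\<lambda>s. 1 / 2 * integral {a..b} (\<lambda>x. d x * (wx x s)\<^sup>2 / g (w x s))) has_real_derivative
    - e * integral {a..b} (\<lambda>x. (R x t)\<^sup>2 / sqrt (g (w x t)))
    - integral {a..b} (\<lambda>x. d x * ux x t * wx x t)
    - 1 / 2 * integral {a..b} (\<lambda>x. g1 (w x t) / g (w x t) * (d x * u x t * (wx x t)\<^sup>2))) (at t)"
proof -
  have "isCont (\<lambda>s. 1 / sqrt (g s)) s" if "0 < ereal s" "ereal s < \<infinity>" for s
  proof -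
    have "isCont g s" using that DERIV_isCont[OF g_deriv[of s]] by simp
    then show ?thesis using that g_pos[of s] by (auto intro!: continuous_intros)
  qed
  from einterval_antiderivative[of 0 \<infinity>, OF _ this]
  obtain G where G: "\<And>s. 0 < s \<Longrightarrow> (G has_real_derivative 1 / sqrt (g s)) (at s)"
    by (auto simp: has_real_derivative_iff_has_vector_derivative)
  have cs: "continuous_on ({a..b} \<times> {0<..}) (\<lambda>z. sqrt (g (w (fst z) (snd z))))"
    by (intro continuous_intros conts2)
  note cs' = cs[THEN slice[of "\<lambda>x t. sqrt (g (w x t))"]]
  have "((\<lambda>s. 1 / 2 * integral {a..b} (\<lambda>x. d x * (wx x s / sqrt (g (w x s)))\<^sup>2)) has_real_derivative
      - integral {a..b} (\<lambda>x. R x t * (wt x t / sqrt (g (w x t))))) (at t)"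
  proof (rule gradient_energy_derivative[where z = "\<lambda>x t. G (w x t)"])
    fix x s assume x: "x \<in> {a..b}" and s: "(0::real) < s"
    show "((\<lambda>y. G (w y s)) has_real_derivative wx x s / sqrt (g (w x s))) (at x within {a..b})"
      using DERIV_chain2[OF G[OF w_pos[OF x s]] w_dx[OF x s]] by simp
    show "((\<lambda>s. G (w x s)) has_real_derivative wt x s / sqrt (g (w x s))) (at s)"
      using DERIV_chain2[OF G[OF w_pos[OF x s]] w_dt[OF x s]] by simp
  qed (use ab R_dx t in \<open>auto intro!: continuous_intros conts conts2 cs cs' simp: boundary nonzero\<close>)
  moreover have "(\<lambda>s. 1 / 2 * integral {a..b} (\<lambda>x. d x * (wx x s)\<^sup>2 / g (w x s))) s
      = 1 / 2 * integral {a..b} (\<lambda>x. d x * (wx x s / sqrt (g (w x s)))\<^sup>2)" if "s \<in> {0<..}" for s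
    using that w_pos g_pos
    by (auto intro!: integral_cong simp: power_divide less_imp_le)
  ultimately have "((\<lambda>s. 1 / 2 * integral {a..b} (\<lambda>x. d x * (wx x s)\<^sup>2 / g (w x s)))
      has_real_derivative - integral {a..b} (\<lambda>x. R x t * (wt x t / sqrt (g (w x t))))) (at t)"
    using t by (subst DERIV_cong_ev[OF refl _ refl]) (auto intro!: eventually_nhds_in_open
        eventually_mono[OF eventually_nhds_in_open[of "{0<..}"]])
  moreover have "integral {a..b} (\<lambda>x. R x t * (wt x t / sqrt (g (w x t))))
      = integral {a..b} (\<lambda>x. e * ((R x t)\<^sup>2 / sqrt (g (w x t))) - R x t * (u x t * sqrt (g (w x t))))"
  proof (intro integral_cong)
    fix x assume x: "x \<in> {a..b}"
    have s: "0 < g (w x t)" using g_pos w_pos x t by auto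
    define r where "r = sqrt (g (w x t))"
    have r: "g (w x t) = r * r" "r \<noteq> 0" using s by (auto simp: r_def)
    show "R x t * (wt x t / sqrt (g (w x t)))
        = e * ((R x t)\<^sup>2 / sqrt (g (w x t))) - R x t * (u x t * sqrt (g (w x t)))"
      unfolding wt_eq[OF x t] r_def[symmetric] using r by (simp add: field_simps power2_eq_square)
  qed
  moreover have "\<dots> = e * integral {a..b} (\<lambda>x. (R x t)\<^sup>2 / sqrt (g (w x t)))
      - integral {a..b} (\<lambda>x. R x t * (u x t * sqrt (g (w x t))))"
    using t by (subst Henstock_Kurzweil_Integration.integral_diff)
      (auto intro!: integrable_continuous_interval continuous_intros conts cs' simp: nonzero simp del: times_divide_eq_right)
  moreover have "integral {a..b} (\<lambda>x. R x t * (u x t * sqrt (g (w x t))))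
      = - integral {a..b} (\<lambda>x. d x * (wx x t / sqrt (g (w x t))) *
          (ux x t * sqrt (g (w x t)) + u x t * (g1 (w x t) * wx x t / (2 * sqrt (g (w x t))))))"
  proof (rule integral_by_parts_zero_boundary)
    fix x assume x: "x \<in> {a..b}"
    have g: "0 < g (w x t)" using g_pos w_pos x t by auto
    have "((\<lambda>y. g (w y t)) has_real_derivative g1 (w x t) * wx x t) (at x within {a..b})"
      using DERIV_chain2[OF g_deriv[OF w_pos[OF x t]] w_dx[OF x t]] .
    then show "((\<lambda>x. u x t * sqrt (g (w x t))) has_real_derivative
      ux x t * sqrt (g (w x t)) + u x t * (g1 (w x t) * wx x t / (2 * sqrt (g (w x t)))))
        (at x within {a..b})"
      using g by (auto intro!: derivative_eq_intros u_dx x t simp: field_simps)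
  qed (use ab R_dx t in \<open>auto intro!: continuous_intros conts cs' simp: boundary nonzero\<close>)
  moreover have "\<dots> = - integral {a..b} (\<lambda>x. d x * ux x t * wx x t
      + 1 / 2 * (g1 (w x t) / g (w x t) * (d x * u x t * (wx x t)\<^sup>2)))"
  proof (intro arg_cong[where f=uminus] integral_cong)
    fix x assume x: "x \<in> {a..b}"
    have s: "0 < g (w x t)" using g_pos w_pos x t by auto
    define r where "r = sqrt (g (w x t))"
    have r: "g (w x t) = r * r" "r \<noteq> 0" using s by (auto simp: r_def)
    show "d x * (wx x t / sqrt (g (w x t))) *
          (ux x t * sqrt (g (w x t)) + u x t * (g1 (w x t) * wx x t / (2 * sqrt (g (w x t)))))
        = d x * ux x t * wx x t + 1 / 2 * (g1 (w x t) / g (w x t) * (d x * u x t * (wx x t)\<^sup>2))"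
      unfolding r_def[symmetric] using r by (simp add: field_simps power2_eq_square)
  qed
  moreover have "\<dots> = - (integral {a..b} (\<lambda>x. d x * ux x t * wx x t)
      + 1 / 2 * integral {a..b} (\<lambda>x. g1 (w x t) / g (w x t) * (d x * u x t * (wx x t)\<^sup>2)))"
    by (rule arg_cong[where f=uminus], rule integral_unique, intro has_integral_add
        has_integral_mult_right integrable_integral integrable_continuous_interval
        continuous_intros conts t) (auto simp: nonzero t)
  ultimately show ?thesis by (simp add: algebra_simps)
qed

lemma weighted_nutrient_derivative:
  assumes p: "continuous_on {a..b} p" and t: "0 < t"
  shows "((\<lambda>s. integral {a..b} (\<lambda>x. p x * w x s)) has_real_derivative
    e * integral {a..b} (\<lambda>x. p x * R x t) - integral {a..b} (\<lambda>x. p x * (u x t * g (w x t)))) (at t)"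
proof -
  have "((\<lambda>s. integral {a..b} (\<lambda>x. p x * w x s)) has_real_derivative
      integral {a..b} (\<lambda>x. p x * wt x t)) (at t)"
  proof (rule integral_has_derivative_param[OF _ _ _ t])
    show "continuous_on ({a..b} \<times> {0<..}) (\<lambda>z. p (fst z) * wt (fst z) (snd z))"
      by (intro continuous_intros conts2 continuous_on_compose2[OF p, of _ fst]) auto
  qed (auto intro!: derivative_eq_intros w_dt continuous_intros conts p)
  also have "integral {a..b} (\<lambda>x. p x * wt x t)
      = integral {a..b} (\<lambda>x. e * (p x * R x t) - p x * (u x t * g (w x t)))"
    using t by (intro integral_cong) (simp add: wt_eq algebra_simps)
  also have "\<dots> = e * integral {a..b} (\<lambda>x. p x * R x t) - integral {a..b} (\<lambda>x. p x * (u x t * g (w x t)))"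
    using t by (subst Henstock_Kurzweil_Integration.integral_diff)
      (auto intro!: integrable_continuous_interval continuous_intros conts p)
  finally show ?thesis .
qed

lemma nutrient_derivative:
  assumes t: "0 < t"
  shows "((\<lambda>s. integral {a..b} (\<lambda>x. w x s)) has_real_derivative
    - integral {a..b} (\<lambda>x. u x t * g (w x t))) (at t)"
proof -
  have "integral {a..b} (\<lambda>x. R x t * 1)
      = - integral {a..b} (\<lambda>x. d x * (wx x t / sqrt (g (w x t))) * 0)"
    using t ab by (intro integral_by_parts_zero_boundary[OF _ R_dx])
      (auto simp: boundary intro!: conts)
  then show ?thesis using weighted_nutrient_derivative[of "\<lambda>_. 1" t] t by simp
qed

end

section \<open>Functionals controlled by a dissipation rate\<close>

lemma abs_diff_le_integral_abs_deriv:
  fixes F :: "real \<Rightarrow> real"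
  assumes F: "\<And>x. x \<in> {a..b} \<Longrightarrow> (F has_real_derivative F' x) (at x within {a..b})"
    and F': "continuous_on {a..b} F'" and xy: "a \<le> y" "y \<le> x" "x \<le> b"
  shows "\<bar>F x - F y\<bar> \<le> integral {y..x} (\<lambda>s. \<bar>F' s\<bar>)"
proof -
  have sub: "{y..x} \<subseteq> {a..b}" using xy by auto
  have "(F' has_integral F x - F y) {y..x}"
  proof (rule fundamental_theorem_of_calculus[OF xy(2)])
    fix s assume "s \<in> {y..x}"
    then show "(F has_vector_derivative F' s) (at s within {y..x})"
      using DERIV_subset[OF F sub] sub
      by (auto simp flip: has_real_derivative_iff_has_vector_derivative)
  qed
  then have "\<bar>F x - F y\<bar> = norm (integral {y..x} F')" by (simp add: integral_unique)
  also have "\<dots> \<le> integral {y..x} (\<lambda>s. \<bar>F' s\<bar>)"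
    using continuous_on_subset[OF F' sub]
    by (intro integral_norm_bound_integral integrable_continuous_interval continuous_intros) auto
  finally show ?thesis .
qed

text \<open>Young's inequality with a free parameter, optimised over the parameter.\<close>

lemma Young_optimised:
  fixes A X \<Delta> :: real
  assumes "\<And>l. 0 < l \<Longrightarrow> X \<le> A / 2 * (l * \<Delta> + 1 / l)" and "0 \<le> A" "0 \<le> \<Delta>"
  shows "X \<le> A * sqrt \<Delta>"
proof (cases "\<Delta> = 0")
  case True
  have "X \<le> 0"
  proof (rule field_le_epsilon)
    fix r :: real assume r: "0 < r"
    have "X \<le> A / 2 * (1 / ((A + 1) / r))"
      using assms(1)[of "(A + 1) / r"] True assms(2) r by simp
    also have "\<dots> = r * (A / (2 * (A + 1)))" using assms(2) r by (simp add: field_simps)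
    also have "\<dots> \<le> r * 1" using r assms(2) by (intro mult_left_mono) auto
    finally show "X \<le> 0 + r" by simp
  qed
  then show ?thesis using True by simp
next
  case False
  then have \<Delta>: "0 < \<Delta>" using assms by simp
  define r where "r = sqrt \<Delta>"
  have r: "0 < r" "\<Delta> = r * r" using \<Delta> by (auto simp: r_def)
  have "X \<le> A / 2 * (1 / r * \<Delta> + 1 / (1 / r))" using r by (intro assms(1)) simp
  also have "\<dots> = A * r" using r by (simp add: field_simps)
  finally show ?thesis by (simp add: r_def)
qed

text \<open>
  By the mean value theorem there is a time \<open>s\<close> in the unit interval before \<open>t\<close> at which \<open>D\<close> is at
  most the drop of \<open>E\<close>, so that \<open>H s\<close> is near \<open>c\<close>. From \<open>s\<close> to \<open>t\<close> the function \<open>H\<close> varies at most by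
  \<open>A1\<close> times the integral of \<open>sqrt D\<close>. To bound this by the root of the drop without integrating over
  time, \<open>sqrt D\<close> is replaced by \<open>(l D + 1/l)/2\<close>, so that a combination of \<open>H\<close>, \<open>E\<close> and a linear
  function becomes monotone, and \<open>l\<close> is optimised.
\<close>

lemma dissipation_controls_distance:
  fixes H H' E E' D :: "real \<Rightarrow> real"
  assumes H: "\<And>s. s \<in> {t - 1..t} \<Longrightarrow> (H has_real_derivative H' s) (at s)"
    and E: "\<And>s. s \<in> {t - 1..t} \<Longrightarrow> (E has_real_derivative E' s) (at s)"
    and E': "\<And>s. s \<in> {t - 1..t} \<Longrightarrow> E' s \<le> - D s"
    and D: "\<And>s. s \<in> {t - 1..t} \<Longrightarrow> 0 \<le> D s"
    and H': "\<And>s. s \<in> {t - 1..t} \<Longrightarrow> \<bar>H' s\<bar> \<le> A1 * sqrt (D s)"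
    and c: "\<And>s. s \<in> {t - 1..t} \<Longrightarrow> \<bar>H s - c\<bar> \<le> A2 * sqrt (D s)"
    and A: "0 \<le> A1" "0 \<le> A2"
  shows "(H t - c)\<^sup>2 \<le> (A1 + A2)\<^sup>2 * (E (t - 1) - E t)"
proof -
  let ?\<Delta> = "E (t - 1) - E t"
  have mono: "E r \<le> E s" if "t - 1 \<le> s" "s \<le> r" "r \<le> t" for s r
  proof (rule DERIV_nonpos_imp_nonincreasing[OF that(2)])
    fix x assume "s \<le> x" "x \<le> r"
    then have x: "x \<in> {t - 1..t}" using that by auto
    have "E' x \<le> 0" using E'[OF x] D[OF x] by simp
    with E[OF x] show "\<exists>y. (E has_real_derivative y) (at x) \<and> y \<le> 0" by blast
  qed
  have \<Delta>: "0 \<le> ?\<Delta>" using mono[of "t - 1" t] by simp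
  obtain s where s: "t - 1 < s" "s < t" "?\<Delta> = - E' s"
  proof -
    have "\<exists>z>t - 1. z < t \<and> E t - E (t - 1) = (t - (t - 1)) * E' z"
      using E by (intro MVT2) auto
    then show ?thesis using that by auto
  qed
  then have s': "s \<in> {t - 1..t}" by simp
  have "D s \<le> ?\<Delta>" using E'[OF s'] s(3) by simp
  then have "A2 * sqrt (D s) \<le> A2 * sqrt ?\<Delta>" using A(2) by (intro mult_left_mono) auto
  with c[OF s'] have 1: "\<bar>H s - c\<bar> \<le> A2 * sqrt ?\<Delta>" by simp
  have 2: "\<sigma> * (H t - H s) \<le> A1 * sqrt ?\<Delta>" if \<sigma>: "\<bar>\<sigma>\<bar> = 1" for \<sigma> :: real
  proof (rule Young_optimised[OF _ A(1) \<Delta>])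
    fix l :: real assume l: "0 < l"
    let ?P = "\<lambda>r. \<sigma> * H r + A1 / 2 * (l * E r - r / l)"
    have "?P t \<le> ?P s"
    proof (rule DERIV_nonpos_imp_nonincreasing[where f = ?P])
      fix x assume "s \<le> x" "x \<le> t"
      then have x: "x \<in> {t - 1..t}" using s' by auto
      have "(?P has_real_derivative \<sigma> * H' x + A1 / 2 * (l * E' x - 1 / l)) (at x)"
        using l by (auto intro!: derivative_eq_intros H[OF x] E[OF x])
      moreover have "\<sigma> * H' x + A1 / 2 * (l * E' x - 1 / l) \<le> 0"
      proof -
        have "0 \<le> (l * sqrt (D x) - 1)\<^sup>2" by simp
        then have "2 * l * sqrt (D x) \<le> l * (l * D x) + 1"
          using D[OF x] by (simp add: power2_diff power_mult_distrib) (simp add: power2_eq_square)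
        then have "2 * sqrt (D x) \<le> l * D x + 1 / l" using l by (simp add: field_simps)
        also have "\<dots> \<le> - l * E' x + 1 / l"
          using mult_left_mono[OF E'[OF x], of l] l by simp
        finally have "A1 / 2 * (2 * sqrt (D x)) \<le> A1 / 2 * (- l * E' x + 1 / l)"
          using A(1) by (intro mult_left_mono) auto
        moreover have "\<sigma> * H' x \<le> A1 * sqrt (D x)"
          using H'[OF x] abs_le_D1[of "\<sigma> * H' x"] \<sigma> by (simp add: abs_mult)
        ultimately show ?thesis by (simp add: algebra_simps)
      qed
      ultimately show "\<exists>y. (?P has_real_derivative y) (at x) \<and> y \<le> 0" by blast
    qed (use s in simp)
    then have "\<sigma> * (H t - H s) \<le> A1 / 2 * (l * (E s - E t) + (t - s) / l)"
      by (simp add: algebra_simps diff_divide_distrib)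
    also have "\<dots> \<le> A1 / 2 * (l * ?\<Delta> + 1 / l)"
      using A(1) l mono[of "t - 1" s] s
      by (intro mult_left_mono add_mono divide_right_mono) auto
    finally show "\<sigma> * (H t - H s) \<le> A1 / 2 * (l * ?\<Delta> + 1 / l)" .
  qed
  have "\<bar>H t - c\<bar> \<le> (A1 + A2) * sqrt ?\<Delta>"
    using 1 2[of 1] 2[of "-1"] by (auto simp: algebra_simps abs_le_iff)
  then have "\<bar>H t - c\<bar>\<^sup>2 \<le> ((A1 + A2) * sqrt ?\<Delta>)\<^sup>2" by (intro power_mono) auto
  then show ?thesis using \<Delta> by (simp add: power_mult_distrib)
qed

section \<open>The energy inequality\<close>

context regularized_flow begin

text \<open>
  Two squares are completed: the first absorbs \<open>d_x u w_x\<close> into half of the drift term and into the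
  consumption of the weighted nutrient, the second absorbs the artificial diffusion of the weighted
  nutrient into that of the gradient, up to a term without \<open>w_x\<close> and \<open>R\<close>.
\<close>

lemma energy_dissipation_pointwise:
  fixes D D1 U W G G1 r Rr P :: real
  assumes pos: "0 < D" "0 < U" "0 < G" "\<gamma>1 \<le> G1" and r: "r = sqrt G" and P: "P = D1\<^sup>2 / D"
  shows "D1 * U * W - e * (Rr\<^sup>2 / r) - 1 / 2 * (G1 / G * (D * U * W\<^sup>2))
      + 1 / \<gamma>1 * (e * (P * Rr) - P * (U * G))
    \<le> - 1 / 4 * (G1 / G * (D * U * W\<^sup>2)) + e / (4 * \<gamma>1\<^sup>2) * (P\<^sup>2 * r)"
proof -
  have G1: "0 < G1" using pos \<gamma>_pos by linarith
  have r0: "0 < r" using pos r by simp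
  have "0 \<le> U / (4 * G1 * G * D) * (G1 * D * W - 2 * G * D1)\<^sup>2"
    using pos G1 by simp
  also have "\<dots> = 1 / 4 * (G1 / G * (D * U * W\<^sup>2)) + 1 / G1 * (P * (U * G)) - D1 * U * W"
    using pos G1 unfolding P by (simp add: field_simps power2_eq_square)
  finally have 1: "D1 * U * W \<le> 1 / 4 * (G1 / G * (D * U * W\<^sup>2)) + 1 / G1 * (P * (U * G))" by simp
  have "0 \<le> P * (U * G)" using pos unfolding P by simp
  moreover have "1 / G1 \<le> 1 / \<gamma>1" using pos \<gamma>_pos by (simp add: frac_le)
  ultimately have 2: "1 / G1 * (P * (U * G)) \<le> 1 / \<gamma>1 * (P * (U * G))"
    by (rule mult_right_mono[rotated])
  have "0 \<le> e * ((2 * \<gamma>1 * Rr - P * r)\<^sup>2 / (4 * \<gamma>1\<^sup>2 * r))"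
    using e_pos r0 by simp
  also have "\<dots> = e * (Rr\<^sup>2 / r) - 1 / \<gamma>1 * (e * (P * Rr)) + e / (4 * \<gamma>1\<^sup>2) * (P\<^sup>2 * r)"
    using r0 \<gamma>_pos by (simp add: field_simps power2_eq_square)
  finally have 3: "1 / \<gamma>1 * (e * (P * Rr)) \<le> e * (Rr\<^sup>2 / r) + e / (4 * \<gamma>1\<^sup>2) * (P\<^sup>2 * r)" by simp
  have "1 / \<gamma>1 * (e * (P * Rr) - P * (U * G)) = 1 / \<gamma>1 * (e * (P * Rr)) - 1 / \<gamma>1 * (P * (U * G))"
    by (simp add: right_diff_distrib)
  then show ?thesis using 1 2 3 by linarith
qed

text \<open>
  A bound for what the artificial diffusion adds to the derivative of the energy while \<open>w \<le> M\<close>. The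
  approximations of \<open>d\<close> are chosen such that this is of order \<open>sqrt e\<close>.
\<close>

definition remainder :: "real \<Rightarrow> real" where
  "remainder M = sqrt (\<gamma>2 * M) / (4 * \<gamma>1\<^sup>2) * (e * integral {a..b} (\<lambda>x. ((d1 x)\<^sup>2 / d x)\<^sup>2))"

lemma energy_inequality:
  assumes t: "0 < t" and M: "\<And>x. x \<in> {a..b} \<Longrightarrow> w x t \<le> M"
  obtains E' where "(energy has_real_derivative E') (at t)"
    and "E' \<le> - production t - \<gamma>1 / (4 * \<gamma>2 * M) * drift t + remainder M"
proof -
  let ?P = "\<lambda>x. (d1 x)\<^sup>2 / d x"
  let ?c = "sqrt (\<gamma>2 * M) / (4 * \<gamma>1\<^sup>2)"
  have M0: "0 < M" using M[OF endpoints(1)] w_pos[OF endpoints(1) t] by linarith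
  have cs: "continuous_on ({a..b} \<times> {0<..}) (\<lambda>z. sqrt (g (w (fst z) (snd z))))"
    by (intro continuous_intros conts2)
  note cs' = cs[THEN slice[of "\<lambda>x t. sqrt (g (w x t))"]]
  have cP: "continuous_on {a..b} ?P" by (intro continuous_intros conts) (auto simp: nonzero)
  let ?E'' = "integral {a..b} (\<lambda>x. (d1 x * u x t + d x * ux x t) * wx x t)
      - e * integral {a..b} (\<lambda>x. (R x t)\<^sup>2 / sqrt (g (w x t)))
      - integral {a..b} (\<lambda>x. d x * ux x t * wx x t)
      - 1 / 2 * integral {a..b} (\<lambda>x. g1 (w x t) / g (w x t) * (d x * u x t * (wx x t)\<^sup>2))
      + 1 / \<gamma>1 * (e * integral {a..b} (\<lambda>x. ?P x * R x t)
        - integral {a..b} (\<lambda>x. ?P x * (u x t * g (w x t))))"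
  let ?E' = "- production t + ?E''"
  have "(energy has_real_derivative ?E') (at t)"
    unfolding energy_def[abs_def]
    by (rule DERIV_cong[OF DERIV_add[OF DERIV_add[OF entropy_derivative[OF t]
            gradient_derivative[OF t]] DERIV_cmult[OF weighted_nutrient_derivative[OF cP t]]]])
      (simp add: algebra_simps)
  moreover have "?E' \<le> - production t - \<gamma>1 / (4 * \<gamma>2 * M) * drift t + remainder M"
  proof -
    have "((\<lambda>x. (d1 x * u x t + d x * ux x t) * wx x t - e * ((R x t)\<^sup>2 / sqrt (g (w x t)))
        - d x * ux x t * wx x t - 1 / 2 * (g1 (w x t) / g (w x t) * (d x * u x t * (wx x t)\<^sup>2))
        + 1 / \<gamma>1 * (e * (?P x * R x t) - ?P x * (u x t * g (w x t)))) has_integral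
        ?E'') {a..b}" (is "(?f has_integral _) _")
      by (intro has_integral_diff has_integral_add has_integral_mult_right integrable_integral
            integrable_continuous_interval continuous_intros conts cs' t cP) (auto simp: nonzero t)
    moreover have "((\<lambda>x. - (\<gamma>1 / (4 * \<gamma>2 * M)) * (d x * u x t * (wx x t)\<^sup>2) + ?c * (e * (?P x)\<^sup>2))
        has_integral - (\<gamma>1 / (4 * \<gamma>2 * M)) * drift t + remainder M) {a..b}"
      unfolding drift_def remainder_def
      by (intro has_integral_add has_integral_mult_right integrable_integral
          integrable_continuous_interval continuous_intros conts t cP) (auto simp: nonzero t)
    moreover have "?f x \<le> - (\<gamma>1 / (4 * \<gamma>2 * M)) * (d x * u x t * (wx x t)\<^sup>2) + ?c * (e * (?P x)\<^sup>2)"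
      if x: "x \<in> {a..b}" for x
    proof -
      have w: "0 < w x t" "w x t \<le> M" using w_pos[OF x t] M[OF x] by auto
      have "\<gamma>2 * w x t \<le> \<gamma>2 * M" using w(2) \<gamma>_pos by simp
      then have g: "0 < g (w x t)" "g (w x t) \<le> \<gamma>2 * M"
        using g_pos[OF w(1)] g_bounds(2)[OF w(1)] by auto
      have "?f x = d1 x * u x t * wx x t - e * ((R x t)\<^sup>2 / sqrt (g (w x t)))
          - 1 / 2 * (g1 (w x t) / g (w x t) * (d x * u x t * (wx x t)\<^sup>2))
          + 1 / \<gamma>1 * (e * (?P x * R x t) - ?P x * (u x t * g (w x t)))"
        by (simp add: algebra_simps)
      also have "\<dots> \<le> - 1 / 4 * (g1 (w x t) / g (w x t) * (d x * u x t * (wx x t)\<^sup>2))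
          + e / (4 * \<gamma>1\<^sup>2) * ((?P x)\<^sup>2 * sqrt (g (w x t)))"
        using d_pos[OF x] u_pos[OF x t] g(1) g1_bound[OF w(1)]
        by (intro energy_dissipation_pointwise refl)
      also have "\<dots> \<le> - (\<gamma>1 / (4 * \<gamma>2 * M)) * (d x * u x t * (wx x t)\<^sup>2) + ?c * (e * (?P x)\<^sup>2)"
      proof (rule add_mono)
        have "\<gamma>1 / (\<gamma>2 * M) \<le> g1 (w x t) / g (w x t)"
          using g g1_bound[OF w(1)] \<gamma>_pos by (intro frac_le) auto
        then have "\<gamma>1 / (\<gamma>2 * M) * (d x * u x t * (wx x t)\<^sup>2)
            \<le> g1 (w x t) / g (w x t) * (d x * u x t * (wx x t)\<^sup>2)"
          using d_pos[OF x] u_pos[OF x t] by (intro mult_right_mono) auto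
        moreover have "\<gamma>1 / (4 * \<gamma>2 * M) * (d x * u x t * (wx x t)\<^sup>2)
            = 1 / 4 * (\<gamma>1 / (\<gamma>2 * M) * (d x * u x t * (wx x t)\<^sup>2))" by simp
        ultimately show "- 1 / 4 * (g1 (w x t) / g (w x t) * (d x * u x t * (wx x t)\<^sup>2))
            \<le> - (\<gamma>1 / (4 * \<gamma>2 * M)) * (d x * u x t * (wx x t)\<^sup>2)" by linarith
        have "e / (4 * \<gamma>1\<^sup>2) * ((?P x)\<^sup>2 * sqrt (g (w x t)))
            \<le> e / (4 * \<gamma>1\<^sup>2) * ((?P x)\<^sup>2 * sqrt (\<gamma>2 * M))"
          using g e_pos by (intro mult_left_mono) auto
        then show "e / (4 * \<gamma>1\<^sup>2) * ((?P x)\<^sup>2 * sqrt (g (w x t))) \<le> ?c * (e * (?P x)\<^sup>2)"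
          by (simp add: mult_ac)
      qed
      finally show ?thesis .
    qed
    ultimately have "?E'' \<le> - (\<gamma>1 / (4 * \<gamma>2 * M)) * drift t + remainder M"
      by (rule has_integral_le)
    then show ?thesis by linarith
  qed
  ultimately show ?thesis by (rule that)
qed

end

section \<open>Bounds at a fixed time\<close>

context regularized_flow begin

definition mass :: "real \<Rightarrow> real" where "mass t = integral {a..b} (\<lambda>x. u x t)"

definition inv_mass :: real where "inv_mass = integral {a..b} (\<lambda>x. 1 / d x)"

lemma inv_cont: "continuous_on {a..b} (\<lambda>x. 1 / d x)"
  by (intro continuous_intros conts) (auto simp: nonzero)

lemma inv_mass_pos: "0 < inv_mass"
proof -
  have "integral (cbox a b) (\<lambda>x. 0) < integral (cbox a b) (\<lambda>x. 1 / d x)"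
  proof (rule integral_less)
    show "continuous_on (cbox a b) (\<lambda>x. 1 / d x)" using inv_cont by simp
    show "0 < 1 / d x" if "x \<in> box a b" for x
      using d_pos[of x] that by (simp add: atLeastAtMost_iff)
  qed (use ab in auto)
  then show ?thesis by (simp add: inv_mass_def)
qed

lemma entropy_continuous:
  "0 < t \<Longrightarrow> continuous_on {a..b} (\<lambda>x. u x t * ln (d x * u x t))"
  by (auto intro!: continuous_intros conts simp: nonzero)

text \<open>
  Where the logarithm is negative, \<open>ln y \<ge> 1 - 1/y\<close> bounds \<open>u ln (d u)\<close> from below by
  \<open>- 1/d\<close>.
\<close>

lemma entropy_pointwise:
  assumes "x \<in> {a..b}" "0 < t"
  shows "u x t * max 0 (ln (d x * u x t)) - 1 / d x \<le> u x t * ln (d x * u x t)"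
proof -
  define y where "y = d x * u x t"
  have p: "0 < d x" "0 < u x t" using assms d_pos u_pos by auto
  have y: "0 < y" using p by (simp add: y_def)
  have "u x t * max 0 (ln y) - 1 / d x \<le> u x t * ln y"
  proof (cases "0 \<le> ln y")
    case True
    then have "max 0 (ln y) = ln y" by simp
    then show ?thesis using p by simp
  next
    case False
    have "ln (1 / y) \<le> 1 / y - 1" using y by (intro ln_le_minus_one) simp
    then have "- ln y \<le> 1 / y" using y by (simp add: ln_div)
    then have "u x t * (- ln y) \<le> u x t * (1 / y)" using p by (intro mult_left_mono) auto
    also have "\<dots> = 1 / d x" using p by (simp add: y_def)
    finally show ?thesis using False by (simp add: max_def)
  qed
  then show ?thesis by (simp only: y_def)
qed

lemma energy_bounds:
  assumes t: "0 < t"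
  shows "- inv_mass \<le> energy t"
    and "integral {a..b} (\<lambda>x. u x t * max 0 (ln (d x * u x t))) \<le> energy t + inv_mass"
    and "integral {a..b} (\<lambda>x. d x * (wx x t)\<^sup>2 / g (w x t)) \<le> 2 * (energy t + inv_mass)"
proof -
  let ?ent = "integral {a..b} (\<lambda>x. u x t * ln (d x * u x t))"
  let ?pos = "integral {a..b} (\<lambda>x. u x t * max 0 (ln (d x * u x t)))"
  let ?gr = "integral {a..b} (\<lambda>x. d x * (wx x t)\<^sup>2 / g (w x t))"
  let ?nu = "1 / \<gamma>1 * integral {a..b} (\<lambda>x. (d1 x)\<^sup>2 / d x * w x t)"
  have cpos: "continuous_on {a..b} (\<lambda>x. u x t * max 0 (ln (d x * u x t)))"
    by (intro continuous_intros conts t) (auto simp: nonzero t)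
  have "?pos - inv_mass = integral {a..b} (\<lambda>x. u x t * max 0 (ln (d x * u x t)) - 1 / d x)"
    unfolding inv_mass_def
    by (rule Henstock_Kurzweil_Integration.integral_diff[symmetric])
      (intro integrable_continuous_interval cpos inv_cont)+
  also have "\<dots> \<le> ?ent"
    by (intro integral_le integrable_continuous_interval entropy_continuous t cpos
        continuous_on_diff inv_cont entropy_pointwise) auto
  finally have 1: "?pos - inv_mass \<le> ?ent" .
  have 2: "0 \<le> ?gr"
  proof (rule Henstock_Kurzweil_Integration.integral_nonneg)
    show "(\<lambda>x. d x * (wx x t)\<^sup>2 / g (w x t)) integrable_on {a..b}"
      by (intro integrable_continuous_interval continuous_intros conts t) (auto simp: nonzero t)
    show "0 \<le> d x * (wx x t)\<^sup>2 / g (w x t)" if "x \<in> {a..b}" for x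
      using d_pos[OF that] g_pos[OF w_pos[OF that t]] by simp
  qed
  have "0 \<le> integral {a..b} (\<lambda>x. (d1 x)\<^sup>2 / d x * w x t)"
  proof (rule Henstock_Kurzweil_Integration.integral_nonneg)
    show "(\<lambda>x. (d1 x)\<^sup>2 / d x * w x t) integrable_on {a..b}"
      by (intro integrable_continuous_interval continuous_intros conts t) (auto simp: nonzero t)
    show "0 \<le> (d1 x)\<^sup>2 / d x * w x t" if "x \<in> {a..b}" for x
      using d_pos[OF that] w_pos[OF that t] by simp
  qed
  then have 3: "0 \<le> ?nu" using \<gamma>_pos by simp
  have 4: "0 \<le> ?pos"
  proof (rule Henstock_Kurzweil_Integration.integral_nonneg)
    show "0 \<le> u x t * max 0 (ln (d x * u x t))" if "x \<in> {a..b}" for x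
      using u_pos[OF that t] by simp
  qed (intro integrable_continuous_interval cpos)
  have e: "energy t = ?ent + 1 / 2 * ?gr + ?nu" by (simp add: energy_def)
  show "- inv_mass \<le> energy t" using 1 2 3 4 e by linarith
  show "?pos \<le> energy t + inv_mass" using 1 2 3 e by linarith
  show "?gr \<le> 2 * (energy t + inv_mass)" 
  proof -
    have "gr \<le> 2 * (en + I)"
      if "p - I \<le> s" "0 \<le> nu" "0 \<le> p" "en = s + 1 / 2 * gr + nu" for p I s nu gr en :: real
      using that by (simp add: field_simps)
    from this[OF 1 3 4 e] show ?thesis .
  qed
qed

lemma dU_mass_le:
  assumes t: "0 < t" and Dm: "\<And>x. x \<in> {a..b} \<Longrightarrow> d x \<le> Dm"
  shows "integral {a..b} (\<lambda>x. d x * u x t) \<le> Dm * mass t" "0 \<le> integral {a..b} (\<lambda>x. d x * u x t)"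
proof -
  have "integral {a..b} (\<lambda>x. d x * u x t) \<le> integral {a..b} (\<lambda>x. Dm * u x t)"
    using u_pos t Dm by (intro integral_le integrable_continuous_interval continuous_intros conts t
        mult_right_mono) (auto simp: less_imp_le)
  then show "integral {a..b} (\<lambda>x. d x * u x t) \<le> Dm * mass t" by (simp add: mass_def)
  show "0 \<le> integral {a..b} (\<lambda>x. d x * u x t)"
    using u_pos d_pos t by (intro Henstock_Kurzweil_Integration.integral_nonneg
        integrable_continuous_interval continuous_intros conts t) (auto simp: less_imp_le)
qed

lemma production_nonneg: "0 < t \<Longrightarrow> 0 \<le> production t"
  and drift_nonneg: "0 < t \<Longrightarrow> 0 \<le> drift t"
  unfolding production_def drift_def using d_pos u_pos
  by (auto intro!: Henstock_Kurzweil_Integration.integral_nonneg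
      integrable_continuous_interval continuous_intros conts simp: nonzero less_imp_le)

lemma gradient_dU_L1:
  assumes t: "0 < t"
  shows "integral {a..b} (\<lambda>x. \<bar>d1 x * u x t + d x * ux x t\<bar>)
    \<le> sqrt (production t * integral {a..b} (\<lambda>x. d x * u x t))"
proof (rule real_le_rsqrt)
  have p: "0 < d x * u x t" if "x \<in> {a..b}" for x using d_pos[OF that] u_pos[OF that t] by simp
  have "(integral {a..b} (\<lambda>x. \<bar>d1 x * u x t + d x * ux x t\<bar> / sqrt (d x * u x t) * sqrt (d x * u x t)))\<^sup>2
    \<le> integral {a..b} (\<lambda>x. (\<bar>d1 x * u x t + d x * ux x t\<bar> / sqrt (d x * u x t))\<^sup>2)
      * integral {a..b} (\<lambda>x. (sqrt (d x * u x t))\<^sup>2)"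
    by (rule integral_Cauchy_Schwarz) (intro continuous_intros conts t; auto simp: nonzero t)+
  also have "integral {a..b} (\<lambda>x. (\<bar>d1 x * u x t + d x * ux x t\<bar> / sqrt (d x * u x t))\<^sup>2) = production t"
    unfolding production_def using p
    by (intro integral_cong) (simp add: power_divide less_imp_le)
  also have "integral {a..b} (\<lambda>x. (sqrt (d x * u x t))\<^sup>2) = integral {a..b} (\<lambda>x. d x * u x t)"
    using p by (intro integral_cong) (simp add: less_imp_le)
  also have "integral {a..b} (\<lambda>x. \<bar>d1 x * u x t + d x * ux x t\<bar> / sqrt (d x * u x t) * sqrt (d x * u x t))
      = integral {a..b} (\<lambda>x. \<bar>d1 x * u x t + d x * ux x t\<bar>)"
    by (intro integral_cong) (auto simp: nonzero t)
  finally show "(integral {a..b} (\<lambda>x. \<bar>d1 x * u x t + d x * ux x t\<bar>))\<^sup>2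
      \<le> production t * integral {a..b} (\<lambda>x. d x * u x t)" .
qed

lemma drift_L1:
  assumes t: "0 < t"
  shows "integral {a..b} (\<lambda>x. d x * u x t * \<bar>wx x t\<bar>)
    \<le> sqrt (drift t * integral {a..b} (\<lambda>x. d x * u x t))"
proof (rule real_le_rsqrt)
  have p: "0 < d x * u x t" if "x \<in> {a..b}" for x using d_pos[OF that] u_pos[OF that t] by simp
  have "(integral {a..b} (\<lambda>x. (sqrt (d x * u x t) * \<bar>wx x t\<bar>) * sqrt (d x * u x t)))\<^sup>2
    \<le> integral {a..b} (\<lambda>x. (sqrt (d x * u x t) * \<bar>wx x t\<bar>)\<^sup>2)
      * integral {a..b} (\<lambda>x. (sqrt (d x * u x t))\<^sup>2)"
    by (rule integral_Cauchy_Schwarz) (intro continuous_intros conts t)+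
  also have "integral {a..b} (\<lambda>x. (sqrt (d x * u x t) * \<bar>wx x t\<bar>)\<^sup>2) = drift t"
    unfolding drift_def using p
    by (intro integral_cong) (simp add: power_mult_distrib less_imp_le del: real_sqrt_mult)
  also have "integral {a..b} (\<lambda>x. (sqrt (d x * u x t))\<^sup>2) = integral {a..b} (\<lambda>x. d x * u x t)"
    using p by (intro integral_cong) (simp add: less_imp_le)
  also have "integral {a..b} (\<lambda>x. (sqrt (d x * u x t) * \<bar>wx x t\<bar>) * sqrt (d x * u x t))
      = integral {a..b} (\<lambda>x. d x * u x t * \<bar>wx x t\<bar>)"
  proof (rule integral_cong)
    fix x assume "x \<in> {a..b}"
    from p[OF this] have "sqrt (d x * u x t) * sqrt (d x * u x t) = d x * u x t" by simp
    moreover have swap: "(\<alpha> * \<beta>) * \<delta> = (\<alpha> * \<delta>) * \<beta>" for \<alpha> \<beta> \<delta> :: real by simp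
    ultimately show "(sqrt (d x * u x t) * \<bar>wx x t\<bar>) * sqrt (d x * u x t) = d x * u x t * \<bar>wx x t\<bar>"
      by (subst swap) (simp only:)
  qed
  finally show "(integral {a..b} (\<lambda>x. d x * u x t * \<bar>wx x t\<bar>))\<^sup>2
      \<le> drift t * integral {a..b} (\<lambda>x. d x * u x t)" .
qed

lemma dU_oscillation:
  assumes t: "0 < t" and x: "x \<in> {a..b}" and y: "y \<in> {a..b}"
  shows "\<bar>d x * u x t - d y * u y t\<bar> \<le> sqrt (production t * integral {a..b} (\<lambda>x. d x * u x t))"
proof -
  let ?F' = "\<lambda>x. d1 x * u x t + d x * ux x t"
  have c: "continuous_on {a..b} ?F'" by (intro continuous_intros conts t)
  have *: "\<bar>d x * u x t - d y * u y t\<bar> \<le> integral {a..b} (\<lambda>x. \<bar>?F' x\<bar>)"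
    if "x \<in> {a..b}" "y \<in> {a..b}" "y \<le> x" for x y
  proof -
    have "\<bar>d x * u x t - d y * u y t\<bar> \<le> integral {y..x} (\<lambda>x. \<bar>?F' x\<bar>)"
    proof (rule abs_diff_le_integral_abs_deriv[where F = "\<lambda>x. d x * u x t", OF _ c])
      show "((\<lambda>x. d x * u x t) has_real_derivative d1 z * u z t + d z * ux z t) (at z within {a..b})"
        if "z \<in> {a..b}" for z
        using DERIV_mult[OF d_deriv[OF that] u_dx[OF that t]] by (simp add: mult.commute)
    qed (use that in \<open>auto simp: atLeastAtMost_iff\<close>)
    also have "\<dots> \<le> integral {a..b} (\<lambda>x. \<bar>?F' x\<bar>)"
    proof (rule integral_subset_le)
      show "{y..x} \<subseteq> {a..b}" using that by (auto simp: atLeastAtMost_iff)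
      then show "(\<lambda>x. \<bar>?F' x\<bar>) integrable_on {y..x}"
        by (intro integrable_continuous_interval continuous_intros continuous_on_subset[OF c])
    qed (auto intro!: integrable_continuous_interval continuous_intros c)
    finally show ?thesis .
  qed
  have "\<bar>d x * u x t - d y * u y t\<bar> \<le> integral {a..b} (\<lambda>x. \<bar>?F' x\<bar>)"
    using *[OF x y] *[OF y x] by (cases "y \<le> x") (auto simp: abs_minus_commute)
  with gradient_dU_L1[OF t] show ?thesis by linarith
qed

text \<open>
  The oscillation of \<open>U = d u\<close> bounds the distance of \<open>U\<close> from its mean with respect to the weight
  \<open>1/d\<close>, and this mean is the quotient of the masses of \<open>u\<close> and \<open>1/d\<close>.
\<close>

lemma distance_to_equilibrium:
  assumes t: "0 < t" and y: "y \<in> {a..b}"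
  shows "\<bar>u y t - mass t / inv_mass / d y\<bar>
    \<le> sqrt (production t * integral {a..b} (\<lambda>x. d x * u x t)) * (1 / d y)"
proof -
  let ?K = "sqrt (production t * integral {a..b} (\<lambda>x. d x * u x t))"
  have K0: "0 \<le> ?K" using dU_oscillation[OF t y y] by simp
  have eq: "(d y * u y t) * inv_mass - mass t = integral {a..b} (\<lambda>x. d y * u y t * (1 / d x) - u x t)"
    unfolding inv_mass_def mass_def
    by (subst Henstock_Kurzweil_Integration.integral_diff)
      (auto intro!: integrable_continuous_interval continuous_intros conts t simp: nonzero
        simp del: times_divide_eq_right)
  have "\<bar>integral {a..b} (\<lambda>x. d y * u y t * (1 / d x) - u x t)\<bar>
      \<le> integral {a..b} (\<lambda>x. ?K * (1 / d x))"
    unfolding real_norm_def[symmetric]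
  proof (rule integral_norm_bound_integral)
    fix x assume x: "x \<in> {a..b}"
    have "d y * u y t * (1 / d x) - u x t = (d y * u y t - d x * u x t) * (1 / d x)"
      using nonzero(1)[OF x] by (simp add: field_simps)
    also have "norm \<dots> \<le> ?K * (1 / d x)"
      using dU_oscillation[OF t y x] d_pos[OF x] unfolding real_norm_def abs_mult
      by (intro mult_mono K0) auto
    finally show "norm (d y * u y t * (1 / d x) - u x t) \<le> ?K * (1 / d x)" .
  qed (intro integrable_continuous_interval continuous_intros conts t; auto simp: nonzero)+
  then have "\<bar>d y * u y t * inv_mass - mass t\<bar> \<le> ?K * inv_mass"
    by (simp only: eq integral_mult_right flip: inv_mass_def)
  moreover have "u y t - mass t / inv_mass / d y = (d y * u y t * inv_mass - mass t) / (inv_mass * d y)"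
    using inv_mass_pos nonzero(1)[OF y] by (simp add: field_simps)
  moreover have "0 < inv_mass * d y" using inv_mass_pos d_pos[OF y] by simp
  ultimately have "\<bar>u y t - mass t / inv_mass / d y\<bar> \<le> ?K * inv_mass / (inv_mass * d y)"
    by (simp only: abs_divide abs_of_pos) (rule divide_right_mono, auto)
  also have "\<dots> = ?K * (1 / d y)" using inv_mass_pos by simp
  finally show ?thesis .
qed

lemma flux_L1:
  assumes t: "0 < t"
  shows "integral {a..b} (\<lambda>x. \<bar>flux x t\<bar>)
    \<le> (sqrt (production t) + sqrt (drift t)) * sqrt (integral {a..b} (\<lambda>x. d x * u x t))"
proof -
  have i: "(\<lambda>x. \<bar>d1 x * u x t + d x * ux x t\<bar>) integrable_on {a..b}"
    "(\<lambda>x. d x * u x t * \<bar>wx x t\<bar>) integrable_on {a..b}"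
    "(\<lambda>x. \<bar>flux x t\<bar>) integrable_on {a..b}"
    by (intro integrable_continuous_interval continuous_intros conts t)+
  have "integral {a..b} (\<lambda>x. \<bar>flux x t\<bar>)
      \<le> integral {a..b} (\<lambda>x. \<bar>d1 x * u x t + d x * ux x t\<bar> + d x * u x t * \<bar>wx x t\<bar>)"
  proof (rule integral_le[OF i(3) integrable_add[OF i(1,2)]])
    fix x assume x: "x \<in> {a..b}"
    have "\<bar>d x * u x t * wx x t\<bar> = d x * u x t * \<bar>wx x t\<bar>"
      using d_pos[OF x] u_pos[OF x t] by (simp add: abs_mult)
    then show "\<bar>flux x t\<bar> \<le> \<bar>d1 x * u x t + d x * ux x t\<bar> + d x * u x t * \<bar>wx x t\<bar>"
      unfolding flux_def by linarith
  qed
  also have "\<dots> = integral {a..b} (\<lambda>x. \<bar>d1 x * u x t + d x * ux x t\<bar>)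
      + integral {a..b} (\<lambda>x. d x * u x t * \<bar>wx x t\<bar>)"
    by (rule Henstock_Kurzweil_Integration.integral_add[OF i(1,2)])
  also have "\<dots> \<le> sqrt (production t * integral {a..b} (\<lambda>x. d x * u x t))
      + sqrt (drift t * integral {a..b} (\<lambda>x. d x * u x t))"
    by (intro add_mono gradient_dU_L1 drift_L1 t)
  finally show ?thesis by (simp add: real_sqrt_mult algebra_simps)
qed

text \<open>Cauchy-Schwarz for \<open>w_x = (sqrt (d / g w) w_x) * sqrt (g w / d)\<close>.\<close>

lemma nutrient_equicontinuity:
  assumes t: "0 < t" and M: "\<And>x. x \<in> {a..b} \<Longrightarrow> w x t \<le> M"
    and xy: "a \<le> y" "y \<le> x" "x \<le> b"
  shows "(w x t - w y t)\<^sup>2 \<le> 2 * (energy t + inv_mass) * (\<gamma>2 * M * integral {y..x} (\<lambda>z. 1 / d z))"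
proof -
  have sub: "{y..x} \<subseteq> {a..b}" using xy by (auto simp: atLeastAtMost_iff)
  have mem: "z \<in> {a..b}" if "z \<in> {y..x}" for z by (rule subsetD[OF sub that])
  let ?f = "\<lambda>z. sqrt (d z / g (w z t)) * \<bar>wx z t\<bar>" and ?h = "\<lambda>z. sqrt (g (w z t) / d z)"
  have p: "0 < d z" "0 < g (w z t)" if "z \<in> {y..x}" for z
    using d_pos g_pos w_pos t mem[OF that] by auto
  have c: "continuous_on {y..x} ?f" "continuous_on {y..x} ?h"
  proof -
    note cd = continuous_on_subset[OF d_cont sub]
      and cg = continuous_on_subset[OF g_cont2[THEN slice[of "\<lambda>x t. g (w x t)"], OF t] sub]
      and cw = continuous_on_subset[OF wx_cont[THEN slice, OF t] sub]
    show "continuous_on {y..x} ?f"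
      by (intro continuous_on_mult continuous_on_real_sqrt continuous_on_divide
          continuous_on_rabs cd cg cw) (auto simp: nonzero mem t)
    show "continuous_on {y..x} ?h"
      by (intro continuous_on_real_sqrt continuous_on_divide cd cg) (auto simp: nonzero mem)
  qed
  have "\<bar>w x t - w y t\<bar> \<le> integral {y..x} (\<lambda>z. \<bar>wx z t\<bar>)"
    using w_dx[OF _ t] wx_cont[THEN slice, OF t] xy
    by (rule abs_diff_le_integral_abs_deriv[where F = "\<lambda>x. w x t"])
  also have "\<dots> = integral {y..x} (\<lambda>z. ?f z * ?h z)"
  proof (rule integral_cong)
    fix z assume z: "z \<in> {y..x}"
    have inv: "sqrt (d z / g (w z t)) * sqrt (g (w z t) / d z) = 1"
      using p[OF z] by (simp flip: real_sqrt_mult)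
    have swap: "(\<alpha> * \<beta>) * \<delta> = (\<alpha> * \<delta>) * \<beta>" for \<alpha> \<beta> \<delta> :: real by simp
    show "\<bar>wx z t\<bar> = ?f z * ?h z" by (subst swap) (simp only: inv mult_1)
  qed
  finally have "\<bar>w x t - w y t\<bar>\<^sup>2 \<le> (integral {y..x} (\<lambda>z. ?f z * ?h z))\<^sup>2"
    by (intro power_mono) auto
  also have "\<dots> \<le> integral {y..x} (\<lambda>z. (?f z)\<^sup>2) * integral {y..x} (\<lambda>z. (?h z)\<^sup>2)"
    by (rule integral_Cauchy_Schwarz[OF c])
  also have "\<dots> \<le> (2 * (energy t + inv_mass)) * (\<gamma>2 * M * integral {y..x} (\<lambda>z. 1 / d z))"
  proof (rule mult_mono)
    have "integral {y..x} (\<lambda>z. (?f z)\<^sup>2) = integral {y..x} (\<lambda>z. d z * (wx z t)\<^sup>2 / g (w z t))"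
      using p by (intro integral_cong) (simp add: power_mult_distrib less_imp_le)
    also have "\<dots> \<le> integral {a..b} (\<lambda>z. d z * (wx z t)\<^sup>2 / g (w z t))"
    proof (rule integral_subset_le[OF sub])
      show i: "(\<lambda>z. d z * (wx z t)\<^sup>2 / g (w z t)) integrable_on {a..b}"
        by (intro integrable_continuous_interval continuous_intros conts t) (auto simp: nonzero t)
      show "(\<lambda>z. d z * (wx z t)\<^sup>2 / g (w z t)) integrable_on {y..x}"
        by (rule integrable_on_subinterval[OF i sub])
      show "\<forall>z\<in>{a..b}. 0 \<le> d z * (wx z t)\<^sup>2 / g (w z t)"
        using d_pos g_pos w_pos t by (simp add: less_imp_le)
    qed
    also have "\<dots> \<le> 2 * (energy t + inv_mass)" by (rule energy_bounds(3)[OF t])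
    finally show "integral {y..x} (\<lambda>z. (?f z)\<^sup>2) \<le> 2 * (energy t + inv_mass)" .
    have "integral {y..x} (\<lambda>z. (?h z)\<^sup>2) \<le> integral {y..x} (\<lambda>z. \<gamma>2 * M * (1 / d z))"
    proof (rule integral_le)
      show "(\<lambda>z. (?h z)\<^sup>2) integrable_on {y..x}"
        by (rule integrable_continuous_interval[OF continuous_on_power[OF c(2)]])
      show "(\<lambda>z. \<gamma>2 * M * (1 / d z)) integrable_on {y..x}"
        by (rule integrable_on_mult_right[OF
              integrable_on_subinterval[OF integrable_continuous_interval[OF inv_cont] sub]])
    next
      fix z assume z: "z \<in> {y..x}"
      have "\<gamma>2 * w z t \<le> \<gamma>2 * M" using M[OF mem[OF z]] \<gamma>_pos by simp
      then have "g (w z t) \<le> \<gamma>2 * M" using g_bounds(2)[OF w_pos[OF mem[OF z] t]] by linarith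
      then show "(?h z)\<^sup>2 \<le> \<gamma>2 * M * (1 / d z)"
        using p[OF z] by (simp add: less_imp_le divide_right_mono)
    qed
    then show "integral {y..x} (\<lambda>z. (?h z)\<^sup>2) \<le> \<gamma>2 * M * integral {y..x} (\<lambda>z. 1 / d z)"
      by (simp only: integral_mult_right)
    show "0 \<le> 2 * (energy t + inv_mass)" using energy_bounds(1)[OF t] by simp
    show "0 \<le> integral {y..x} (\<lambda>z. (?h z)\<^sup>2)"
      by (rule Henstock_Kurzweil_Integration.integral_nonneg[OF
            integrable_continuous_interval[OF continuous_on_power[OF c(2)]]]) simp
  qed
  finally show ?thesis by (simp only: power2_abs)
qed

end

section \<open>Bounds independent of the regularization\<close>

text \<open>
  A regularized solution with bounds on \<open>[0, T]\<close>; all constants obtained from them depend on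
  \<open>\<gamma>1\<close>, \<open>\<gamma>2\<close>, \<open>M\<close>, \<open>N\<close>, \<open>Dm\<close>, \<open>m\<close> and \<open>C0\<close>, but not on the regularization and not on \<open>T\<close>.
\<close>

locale bounded_regularized_flow = regularized_flow +
  fixes T M N Dm m C0 :: real
  assumes T_pos: "0 < T" and m_pos: "0 < m"
    and w_le: "\<And>x t. x \<in> {a..b} \<Longrightarrow> 0 < t \<Longrightarrow> t \<le> T \<Longrightarrow> w x t \<le> M"
    and d_le: "\<And>x. x \<in> {a..b} \<Longrightarrow> d x \<le> Dm"
    and inv_mass_le: "inv_mass \<le> N"
    and mass_eq: "\<And>t. 0 < t \<Longrightarrow> mass t = m"
    and remainder_le: "remainder M * T \<le> 1"
    and initial_energy: "\<forall>\<^sub>F t in at_right 0. energy t \<le> C0"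
begin

definition \<kappa> :: real where "\<kappa> = \<gamma>1 / (4 * \<gamma>2 * M)"

definition dissipation :: "real \<Rightarrow> real" where
  "dissipation t = production t + \<kappa> * drift t"

text \<open>The energy corrected by the remainder, so that it decreases.\<close>

definition lyapunov :: "real \<Rightarrow> real" where
  "lyapunov t = energy t - remainder M * t"

lemma M_pos: "0 < M"
  using w_le[OF endpoints(1) T_pos order_refl] w_pos[OF endpoints(1) T_pos] by linarith

lemma \<kappa>_pos: "0 < \<kappa>"
  using M_pos \<gamma>_pos by (simp add: \<kappa>_def)

lemma Dm_pos: "0 < Dm"
  using d_le[OF endpoints(1)] d_pos[OF endpoints(1)] by linarith

lemma N_pos: "0 < N"
  using inv_mass_le inv_mass_pos by linarith

lemma remainder_nonneg: "0 \<le> remainder M"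
proof -
  have "0 \<le> integral {a..b} (\<lambda>x. ((d1 x)\<^sup>2 / d x)\<^sup>2)"
    by (intro Henstock_Kurzweil_Integration.integral_nonneg integrable_continuous_interval
        continuous_intros conts) (auto simp: nonzero)
  then show ?thesis using M_pos \<gamma>_pos e_pos by (simp add: remainder_def)
qed

lemma dissipation_bounds:
  assumes "0 < t"
  shows "0 \<le> dissipation t" "production t \<le> dissipation t" "drift t \<le> dissipation t / \<kappa>"
  using production_nonneg[OF assms] drift_nonneg[OF assms] \<kappa>_pos
  by (auto simp: dissipation_def field_simps)

lemma lyapunov_derivative:
  assumes "0 < t" "t \<le> T"
  obtains L' where "(lyapunov has_real_derivative L') (at t)" "L' \<le> - dissipation t"
proof -
  obtain E' where E: "(energy has_real_derivative E') (at t)"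
    "E' \<le> - production t - \<gamma>1 / (4 * \<gamma>2 * M) * drift t + remainder M"
    using energy_inequality[OF assms(1) w_le[OF _ assms]] by blast
  show ?thesis
  proof (rule that)
    show "(lyapunov has_real_derivative E' - remainder M) (at t)"
      unfolding lyapunov_def[abs_def] by (auto intro!: derivative_eq_intros E(1))
    show "E' - remainder M \<le> - dissipation t"
      using E(2) by (simp add: dissipation_def \<kappa>_def)
  qed
qed

lemma lyapunov_antimono:
  assumes "0 < s" "s \<le> t" "t \<le> T"
  shows "lyapunov t \<le> lyapunov s"
proof (rule DERIV_nonpos_imp_nonincreasing[OF assms(2)])
  fix x assume "s \<le> x" "x \<le> t"
  then have x: "0 < x" "x \<le> T" using assms by auto
  show "\<exists>y. (lyapunov has_real_derivative y) (at x) \<and> y \<le> 0"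
    using lyapunov_derivative[OF x] dissipation_bounds(1)[OF x(1)] by (metis neg_le_0_iff_le order_trans)
qed

lemma lyapunov_bounds:
  assumes t: "0 < t" "t \<le> T"
  shows "lyapunov t \<le> C0" "- N - 1 \<le> lyapunov t" "energy t \<le> C0 + 1"
proof -
  have "\<forall>\<^sub>F s in at_right 0. s \<in> {0<..<t}"
    using t(1) by (rule eventually_at_right_real)
  with initial_energy have "\<forall>\<^sub>F s in at_right 0. energy s \<le> C0 \<and> s \<in> {0<..<t}"
    by (rule eventually_conj)
  from eventually_happens'[OF trivial_limit_at_right_real this]
  obtain s where s: "energy s \<le> C0" "0 < s" "s < t" by auto
  have "lyapunov s \<le> energy s" using remainder_nonneg s by (simp add: lyapunov_def)
  with lyapunov_antimono[of s t] s t show 1: "lyapunov t \<le> C0" by simp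
  have r: "remainder M * t \<le> 1"
    using mult_left_mono[OF t(2) remainder_nonneg] remainder_le by linarith
  show "- N - 1 \<le> lyapunov t"
    using energy_bounds(1)[OF t(1)] inv_mass_le r by (simp add: lyapunov_def)
  show "energy t \<le> C0 + 1" using 1 r by (simp add: lyapunov_def)
qed

lemma dU_mass: "0 < t \<Longrightarrow> integral {a..b} (\<lambda>x. d x * u x t) \<le> Dm * m"
  using dU_mass_le(1)[OF _ d_le, of t] mass_eq[of t] by simp

lemma L1_distance_to_equilibrium:
  assumes t: "0 < t" and h: "continuous_on {a..b} h" and B: "\<And>x. x \<in> {a..b} \<Longrightarrow> \<bar>h x\<bar> \<le> B"
  shows "\<bar>integral {a..b} (\<lambda>x. u x t * h x) - m / inv_mass * integral {a..b} (\<lambda>x. h x / d x)\<bar>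
    \<le> B * N * sqrt (Dm * m) * sqrt (dissipation t)"
proof -
  let ?K = "sqrt (production t * integral {a..b} (\<lambda>x. d x * u x t))"
  have i: "(\<lambda>x. u x t * h x) integrable_on {a..b}" "(\<lambda>x. h x / d x) integrable_on {a..b}"
    by (intro integrable_continuous_interval continuous_intros conts t h; auto simp: nonzero)+
  have B0: "0 \<le> B" using B[OF endpoints(1)] by linarith
  have K: "?K \<le> sqrt (Dm * m) * sqrt (dissipation t)"
  proof -
    have "production t * integral {a..b} (\<lambda>x. d x * u x t) \<le> dissipation t * (Dm * m)"
      using dU_mass[OF t] dU_mass_le(2)[OF t d_le] dissipation_bounds[OF t] production_nonneg[OF t]
      by (intro mult_mono) auto
    then show ?thesis by (simp add: real_sqrt_mult[symmetric] mult.commute)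
  qed
  have eq: "integral {a..b} (\<lambda>x. u x t * h x) - m / inv_mass * integral {a..b} (\<lambda>x. h x / d x)
      = integral {a..b} (\<lambda>x. u x t * h x - m / inv_mass * (h x / d x))"
    by (subst Henstock_Kurzweil_Integration.integral_diff[OF i(1) integrable_on_mult_right[OF i(2)]])
      (simp only: integral_mult_right)
  have "\<bar>integral {a..b} (\<lambda>x. u x t * h x - m / inv_mass * (h x / d x))\<bar>
      \<le> integral {a..b} (\<lambda>x. (B * ?K) * (1 / d x))"
    unfolding real_norm_def[symmetric]
  proof (rule integral_norm_bound_integral)
    show "(\<lambda>x. u x t * h x - m / inv_mass * (h x / d x)) integrable_on {a..b}"
      by (rule integrable_diff[OF i(1) integrable_on_mult_right[OF i(2)]])
    show "(\<lambda>x. (B * ?K) * (1 / d x)) integrable_on {a..b}"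
      by (rule integrable_on_mult_right[OF integrable_continuous_interval[OF inv_cont]])
    fix x assume x: "x \<in> {a..b}"
    have "u x t * h x - m / inv_mass * (h x / d x) = h x * (u x t - mass t / inv_mass / d x)"
      using t by (simp add: mass_eq algebra_simps)
    also have "norm \<dots> \<le> B * (?K * (1 / d x))"
      unfolding real_norm_def abs_mult
      by (rule mult_mono[OF B[OF x] distance_to_equilibrium[OF t x] B0]) simp
    finally show "norm (u x t * h x - m / inv_mass * (h x / d x)) \<le> (B * ?K) * (1 / d x)"
      by (simp add: mult_ac)
  qed
  also have "\<dots> = (B * ?K) * inv_mass"
    by (simp only: integral_mult_right flip: inv_mass_def)
  also have "\<dots> \<le> (B * (sqrt (Dm * m) * sqrt (dissipation t))) * N"
    using K B0 inv_mass_le inv_mass_pos N_pos m_pos Dm_pos dissipation_bounds[OF t]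
    by (intro mult_mono mult_left_mono mult_nonneg_nonneg) auto
  finally show ?thesis unfolding eq by (simp add: mult_ac)
qed

lemma flux_dissipation:
  assumes t: "0 < t" and h: "continuous_on {a..b} h" and B: "\<And>x. x \<in> {a..b} \<Longrightarrow> \<bar>h x\<bar> \<le> B"
  shows "\<bar>- integral {a..b} (\<lambda>x. flux x t * h x)\<bar>
    \<le> B * (1 + 1 / sqrt \<kappa>) * sqrt (Dm * m) * sqrt (dissipation t)"
proof -
  have B0: "0 \<le> B" using B[OF endpoints(1)] by linarith
  have "\<bar>integral {a..b} (\<lambda>x. flux x t * h x)\<bar> \<le> integral {a..b} (\<lambda>x. B * \<bar>flux x t\<bar>)"
    unfolding real_norm_def[symmetric]
    using B by (intro integral_norm_bound_integral integrable_continuous_interval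
        continuous_intros conts t h) (auto simp: abs_mult mult.commute[of B] intro!: mult_left_mono)
  also have "\<dots> = B * integral {a..b} (\<lambda>x. \<bar>flux x t\<bar>)" by (rule integral_mult_right)
  also have "\<dots> \<le> B * ((sqrt (production t) + sqrt (drift t)) * sqrt (integral {a..b} (\<lambda>x. d x * u x t)))"
    by (rule mult_left_mono[OF flux_L1[OF t] B0])
  also have "\<dots> \<le> B * ((sqrt (dissipation t) + sqrt (dissipation t / \<kappa>)) * sqrt (Dm * m))"
    using dissipation_bounds[OF t] dU_mass[OF t] dU_mass_le(2)[OF t d_le] \<kappa>_pos
    by (intro mult_left_mono mult_mono add_mono B0) (auto intro: add_nonneg_nonneg)
  also have "sqrt (dissipation t / \<kappa>) = sqrt (dissipation t) * (1 / sqrt \<kappa>)"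
    by (simp add: real_sqrt_divide)
  finally show ?thesis by (simp add: algebra_simps)
qed

lemma weak_distance_le_lyapunov_drop:
  assumes \<phi>: "\<And>x. x \<in> {a..b} \<Longrightarrow> (\<phi> has_real_derivative \<phi>1 x) (at x within {a..b})"
    and \<phi>1: "continuous_on {a..b} \<phi>1"
    and B: "\<And>x. x \<in> {a..b} \<Longrightarrow> \<bar>\<phi> x\<bar> \<le> B" "\<And>x. x \<in> {a..b} \<Longrightarrow> \<bar>\<phi>1 x\<bar> \<le> B"
    and t: "1 < t" "t \<le> T"
  shows "(integral {a..b} (\<lambda>x. u x t * \<phi> x) - m / inv_mass * integral {a..b} (\<lambda>x. \<phi> x / d x))\<^sup>2
    \<le> (B * (1 + 1 / sqrt \<kappa> + N) * sqrt (Dm * m))\<^sup>2 * (lyapunov (t - 1) - lyapunov t)"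
proof -
  have B0: "0 \<le> B" using B(1)[OF endpoints(1)] by linarith
  have c: "continuous_on {a..b} \<phi>" by (rule DERIV_continuous_on[OF \<phi>])
  define L' where "L' s = (SOME l. (lyapunov has_real_derivative l) (at s) \<and> l \<le> - dissipation s)" for s
  have pos: "0 < s" "s \<le> T" if "s \<in> {t - 1..t}" for s
    using that t by (auto simp: atLeastAtMost_iff)
  have L': "(lyapunov has_real_derivative L' s) (at s)" "L' s \<le> - dissipation s"
    if "s \<in> {t - 1..t}" for s
  proof -
    have "\<exists>l. (lyapunov has_real_derivative l) (at s) \<and> l \<le> - dissipation s"
      using lyapunov_derivative[OF pos[OF that]] by blast
    from someI_ex[OF this] show "(lyapunov has_real_derivative L' s) (at s)" "L' s \<le> - dissipation s"
      by (auto simp: L'_def)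
  qed
  have "(integral {a..b} (\<lambda>x. u x t * \<phi> x) - m / inv_mass * integral {a..b} (\<lambda>x. \<phi> x / d x))\<^sup>2
    \<le> (B * (1 + 1 / sqrt \<kappa>) * sqrt (Dm * m) + B * N * sqrt (Dm * m))\<^sup>2
      * (lyapunov (t - 1) - lyapunov t)"
  proof (rule dissipation_controls_distance[where H = "\<lambda>s. integral {a..b} (\<lambda>x. u x s * \<phi> x)"
        and H' = "\<lambda>s. - integral {a..b} (\<lambda>x. flux x s * \<phi>1 x)" and E' = L' and D = dissipation])
    fix s assume s: "s \<in> {t - 1..t}"
    note p = pos[OF s]
    show "((\<lambda>s. integral {a..b} (\<lambda>x. u x s * \<phi> x)) has_real_derivative
        - integral {a..b} (\<lambda>x. flux x s * \<phi>1 x)) (at s)"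
      by (rule weighted_mass_derivative[OF \<phi> \<phi>1 p(1)])
    show "(lyapunov has_real_derivative L' s) (at s)" "L' s \<le> - dissipation s"
      by (rule L'[OF s])+
    show "0 \<le> dissipation s" by (rule dissipation_bounds(1)[OF p(1)])
    show "\<bar>- integral {a..b} (\<lambda>x. flux x s * \<phi>1 x)\<bar>
        \<le> B * (1 + 1 / sqrt \<kappa>) * sqrt (Dm * m) * sqrt (dissipation s)"
      by (rule flux_dissipation[OF p(1) \<phi>1 B(2)])
    show "\<bar>integral {a..b} (\<lambda>x. u x s * \<phi> x) - m / inv_mass * integral {a..b} (\<lambda>x. \<phi> x / d x)\<bar>
        \<le> B * N * sqrt (Dm * m) * sqrt (dissipation s)"
      by (rule L1_distance_to_equilibrium[OF p(1) c B(1)])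
  qed (use B0 \<kappa>_pos Dm_pos m_pos N_pos in auto)
  then show ?thesis by (simp add: algebra_simps)
qed

text \<open>
  The mean value theorem for \<open>\<integral> w\<close> plus the Lyapunov functional on \<open>[T/2, T]\<close> gives a time \<open>s\<close>
  at which \<open>\<integral> u g(w)\<close> and the dissipation are both of order \<open>1/T\<close>. At this time \<open>u\<close> may be replaced by
  its equilibrium in the first of them, and \<open>\<integral> w\<close> does not increase between \<open>s\<close> and \<open>T\<close>.
\<close>

lemma nutrient_decay:
  shows "integral {a..b} (\<lambda>x. w x T)
    \<le> Dm * N / (\<gamma>1 * m) * (2 * (M * (b - a) + C0 + N + 1) / T
        + \<gamma>2 * M * N * sqrt (Dm * m) * sqrt (2 * (M * (b - a) + C0 + N + 1) / T))"
proof -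
  let ?y = "\<lambda>s. integral {a..b} (\<lambda>x. w x s)" and ?f = "\<lambda>s. integral {a..b} (\<lambda>x. u x s * g (w x s))"
  define r where "r = 2 * (M * (b - a) + C0 + N + 1) / T"
  have y0: "0 \<le> ?y s" if "0 < s" for s
    using w_pos that by (intro Henstock_Kurzweil_Integration.integral_nonneg
        integrable_continuous_interval conts) (auto simp: less_imp_le)
  have f0: "0 \<le> ?f s" if "0 < s" for s
    using w_pos u_pos g_pos that by (intro Henstock_Kurzweil_Integration.integral_nonneg
        integrable_continuous_interval continuous_intros conts) (auto simp: less_imp_le)
  have yM: "?y s \<le> M * (b - a)" if "0 < s" "s \<le> T" for s
  proof -
    have "?y s \<le> integral {a..b} (\<lambda>x. M)"
      using w_le that by (intro integral_le integrable_continuous_interval conts continuous_intros) auto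
    then show ?thesis using ab by (simp add: mult.commute)
  qed
  define L' where "L' s = (SOME l. (lyapunov has_real_derivative l) (at s) \<and> l \<le> - dissipation s)" for s
  have L': "(lyapunov has_real_derivative L' s) (at s)" "L' s \<le> - dissipation s"
    if "0 < s" "s \<le> T" for s
  proof -
    have "\<exists>l. (lyapunov has_real_derivative l) (at s) \<and> l \<le> - dissipation s"
      using lyapunov_derivative[OF that] by blast
    from someI_ex[OF this] show "(lyapunov has_real_derivative L' s) (at s)" "L' s \<le> - dissipation s"
      by (auto simp: L'_def)
  qed
  have "\<exists>z>T / 2. z < T \<and> (?y T + lyapunov T) - (?y (T / 2) + lyapunov (T / 2))
      = (T - T / 2) * (- ?f z + L' z)"
    using T_pos by (intro MVT2 DERIV_add nutrient_derivative L') auto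
  then obtain s where s: "T / 2 < s" "s < T"
    and e: "(?y T + lyapunov T) - (?y (T / 2) + lyapunov (T / 2)) = (T - T / 2) * (- ?f s + L' s)"
    by blast
  have s0: "0 < s" using s T_pos by linarith
  have "T / 2 * (?f s - L' s) \<le> M * (b - a) + C0 + N + 1"
    using e yM[of "T / 2"] y0[of T] lyapunov_bounds(1)[of "T / 2"] lyapunov_bounds(2)[of T] T_pos
    by (simp add: field_simps)
  then have fr: "?f s - L' s \<le> r"
    using T_pos by (simp add: r_def field_simps)
  have Lr: "L' s \<le> - dissipation s" using L'(2)[OF s0] s by simp
  have f: "?f s \<le> r" and D: "dissipation s \<le> r"
    using fr Lr f0[OF s0] dissipation_bounds(1)[OF s0] by linarith+
  have gM: "\<bar>g (w x s)\<bar> \<le> \<gamma>2 * M" if x: "x \<in> {a..b}" for x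
  proof -
    have "\<gamma>2 * w x s \<le> \<gamma>2 * M" using w_le[OF x s0] s \<gamma>_pos by simp
    then show ?thesis using g_bounds(2)[OF w_pos[OF x s0]] g_pos[OF w_pos[OF x s0]] by linarith
  qed
  let ?G = "integral {a..b} (\<lambda>x. g (w x s) / d x)"
  have "\<bar>?f s - m / inv_mass * ?G\<bar> \<le> \<gamma>2 * M * N * sqrt (Dm * m) * sqrt (dissipation s)"
    by (rule L1_distance_to_equilibrium[OF s0 _ gM]) (intro conts s0)
  also have "\<dots> \<le> \<gamma>2 * M * N * sqrt (Dm * m) * sqrt r"
    using D \<gamma>_pos M_pos N_pos Dm_pos m_pos by (intro mult_left_mono) auto
  finally have 1: "m / inv_mass * ?G \<le> r + \<gamma>2 * M * N * sqrt (Dm * m) * sqrt r" using f by linarith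
  have "?y s \<le> integral {a..b} (\<lambda>x. Dm / \<gamma>1 * (g (w x s) / d x))"
  proof (rule integral_le)
    show "(\<lambda>x. w x s) integrable_on {a..b}" by (intro integrable_continuous_interval conts s0)
    show "(\<lambda>x. Dm / \<gamma>1 * (g (w x s) / d x)) integrable_on {a..b}"
      by (intro integrable_continuous_interval continuous_intros conts s0) (auto simp: nonzero)
    fix x assume x: "x \<in> {a..b}"
    have g: "\<gamma>1 * w x s \<le> g (w x s)" "0 < g (w x s)"
      using g_bounds(1)[OF w_pos[OF x s0]] g_pos[OF w_pos[OF x s0]] by auto
    have "w x s \<le> g (w x s) / \<gamma>1" using g \<gamma>_pos by (simp add: field_simps)
    also have "\<dots> \<le> g (w x s) / \<gamma>1 * (Dm / d x)"
      using mult_left_mono[of 1 "Dm / d x" "g (w x s) / \<gamma>1"] d_le[OF x] d_pos[OF x] g \<gamma>_pos by simp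
    finally show "w x s \<le> Dm / \<gamma>1 * (g (w x s) / d x)" by (simp add: mult_ac)
  qed
  also have "\<dots> = Dm / \<gamma>1 * ?G" by (rule integral_mult_right)
  finally have 2: "?y s \<le> Dm / \<gamma>1 * ?G" .
  have "?y T \<le> ?y s"
  proof (rule DERIV_nonpos_imp_nonincreasing[where f = ?y])
    fix x assume "s \<le> x"
    then have "0 < x" using s0 by simp
    from nutrient_derivative[OF this] f0[OF this]
    show "\<exists>z. (?y has_real_derivative z) (at x) \<and> z \<le> 0" by force
  qed (use s in simp)
  also note 2
  also have "Dm / \<gamma>1 * ?G = Dm / \<gamma>1 * (inv_mass / m) * (m / inv_mass * ?G)"
    using m_pos inv_mass_pos by simp
  also have "\<dots> \<le> Dm / \<gamma>1 * (N / m) * (r + \<gamma>2 * M * N * sqrt (Dm * m) * sqrt r)"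
  proof (rule order_trans[OF mult_left_mono[OF 1] mult_right_mono])
    show "Dm / \<gamma>1 * (inv_mass / m) \<le> Dm / \<gamma>1 * (N / m)"
      using inv_mass_le m_pos Dm_pos \<gamma>_pos by (intro mult_left_mono divide_right_mono) auto
    show "0 \<le> Dm / \<gamma>1 * (inv_mass / m)" using Dm_pos \<gamma>_pos m_pos inv_mass_pos by simp
    have "0 \<le> r" using D dissipation_bounds(1)[OF s0] by linarith
    then show "0 \<le> r + \<gamma>2 * M * N * sqrt (Dm * m) * sqrt r"
      using \<gamma>_pos M_pos N_pos Dm_pos m_pos by simp
  qed
  finally show ?thesis unfolding r_def[symmetric] by simp
qed

text \<open>
  Where \<open>d u \<le> L\<close>, the function \<open>u\<close> is dominated by \<open>L/d\<close>; elsewhere \<open>u\<close> is at most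
  \<open>u (ln (d u))_+ / ln L\<close>.
\<close>

lemma uniform_integrability:
  assumes t: "0 < t" "t \<le> T" and h: "continuous_on {a..b} h"
    and B: "\<And>x. x \<in> {a..b} \<Longrightarrow> \<bar>h x\<bar> \<le> B" and L: "1 < L"
  shows "integral {a..b} (\<lambda>x. u x t * \<bar>h x\<bar>)
    \<le> L * integral {a..b} (\<lambda>x. \<bar>h x\<bar> / d x) + B * (C0 + N + 1) / ln L"
proof -
  have B0: "0 \<le> B" using B[OF endpoints(1)] by linarith
  have lnL: "0 < ln L" using L by simp
  let ?p = "\<lambda>x. u x t * max 0 (ln (d x * u x t))"
  have i: "(\<lambda>x. \<bar>h x\<bar> / d x) integrable_on {a..b}" "?p integrable_on {a..b}"
    by (intro integrable_continuous_interval continuous_intros conts t h; auto simp: nonzero t)+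
  have "integral {a..b} (\<lambda>x. u x t * \<bar>h x\<bar>)
      \<le> integral {a..b} (\<lambda>x. L * (\<bar>h x\<bar> / d x) + B / ln L * ?p x)"
  proof (rule integral_le[OF _ integrable_add[OF integrable_on_mult_right[OF i(1)]
          integrable_on_mult_right[OF i(2)]]])
    show "(\<lambda>x. u x t * \<bar>h x\<bar>) integrable_on {a..b}"
      by (intro integrable_continuous_interval continuous_intros conts t h)
    fix x assume x: "x \<in> {a..b}"
    have p: "0 < d x" "0 < u x t" using d_pos[OF x] u_pos[OF x t(1)] by auto
    show "u x t * \<bar>h x\<bar> \<le> L * (\<bar>h x\<bar> / d x) + B / ln L * ?p x"
    proof (cases "d x * u x t \<le> L")
      case True
      then have "u x t \<le> L / d x" using p by (simp add: field_simps)
      then have "u x t * \<bar>h x\<bar> \<le> L / d x * \<bar>h x\<bar>" by (intro mult_right_mono) auto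
      moreover have "0 \<le> B / ln L * ?p x" using B0 lnL p by simp
      ultimately show ?thesis by simp
    next
      case False
      then have "ln L \<le> ln (d x * u x t)" using L by (subst ln_le_cancel_iff) auto
      then have "1 \<le> max 0 (ln (d x * u x t)) / ln L" using lnL by simp
      then have "u x t * 1 \<le> u x t * (max 0 (ln (d x * u x t)) / ln L)"
        using p by (intro mult_left_mono) auto
      then have "\<bar>h x\<bar> * u x t \<le> B * (u x t * (max 0 (ln (d x * u x t)) / ln L))"
        using p B[OF x] B0 by (intro mult_mono) auto
      moreover have "0 \<le> L * (\<bar>h x\<bar> / d x)" using L p by simp
      ultimately show ?thesis by (simp add: mult_ac)
    qed
  qed
  also have "\<dots> = L * integral {a..b} (\<lambda>x. \<bar>h x\<bar> / d x) + B / ln L * integral {a..b} ?p"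
    by (subst Henstock_Kurzweil_Integration.integral_add[OF integrable_on_mult_right[OF i(1)]
          integrable_on_mult_right[OF i(2)]]) (simp only: integral_mult_right)
  also have "\<dots> \<le> L * integral {a..b} (\<lambda>x. \<bar>h x\<bar> / d x) + B / ln L * (C0 + N + 1)"
    using energy_bounds(2)[OF t(1)] lyapunov_bounds(3)[OF t] inv_mass_le B0 lnL
    by (intro add_left_mono mult_left_mono) auto
  finally show ?thesis by simp
qed

lemma bounded_nutrient_equicontinuity:
  assumes t: "0 < t" "t \<le> T" and xy: "a \<le> y" "y \<le> x" "x \<le> b"
  shows "(w x t - w y t)\<^sup>2 \<le> 2 * (C0 + N + 1) * (\<gamma>2 * M) * integral {y..x} (\<lambda>z. 1 / d z)"
proof -
  have sub: "{y..x} \<subseteq> {a..b}" using xy by (auto simp: atLeastAtMost_iff)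
  have "0 \<le> integral {y..x} (\<lambda>z. 1 / d z)"
    using d_pos subsetD[OF sub]
    by (intro Henstock_Kurzweil_Integration.integral_nonneg
        integrable_on_subinterval[OF integrable_continuous_interval[OF inv_cont] sub])
      (auto simp: less_imp_le)
  then have nn: "0 \<le> \<gamma>2 * M * integral {y..x} (\<lambda>z. 1 / d z)" using \<gamma>_pos M_pos by simp
  have "(w x t - w y t)\<^sup>2 \<le> 2 * (energy t + inv_mass) * (\<gamma>2 * M * integral {y..x} (\<lambda>z. 1 / d z))"
    by (rule nutrient_equicontinuity[OF t(1) w_le[OF _ t] xy])
  also have "\<dots> \<le> 2 * (C0 + N + 1) * (\<gamma>2 * M * integral {y..x} (\<lambda>z. 1 / d z))"
    using lyapunov_bounds(3)[OF t] inv_mass_le by (intro mult_right_mono nn) auto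
  finally show ?thesis by (simp add: mult_ac)
qed

end

section \<open>Integrals over open intervals\<close>

lemma Lp_1_iff_integrable: "f \<in> Lp 1 S \<longleftrightarrow> integrable (lebesgue_on S) f"
  by (simp add: Lp_def integrable_iff_bounded)

lemma integrable_lebesgue_on_subset:
  fixes f :: "real \<Rightarrow> real"
  assumes "integrable (lebesgue_on S) f" "S \<in> sets lebesgue" "A \<in> sets lebesgue" "A \<subseteq> S"
  shows "integrable (lebesgue_on A) f"
proof -
  have "integrable lebesgue (\<lambda>x. indicator A x *\<^sub>R (if x \<in> S then f x else 0))"
    using assms by (intro integrable_mult_indicator) (auto simp: Lebesgue_Measure.integrable_restrict_UNIV)
  also have "(\<lambda>x. indicator A x *\<^sub>R (if x \<in> S then f x else 0)) = (\<lambda>x. if x \<in> A then f x else 0)"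
    using assms(4) by (auto simp: indicator_def fun_eq_iff)
  finally show ?thesis using assms(3) by (simp add: Lebesgue_Measure.integrable_restrict_UNIV)
qed

lemma integral_lebesgue_on_eq_of_support:
  fixes f :: "real \<Rightarrow> real"
  assumes "A \<in> sets lebesgue" "B \<in> sets lebesgue" "\<And>x. x \<in> A - B \<Longrightarrow> f x = 0" "\<And>x. x \<in> B - A \<Longrightarrow> f x = 0"
  shows "(LINT x|lebesgue_on A. f x) = (LINT x|lebesgue_on B. f x)"
proof -
  have "(\<lambda>x. if x \<in> A then f x else 0) = (\<lambda>x. if x \<in> B then f x else 0)" using assms by auto
  then show ?thesis
    using assms(1,2) by (metis (no_types) Lebesgue_Measure.integral_restrict_UNIV)
qed

lemma continuous_on_open_interval_integral:
  fixes f :: "real \<Rightarrow> real"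
  assumes "continuous_on {a..b} f"
  shows "integrable (lebesgue_on {a<..<b}) f"
    and "(LINT x|lebesgue_on {a<..<b}. f x) = integral {a..b} f"
proof -
  show i: "integrable (lebesgue_on {a<..<b}) f"
    by (rule integrable_lebesgue_on_subset[OF continuous_imp_integrable_real[OF assms]]) auto
  show "(LINT x|lebesgue_on {a<..<b}. f x) = integral {a..b} f"
    using lebesgue_integral_eq_integral[OF i] by (simp add: integral_open_interval_real)
qed

lemma AE_lebesgue_on_not_negligible:
  assumes "negligible N" "S \<in> sets lebesgue"
  shows "AE x in lebesgue_on S. x \<notin> N"
proof -
  have "AE x in lebesgue. x \<notin> N"
    using assms(1) by (intro AE_not_in) (simp add: negligible_iff_null_sets)
  then have "AE x in lebesgue. x \<in> S \<longrightarrow> x \<notin> N" by eventually_elim simp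
  then show ?thesis using assms(2) by (simp add: AE_restrict_space_iff)
qed

section \<open>Polynomials approximate bounded measurable functions\<close>

lemma real_polynomial_function_eq_poly:
  fixes f :: "real \<Rightarrow> real"
  assumes "real_polynomial_function f"
  obtains p where "f = poly p"
proof -
  obtain c n where "f = (\<lambda>x. \<Sum>i\<le>n. c i * x ^ i)"
    using assms real_polynomial_function_iff_sum by auto
  then have "f = poly (\<Sum>i\<le>n. monom (c i) i)" by (auto simp: poly_sum poly_monom)
  then show ?thesis by (rule that)
qed

text \<open>
  A measurable function is almost everywhere the limit of continuous functions; these are truncated
  at the bound and replaced by polynomials by the Weierstrass theorem.
\<close>

lemma bounded_polynomial_approximation:
  fixes \<phi> :: "real \<Rightarrow> real"
  assumes \<phi>: "\<phi> \<in> borel_measurable (lebesgue_on {a<..<b})" and C: "0 \<le> C"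
    and bd: "AE x in lebesgue_on {a<..<b}. \<bar>\<phi> x\<bar> \<le> C"
  obtains p :: "nat \<Rightarrow> real poly"
  where "\<And>n x. x \<in> {a..b} \<Longrightarrow> \<bar>poly (p n) x\<bar> \<le> C + 1"
    and "AE x in lebesgue_on {a<..<b}. (\<lambda>n. poly (p n) x) \<longlonglongrightarrow> \<phi> x"
proof -
  have "\<phi> measurable_on {a<..<b}" using \<phi> by (subst measurable_on_iff_borel_measurable) auto
  from this[unfolded measurable_on_def] obtain N h where N: "negligible N" and h: "\<And>n. continuous_on UNIV (h n)"
    and lim: "\<And>x. x \<notin> N \<Longrightarrow> (\<lambda>n. h n x) \<longlonglongrightarrow> (if x \<in> {a<..<b} then \<phi> x else 0)"
    by blast
  define k where "k n x = max (- C) (min C (h n x))" for n x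
  have "\<exists>p. \<forall>x\<in>{a..b}. \<bar>k n x - poly p x\<bar> < inverse (Suc n)" for n
  proof -
    have "continuous_on {a..b} (k n)"
      unfolding k_def by (intro continuous_intros continuous_on_subset[OF h]) auto
    then obtain q where "real_polynomial_function q" "\<And>x. x \<in> {a..b} \<Longrightarrow> \<bar>k n x - q x\<bar> < inverse (Suc n)"
      using Stone_Weierstrass_real_polynomial_function[of "{a..b}" "k n" "inverse (Suc n)"] by auto
    then show ?thesis using real_polynomial_function_eq_poly by metis
  qed
  then obtain p where p: "\<And>n x. x \<in> {a..b} \<Longrightarrow> \<bar>k n x - poly (p n) x\<bar> < inverse (Suc n)" by metis
  show ?thesis
  proof (rule that[of p])
    show "\<bar>poly (p n) x\<bar> \<le> C + 1" if "x \<in> {a..b}" for n x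
    proof -
      have "\<bar>k n x\<bar> \<le> C" using C by (auto simp: k_def)
      moreover have "inverse (real (Suc n)) \<le> 1" by (simp add: field_simps)
      ultimately show ?thesis using p[OF that, of n] by linarith
    qed
    have "AE x in lebesgue_on {a<..<b}. x \<notin> N"
      by (rule AE_lebesgue_on_not_negligible[OF N]) simp
    then show "AE x in lebesgue_on {a<..<b}. (\<lambda>n. poly (p n) x) \<longlonglongrightarrow> \<phi> x"
      using bd AE_space
    proof eventually_elim
      case (elim x)
      then have x: "x \<in> {a<..<b}" by simp
      have "(\<lambda>n. h n x) \<longlonglongrightarrow> \<phi> x" using lim[OF elim(1)] x by simp
      then have "(\<lambda>n. k n x) \<longlonglongrightarrow> max (- C) (min C (\<phi> x))"
        unfolding k_def by (intro tendsto_intros)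
      moreover have "max (- C) (min C (\<phi> x)) = \<phi> x" using elim(2) by (auto simp: abs_le_iff)
      moreover have "(\<lambda>n. k n x - poly (p n) x) \<longlonglongrightarrow> 0"
        using p[of x] x
        by (intro tendsto_rabs_zero_cancel[OF tendsto_sandwich[OF _ _ tendsto_const LIMSEQ_inverse_real_of_nat]])
          (auto simp: less_imp_le)
      ultimately show "(\<lambda>n. poly (p n) x) \<longlonglongrightarrow> \<phi> x"
        using tendsto_diff[of "\<lambda>n. k n x" "\<phi> x" sequentially "\<lambda>n. k n x - poly (p n) x" 0] by simp
    qed
  qed
qed

section \<open>Smooth bump functions\<close>

lemma Ck_on_infinity_if_closed_under_derivative:
  assumes f: "f \<in> S" and S: "\<And>h. h \<in> S \<Longrightarrow> \<exists>h'\<in>S. \<forall>x. (h has_real_derivative h' x) (at x)"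
  shows "Ck_on \<infinity> UNIV f"
proof -
  from S obtain D where D: "\<And>h. h \<in> S \<Longrightarrow> D h \<in> S"
    "\<And>h x. h \<in> S \<Longrightarrow> (h has_real_derivative D h x) (at x)" by metis
  have m: "(D ^^ n) f \<in> S" for n by (induction n) (use f D(1) in auto)
  have d: "((D ^^ n) f has_real_derivative (D ^^ Suc n) f x) (at x)" for n x
    using D(2)[OF m[of n]] by simp
  show ?thesis
    unfolding Ck_on_def
  proof (intro exI[of _ "\<lambda>n. (D ^^ n) f"] conjI allI impI ballI)
    show "continuous_on UNIV ((D ^^ n) f)" for n
      using d by (intro continuous_at_imp_continuous_on ballI DERIV_isCont)
    show "((D ^^ n) f has_real_derivative (D ^^ Suc n) f x) (at x)" for n x by (rule d)
  qed simp
qed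

text \<open>
  The function \<open>p(1/x) exp(-1/x)\<close>, continued by \<open>0\<close>. This class is closed under differentiation,
  which makes its members smooth.
\<close>

definition flat :: "real poly \<Rightarrow> real \<Rightarrow> real" where
  "flat p x = (if 0 < x then poly p (1 / x) * exp (- (1 / x)) else 0)"

lemma poly_exp_tendsto_0: "((\<lambda>y. poly p y * exp (- y)) \<longlongrightarrow> 0) at_top" for p :: "real poly"
proof (induction p)
  case (pCons c p)
  have gen: "((\<lambda>y. y ^ n * (poly p y * exp (- y))) \<longlongrightarrow> 0) at_top" for n and p :: "real poly"
  proof -
    have "((\<lambda>y. \<Sum>i\<le>degree p. coeff p i * (y ^ (n + i) / exp y)) \<longlongrightarrow> (\<Sum>i\<le>degree p. coeff p i * 0)) at_top"
      by (intro tendsto_intros tendsto_power_div_exp_0)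
    also have "(\<lambda>y. \<Sum>i\<le>degree p. coeff p i * (y ^ (n + i) / exp y)) = (\<lambda>y. y ^ n * (poly p y * exp (- y)))"
      by (auto simp: poly_altdef sum_distrib_left sum_distrib_right power_add exp_minus field_simps)
    finally show ?thesis by simp
  qed
  show ?case using gen[of 0 "pCons c p"] by simp
qed simp

lemma flat_derivative: "(flat p has_real_derivative flat ([:0, 0, 1:] * (p - pderiv p)) x) (at x)"
proof -
  let ?q = "[:0, 0, 1:] * (p - pderiv p)"
  consider "x < 0" | "x = 0" | "0 < x" by linarith
  then show ?thesis
  proof cases
    case 1
    have "((\<lambda>x. 0) has_real_derivative flat ?q x) (at x)" using 1 by (simp add: flat_def)
    moreover have "\<forall>\<^sub>F y in nhds x. y \<in> {..<0}" using 1 by (intro eventually_nhds_in_open) auto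
    then have "\<forall>\<^sub>F y in nhds x. flat p y = 0" by eventually_elim (simp add: flat_def)
    ultimately show ?thesis by (subst DERIV_cong_ev[OF refl _ refl]) auto
  next
    case 2
    have r: "((\<lambda>h. flat p h / h) \<longlongrightarrow> 0) (at_right 0)"
    proof -
      have "((\<lambda>h. poly ([:0, 1:] * p) (inverse h) * exp (- inverse h)) \<longlongrightarrow> 0) (at_right 0)"
        by (rule filterlim_compose[OF poly_exp_tendsto_0 filterlim_inverse_at_top_right])
      moreover have "\<forall>\<^sub>F h in at_right 0. poly ([:0, 1:] * p) (inverse h) * exp (- inverse h) = flat p h / h"
        using eventually_at_right_less[of 0]
        by eventually_elim (simp add: flat_def field_simps)
      ultimately show ?thesis by (rule Lim_transform_eventually)
    qed
    have l: "((\<lambda>h. flat p h / h) \<longlongrightarrow> 0) (at_left 0)"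
    proof (rule Lim_transform_eventually[OF tendsto_const])
      have "\<forall>\<^sub>F h in at_left 0. h < (0::real)" by (rule eventually_at_leftI[of "-1"]) auto
      then show "\<forall>\<^sub>F h in at_left 0. 0 = flat p h / h" by eventually_elim (simp add: flat_def)
    qed
    show ?thesis using 2 filterlim_split_at[OF l r]
      by (simp add: has_field_derivative_iff flat_def)
  next
    case 3
    have "((\<lambda>y. poly p (1 / y) * exp (- (1 / y))) has_real_derivative flat ?q x) (at x)"
      using 3 by (auto intro!: derivative_eq_intros simp: flat_def field_simps power2_eq_square)
    moreover have "\<forall>\<^sub>F y in nhds x. y \<in> {0<..}" using 3 by (intro eventually_nhds_in_open) auto
    then have "\<forall>\<^sub>F y in nhds x. poly p (1 / y) * exp (- (1 / y)) = flat p y"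
      by eventually_elim (simp add: flat_def)
    from DERIV_cong_ev[OF refl this refl] calculation show ?thesis by simp
  qed
qed

text \<open>The sums make the class closed under differentiation, by the product rule.\<close>

inductive_set bumps :: "real \<Rightarrow> real \<Rightarrow> (real \<Rightarrow> real) set" for c e :: real where
  base: "(\<lambda>x. poly r x * (flat p (x - c) * flat q (e - x))) \<in> bumps c e"
| add: "f \<in> bumps c e \<Longrightarrow> h \<in> bumps c e \<Longrightarrow> (\<lambda>x. f x + h x) \<in> bumps c e"

lemma bumps_derivative: "h \<in> bumps c e \<Longrightarrow> \<exists>h'\<in>bumps c e. \<forall>x. (h has_real_derivative h' x) (at x)"
proof (induction rule: bumps.induct)
  case (base r p q)
  let ?D = "\<lambda>p. [:0, 0, 1:] * (p - pderiv p)"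
  have f1: "((\<lambda>x. flat p (x - c)) has_real_derivative flat (?D p) (x - c)) (at x)" for x
  proof -
    have "((\<lambda>x. x - c) has_real_derivative 1) (at x)" by (auto intro!: derivative_eq_intros)
    from DERIV_chain2[OF flat_derivative this, of p] show ?thesis by simp
  qed
  have f2: "((\<lambda>x. flat q (e - x)) has_real_derivative - flat (?D q) (e - x)) (at x)" for x
  proof -
    have "((\<lambda>x. e - x) has_real_derivative -1) (at x)" by (auto intro!: derivative_eq_intros)
    from DERIV_chain2[OF flat_derivative this, of q] show ?thesis by simp
  qed
  have "((\<lambda>x. poly r x * (flat p (x - c) * flat q (e - x))) has_real_derivative
      (poly (pderiv r) x * (flat p (x - c) * flat q (e - x))
      + poly r x * (flat (?D p) (x - c) * flat q (e - x)))
      + poly (- r) x * (flat p (x - c) * flat (?D q) (e - x))) (at x)" for x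
    by (rule DERIV_cong[OF DERIV_mult[OF poly_DERIV DERIV_mult[OF f1 f2]]]) (simp add: algebra_simps)
  moreover have "(\<lambda>x. (poly (pderiv r) x * (flat p (x - c) * flat q (e - x))
      + poly r x * (flat (?D p) (x - c) * flat q (e - x)))
      + poly (- r) x * (flat p (x - c) * flat (?D q) (e - x))) \<in> bumps c e"
    by (intro bumps.intros)
  ultimately show ?case by (intro bexI) auto
next
  case (add f h)
  then obtain f' h' where "f' \<in> bumps c e" "h' \<in> bumps c e"
    "\<forall>x. (f has_real_derivative f' x) (at x)" "\<forall>x. (h has_real_derivative h' x) (at x)" by auto
  then show ?case by (intro bexI[of _ "\<lambda>x. f' x + h' x"]) (auto intro: bumps.add DERIV_add)
qed

definition bump :: "real \<Rightarrow> real \<Rightarrow> real \<Rightarrow> real" where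
  "bump c e x = flat 1 (x - c) * flat 1 (e - x)"

lemma bump_pos: "x \<in> {c<..<e} \<Longrightarrow> 0 < bump c e x"
  and bump_eq_0: "x \<notin> {c<..<e} \<Longrightarrow> bump c e x = 0"
  by (auto simp: bump_def flat_def)

lemma bump_le_1: "0 \<le> bump c e x" "bump c e x \<le> 1"
  by (auto simp: bump_def flat_def intro!: mult_le_one)

lemma test_fun_poly_bump:
  assumes "a < c" "e < b"
  shows "test_fun a b (\<lambda>x. poly r x * bump c e x)"
  unfolding test_fun_def
proof (intro conjI exI[of _ "{c..e}"] allI impI)
  have "(\<lambda>x. poly r x * bump c e x) \<in> bumps c e"
    unfolding bump_def by (rule bumps.base)
  then show "Ck_on \<infinity> UNIV (\<lambda>x. poly r x * bump c e x)"
    by (rule Ck_on_infinity_if_closed_under_derivative) (rule bumps_derivative)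
  show "poly r x * bump c e x = 0" if "x \<notin> {c..e}" for x
  proof -
    have "x \<notin> {c<..<e}" using that by auto
    then show ?thesis using bump_eq_0[of x c e] by simp
  qed
qed (use assms in auto)

lemma test_fun_derivative:
  assumes "test_fun a b \<phi>"
  shows "(\<phi> has_real_derivative deriv \<phi> x) (at x)" "continuous_on UNIV (deriv \<phi>)"
    "x \<notin> {a<..<b} \<Longrightarrow> \<phi> x = 0"
proof -
  obtain D where D: "D 0 = \<phi>" "\<And>n x. (D n has_real_derivative D (Suc n) x) (at x)"
    "\<And>n. continuous_on UNIV (D n)"
    using assms unfolding test_fun_def Ck_on_def by auto
  have "deriv \<phi> = D 1" using D(2)[of 0] by (auto simp: D(1) intro!: DERIV_imp_deriv)
  then show "(\<phi> has_real_derivative deriv \<phi> x) (at x)" "continuous_on UNIV (deriv \<phi>)"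
    using D(2)[of 0 x] D(3)[of 1] by (auto simp: D(1))
  show "x \<notin> {a<..<b} \<Longrightarrow> \<phi> x = 0"
    using assms unfolding test_fun_def by blast
qed

section \<open>Weak derivatives\<close>

text \<open>
  The difference \<open>h\<close> of the two weak derivatives is orthogonal to every polynomial times a fixed bump
  function. Approximating \<open>sgn h\<close> by polynomials shows that \<open>\<bar>h\<bar>\<close> times the bump function
  has integral zero.
\<close>

lemma weak_deriv_unique_on_subinterval:
  assumes v: "has_weak_deriv a b f v" "has_weak_deriv a b f v'" and ce: "a < c" "e < b"
  shows "AE x in lebesgue_on {c<..<e}. v x = v' x"
proof -
  let ?M = "lebesgue_on {c<..<e}"
  have sub: "{c..e} \<subseteq> {a<..<b}" using ce by auto
  have i: "integrable ?M v" "integrable ?M v'"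
    using v sub unfolding has_weak_deriv_def Lp_1_iff_integrable
    by (metis (no_types) compact_Icc integrable_lebesgue_on_subset lmeasurable_cbox fmeasurableD
        interval_cbox greaterThanLessThan_subseteq_atLeastAtMost_iff order_refl lmeasurable_interval(2))+
  define h where "h x = v x - v' x" for x
  have ih: "integrable ?M h" unfolding h_def using i by simp
  have bm: "bump c e \<in> borel_measurable ?M"
  proof -
    have "continuous_on UNIV (bump c e)"
      unfolding bump_def using flat_derivative[THEN DERIV_isCont]
      by (intro continuous_on_mult continuous_on_compose2[OF continuous_at_imp_continuous_on, of UNIV "flat 1"]
          continuous_intros) auto
    then have "bump c e \<in> borel_measurable borel" by (rule borel_measurable_continuous_onI)
    then show ?thesis by (intro measurable_restrict_space1 measurable_completion) simp
  qed
  have pm: "poly q \<in> borel_measurable ?M" for q :: "real poly"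
    by (intro measurable_restrict_space1 measurable_completion)
      (simp add: borel_measurable_continuous_onI continuous_on_poly continuous_on_id)
  have zero: "(LINT x|?M. h x * (poly q x * bump c e x)) = 0" for q
  proof -
    have t: "test_fun a b (\<lambda>x. poly q x * bump c e x)" by (rule test_fun_poly_bump[OF ce])
    obtain B where B: "\<And>x. x \<in> {c..e} \<Longrightarrow> \<bar>poly q x\<bar> \<le> B"
    proof -
      have "compact (poly q ` {c..e})" by (intro compact_continuous_image continuous_intros) auto
      then have "bounded (poly q ` {c..e})" by (rule compact_imp_bounded)
      then obtain B where "\<forall>x\<in>{c..e}. \<bar>poly q x\<bar> \<le> B" by (auto simp: bounded_iff)
      then show ?thesis by (intro that[of B]) blast
    qed
    have int: "integrable ?M (\<lambda>x. k x * (poly q x * bump c e x))" if k: "integrable ?M k" for k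
    proof (rule Bochner_Integration.integrable_bound[of ?M "\<lambda>x. B * k x"])
      show "(\<lambda>x. k x * (poly q x * bump c e x)) \<in> borel_measurable ?M"
        using borel_measurable_integrable[OF k] pm bm by (intro borel_measurable_times)
      show "AE x in ?M. norm (k x * (poly q x * bump c e x)) \<le> norm (B * k x)"
      proof (rule AE_I2)
        fix x assume "x \<in> space ?M"
        then have "\<bar>poly q x\<bar> * bump c e x \<le> B * 1"
          using B[of x] bump_le_1[of c e x] by (intro mult_mono) auto
        moreover have "0 \<le> B" using \<open>x \<in> space ?M\<close> B[of x] by force
        ultimately show "norm (k x * (poly q x * bump c e x)) \<le> norm (B * k x)"
          using bump_le_1[of c e x] mult_left_mono[of "\<bar>poly q x\<bar> * bump c e x" B "\<bar>k x\<bar>"]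
          by (simp add: abs_mult mult_ac)
      qed
    qed (use k in simp)
    have *: "(LINT x|lebesgue_on {a<..<b}. k x * (poly q x * bump c e x))
        = (LINT x|?M. k x * (poly q x * bump c e x))" for k
      using ce by (intro integral_lebesgue_on_eq_of_support) (auto simp: bump_eq_0)
    have "(LINT x|lebesgue_on {a<..<b}. f x * deriv (\<lambda>x. poly q x * bump c e x) x)
        = - (LINT x|lebesgue_on {a<..<b}. k x * (poly q x * bump c e x))"
      if "has_weak_deriv a b f k" for k
      using that t unfolding has_weak_deriv_def by blast
    from this[OF v(1)] this[OF v(2)]
    have "(LINT x|?M. v x * (poly q x * bump c e x)) = (LINT x|?M. v' x * (poly q x * bump c e x))"
      unfolding * by linarith
    then show ?thesis
      using int[OF i(1)] int[OF i(2)] by (simp add: h_def left_diff_distrib)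
  qed
  have "(\<lambda>x. sgn (h x)) \<in> borel_measurable ?M"
    using borel_measurable_integrable[OF ih] by simp
  moreover have "AE x in ?M. \<bar>sgn (h x)\<bar> \<le> 1" by (auto simp: sgn_if)
  ultimately obtain p where p: "\<And>n x. x \<in> {c..e} \<Longrightarrow> \<bar>poly (p n) x\<bar> \<le> 1 + 1"
    and lim: "AE x in ?M. (\<lambda>n. poly (p n) x) \<longlonglongrightarrow> sgn (h x)"
    using bounded_polynomial_approximation[of "\<lambda>x. sgn (h x)" c e 1] by auto
  have "(\<lambda>n. LINT x|?M. h x * (poly (p n) x * bump c e x)) \<longlonglongrightarrow> (LINT x|?M. h x * (sgn (h x) * bump c e x))"
  proof (rule integral_dominated_convergence[where w = "\<lambda>x. 2 * \<bar>h x\<bar>"])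
    show "(\<lambda>x. h x * (sgn (h x) * bump c e x)) \<in> borel_measurable ?M"
      "(\<lambda>x. h x * (poly (p n) x * bump c e x)) \<in> borel_measurable ?M" for n
      using borel_measurable_integrable[OF ih] pm bm by simp_all
    show "integrable ?M (\<lambda>x. 2 * \<bar>h x\<bar>)" using ih by simp
    show "AE x in ?M. (\<lambda>n. h x * (poly (p n) x * bump c e x)) \<longlonglongrightarrow> h x * (sgn (h x) * bump c e x)"
      using lim by eventually_elim (intro tendsto_intros)
    show "AE x in ?M. norm (h x * (poly (p n) x * bump c e x)) \<le> 2 * \<bar>h x\<bar>" for n
    proof (rule AE_I2)
      fix x assume "x \<in> space ?M"
      then have "\<bar>poly (p n) x\<bar> * bump c e x \<le> 2 * 1"
        using p[of x n] bump_le_1[of c e x] by (intro mult_mono) auto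
      then show "norm (h x * (poly (p n) x * bump c e x)) \<le> 2 * \<bar>h x\<bar>"
        using bump_le_1[of c e x] mult_left_mono[of "\<bar>poly (p n) x\<bar> * bump c e x" 2 "\<bar>h x\<bar>"]
        by (simp add: abs_mult mult_ac)
    qed
  qed
  then have z: "(LINT x|?M. h x * (sgn (h x) * bump c e x)) = 0"
    by (simp add: zero LIMSEQ_const_iff)
  have eq: "h x * (sgn (h x) * bump c e x) = \<bar>h x\<bar> * bump c e x" for x
    by (simp add: abs_sgn mult.assoc)
  have "integrable ?M (\<lambda>x. \<bar>h x\<bar> * bump c e x)"
  proof (rule Bochner_Integration.integrable_bound[OF ih])
    show "(\<lambda>x. \<bar>h x\<bar> * bump c e x) \<in> borel_measurable ?M"
      using borel_measurable_integrable[OF ih] bm by simp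
    show "AE x in ?M. norm (\<bar>h x\<bar> * bump c e x) \<le> norm (h x)"
      using bump_le_1 by (intro AE_I2) (simp add: abs_mult mult_left_le)
  qed
  then have "AE x in ?M. \<bar>h x\<bar> * bump c e x = 0"
    using z unfolding eq by (subst (asm) integral_nonneg_eq_0_iff_AE) (auto simp: bump_le_1)
  then show ?thesis
    using AE_space by eventually_elim (use bump_pos[of _ c e] in \<open>force simp: h_def\<close>)
qed

lemma weak_deriv_unique:
  assumes v: "has_weak_deriv a b f v" "has_weak_deriv a b f v'"
  shows "AE x in lebesgue_on {a<..<b}. v x = v' x"
proof -
  have "AE x in lebesgue. x \<in> {a + inverse (Suc n)<..<b - inverse (Suc n)} \<longrightarrow> v x = v' x" for n :: nat
    using weak_deriv_unique_on_subinterval[OF v, of "a + inverse (Suc n)" "b - inverse (Suc n)"]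
    by (simp add: AE_restrict_space_iff)
  then have "AE x in lebesgue. \<forall>n::nat. x \<in> {a + inverse (Suc n)<..<b - inverse (Suc n)} \<longrightarrow> v x = v' x"
    by (simp only: AE_all_countable) simp
  then have "AE x in lebesgue. x \<in> {a<..<b} \<longrightarrow> v x = v' x"
  proof eventually_elim
    case (elim x)
    show ?case
    proof
      assume x: "x \<in> {a<..<b}"
      obtain n where "inverse (real (Suc n)) < min (x - a) (b - x)"
        using reals_Archimedean[of "min (x - a) (b - x)"] x by auto
      then have "x \<in> {a + inverse (Suc n)<..<b - inverse (Suc n)}" by auto
      then show "v x = v' x" using elim by blast
    qed
  qed
  then show ?thesis by (simp add: AE_restrict_space_iff)
qed

lemma wderiv_eq_AE:
  assumes "has_weak_deriv a b f v"
  shows "has_weak_deriv a b f (wderiv a b f)"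
    and "AE x in lebesgue_on {a<..<b}. wderiv a b f x = v x"
proof -
  show 1: "has_weak_deriv a b f (wderiv a b f)"
    unfolding wderiv_def by (rule someI[of "has_weak_deriv a b f", OF assms])
  show "AE x in lebesgue_on {a<..<b}. wderiv a b f x = v x"
    by (rule weak_deriv_unique[OF 1 assms])
qed

lemma has_weak_deriv_classical:
  assumes ab: "a < b"
    and f: "\<And>x. x \<in> {a..b} \<Longrightarrow> (f has_real_derivative f' x) (at x within {a..b})"
    and f': "continuous_on {a..b} f'"
  shows "has_weak_deriv a b f f'"
  unfolding has_weak_deriv_def
proof (intro conjI allI impI)
  have c: "continuous_on {a..b} f" by (rule DERIV_continuous_on[OF f])
  fix K assume K: "compact K \<and> K \<subseteq> {a<..<b}"
  have "integrable (lebesgue_on K) k" if "continuous_on {a..b} k" for k :: "real \<Rightarrow> real"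
    using K that
    by (intro integrable_lebesgue_on_subset[OF continuous_imp_integrable_real[OF that]])
      (auto simp: lmeasurable_compact fmeasurableD)
  then show "f \<in> Lp 1 K" "f' \<in> Lp 1 K" using c f' by (auto simp: Lp_1_iff_integrable)
next
  fix \<phi> assume \<phi>: "test_fun a b \<phi>"
  have c: "continuous_on {a..b} f" by (rule DERIV_continuous_on[OF f])
  have d: "(\<phi> has_real_derivative deriv \<phi> x) (at x within {a..b})" for x
    using test_fun_derivative(1)[OF \<phi>] by (rule has_field_derivative_at_within)
  have c\<phi>: "continuous_on {a..b} \<phi>" by (rule DERIV_continuous_on[OF d])
  have cd: "continuous_on {a..b} (deriv \<phi>)"
    using test_fun_derivative(2)[OF \<phi>] by (rule continuous_on_subset) simp
  have "integral {a..b} (\<lambda>x. deriv \<phi> x * f x) = - integral {a..b} (\<lambda>x. \<phi> x * f' x)"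
    using ab test_fun_derivative(3)[OF \<phi>]
    by (intro integral_by_parts_zero_boundary[OF _ d f cd f']) auto
  moreover have "(LINT x|lebesgue_on {a<..<b}. f x * deriv \<phi> x) = integral {a..b} (\<lambda>x. f x * deriv \<phi> x)"
    "(LINT x|lebesgue_on {a<..<b}. f' x * \<phi> x) = integral {a..b} (\<lambda>x. f' x * \<phi> x)"
    by (intro continuous_on_open_interval_integral(2) continuous_on_mult c cd c\<phi> f')+
  ultimately show "(LINT x|lebesgue_on {a<..<b}. f x * deriv \<phi> x) = - (LINT x|lebesgue_on {a<..<b}. f' x * \<phi> x)"
    by (simp add: mult.commute)
qed

section \<open>The initial trace of the nutrient gradient\<close>

lemma nn_integral_open_interval_eq_integral:
  fixes f :: "real \<Rightarrow> real"
  assumes "continuous_on {a..b} f" "\<And>x. x \<in> {a..b} \<Longrightarrow> 0 \<le> f x"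
  shows "(\<integral>\<^sup>+x. ennreal (f x) \<partial>lebesgue_on {a<..<b}) = ennreal (integral {a..b} f)"
  using assms(2)
  by (subst nn_integral_eq_integral[OF continuous_on_open_interval_integral(1)[OF assms(1)]])
    (auto simp: continuous_on_open_interval_integral(2)[OF assms(1)] intro!: AE_I2)

lemma uniform_initial_continuity:
  fixes f :: "real \<Rightarrow> real \<Rightarrow> real"
  assumes c: "continuous_on ({a..b} \<times> {0..}) (\<lambda>z. f (fst z) (snd z))" and r: "0 < r"
  shows "\<forall>\<^sub>F t in at_right 0. \<forall>x\<in>{a..b}. \<bar>f x t - f x 0\<bar> \<le> r"
proof -
  have "continuous_on ({0..} \<times> {a..b}) (\<lambda>z. f (snd z) (fst z))"
    using continuous_on_compose2[OF c, of "{0..} \<times> {a..b}" "\<lambda>z. (snd z, fst z)"]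
    by (force intro!: continuous_intros)
  from continuous_on_prod_compactE[OF this compact_Icc, of 0 r] r
  obtain X where X: "0 \<in> X" "open X"
    and d: "\<forall>t\<in>X \<inter> {0..}. \<forall>x\<in>{a..b}. dist (f x t) (f x 0) \<le> r" by auto
  have "\<forall>\<^sub>F t in at_right 0. t \<in> X"
    using X by (intro eventually_at_topological[THEN iffD2]) auto
  moreover have "\<forall>\<^sub>F t in at_right (0::real). 0 < t" by (rule eventually_at_right_less)
  ultimately show ?thesis
    by eventually_elim (use d in \<open>auto simp: dist_real_def\<close>)
qed

context
  fixes a b :: real and w wx :: "real \<Rightarrow> real \<Rightarrow> real"
  assumes ab: "a < b"
    and w_dx: "\<And>x t. x \<in> {a..b} \<Longrightarrow> 0 < t \<Longrightarrow>
      ((\<lambda>y. w y t) has_real_derivative wx x t) (at x within {a..b})"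
    and wx_cont: "\<And>t. 0 < t \<Longrightarrow> continuous_on {a..b} (\<lambda>x. wx x t)"
    and w_cont: "continuous_on ({a..b} \<times> {0..}) (\<lambda>z. w (fst z) (snd z))"
    and w_pos: "\<And>x t. x \<in> {a..b} \<Longrightarrow> 0 \<le> t \<Longrightarrow> 0 < w x t"
    and W: "C0_W12 a b w"
begin

abbreviation "v0 \<equiv> wderiv a b (\<lambda>x. w x 0)"

lemma initial_trace_square_integrable:
  "v0 \<in> borel_measurable (lebesgue_on {a<..<b})" "integrable (lebesgue_on {a<..<b}) (\<lambda>x. (v0 x)\<^sup>2)"
proof -
  have "v0 \<in> Lp 2 {a<..<b}" using W unfolding C0_W12_def Lp_tendsto_def by auto
  then show "v0 \<in> borel_measurable (lebesgue_on {a<..<b})"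
    "integrable (lebesgue_on {a<..<b}) (\<lambda>x. (v0 x)\<^sup>2)"
    by (auto simp: Lp_def integrable_iff_bounded)
qed

lemma gradient_tendsto_initial_trace:
  "((\<lambda>t. \<integral>\<^sup>+x. ennreal ((wx x t - v0 x)\<^sup>2) \<partial>lebesgue_on {a<..<b}) \<longlongrightarrow> 0) (at_right 0)"
proof -
  have "((\<lambda>t. \<integral>\<^sup>+x. ennreal (\<bar>wderiv a b (\<lambda>x. w x t) x - v0 x\<bar> powr 2) \<partial>lebesgue_on {a<..<b}) \<longlongrightarrow> 0)
      (at 0 within {0..})"
    using W unfolding C0_W12_def Lp_tendsto_def by auto
  then have "((\<lambda>t. \<integral>\<^sup>+x. ennreal (\<bar>wderiv a b (\<lambda>x. w x t) x - v0 x\<bar> powr 2) \<partial>lebesgue_on {a<..<b}) \<longlongrightarrow> 0)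
      (at_right 0)"
    by (rule tendsto_within_subset) auto
  moreover have "\<forall>\<^sub>F t in at_right 0. (\<integral>\<^sup>+x. ennreal (\<bar>wderiv a b (\<lambda>x. w x t) x - v0 x\<bar> powr 2) \<partial>lebesgue_on {a<..<b})
      = (\<integral>\<^sup>+x. ennreal ((wx x t - v0 x)\<^sup>2) \<partial>lebesgue_on {a<..<b})"
    using eventually_at_right_less[of 0]
  proof eventually_elim
    case (elim t)
    have "has_weak_deriv a b (\<lambda>x. w x t) (\<lambda>x. wx x t)"
      by (rule has_weak_deriv_classical[OF ab w_dx[OF _ elim] wx_cont[OF elim]])
    from wderiv_eq_AE(2)[OF this]
    have "AE x in lebesgue_on {a<..<b}. ennreal (\<bar>wderiv a b (\<lambda>x. w x t) x - v0 x\<bar> powr 2)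
        = ennreal ((wx x t - v0 x)\<^sup>2)"
      by eventually_elim simp
    then show ?case by (rule nn_integral_cong_AE)
  qed
  ultimately show ?thesis by (rule Lim_transform_eventually)
qed

text \<open>
  For positive times \<open>sqrt w\<close> has the classical derivative \<open>w_x / (2 sqrt w)\<close>. In the defining identity
  of the weak derivative one passes to the limit \<open>t \<rightarrow> 0\<close>: \<open>w\<close> converges uniformly and is bounded
  away from \<open>0\<close>, and \<open>w_x\<close> converges in \<open>L^2\<close>.
\<close>

lemma has_weak_deriv_sqrt_initial:
  "has_weak_deriv a b (\<lambda>x. sqrt (w x 0)) (\<lambda>x. v0 x / (2 * sqrt (w x 0)))"
proof -
  let ?M = "lebesgue_on {a<..<b}"
  interpret finite_measure ?M by (rule finite_measure_lebesgue_on) simp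
  have slice: "continuous_on {a..b} (\<lambda>x. w x t)" if "0 \<le> t" for t
    using continuous_on_compose2[OF w_cont, of "{a..b}" "\<lambda>x. (x, t)"] that
    by (force intro!: continuous_intros)
  have bm: "k \<in> borel_measurable ?M" if "continuous_on {a..b} k" for k :: "real \<Rightarrow> real"
    by (rule borel_measurable_integrable[OF continuous_on_open_interval_integral(1)[OF that]])
  have csq: "continuous_on {a..b} (\<lambda>x. sqrt (w x t))" "continuous_on {a..b} (\<lambda>x. 1 / (2 * sqrt (w x t)))"
    if "0 \<le> t" for t
    using slice[OF that] w_pos[OF _ that] by (auto intro!: continuous_intros simp: less_le)
  have v0: "integrable ?M v0"
    by (rule square_integrable_imp_integrable[OF initial_trace_square_integrable])
  obtain m0 m1 where m: "0 < m0" "\<And>x t. x \<in> {a..b} \<Longrightarrow> t \<in> {0..1} \<Longrightarrow> m0 \<le> w x t"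
    "\<And>x t. x \<in> {a..b} \<Longrightarrow> t \<in> {0..1} \<Longrightarrow> w x t \<le> m1"
  proof -
    have cc: "compact ({a..b} \<times> {0..1::real})" "{a..b} \<times> {0..1::real} \<noteq> {}"
      using ab by (auto intro: compact_Times)
    have cw: "continuous_on ({a..b} \<times> {0..1}) (\<lambda>z. w (fst z) (snd z))"
      by (rule continuous_on_subset[OF w_cont]) auto
    obtain p where "p \<in> {a..b} \<times> {0..1}" "\<forall>z\<in>{a..b} \<times> {0..1}. w (fst p) (snd p) \<le> w (fst z) (snd z)"
      using continuous_attains_inf[OF cc cw] by blast
    moreover obtain q where "\<forall>z\<in>{a..b} \<times> {0..1}. w (fst z) (snd z) \<le> w (fst q) (snd q)"
      using continuous_attains_sup[OF cc cw] by blast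
    ultimately show ?thesis
      using w_pos by (intro that[of "w (fst p) (snd p)" "w (fst q) (snd q)"]) auto
  qed
  define s where "s n = inverse (real (Suc n))" for n
  have s: "0 < s n" "s n \<in> {0..1}" for n by (auto simp: s_def field_simps)
  have s0: "s \<longlonglongrightarrow> 0" unfolding s_def by (rule LIMSEQ_inverse_real_of_nat)
  have s_right: "filterlim s (at_right 0) sequentially"
  proof -
    have "s n \<noteq> 0" for n using s(1)[of n] by simp
    then show ?thesis using s0 s(1) by (auto simp: filterlim_at intro!: always_eventually)
  qed
  have w_lim: "(\<lambda>n. w x (s n)) \<longlonglongrightarrow> w x 0" if "x \<in> {a..b}" for x
  proof -
    have "continuous_on {0..} (w x)"
      using continuous_on_compose2[OF w_cont, of "{0..}" "\<lambda>t. (x, t)"] that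
      by (force intro!: continuous_intros)
    from continuous_on_tendsto_compose[OF this s0] show ?thesis using s by (simp add: less_imp_le)
  qed
  have inv_le: "1 / (2 * sqrt (w x t)) \<le> 1 / (2 * sqrt m0)" "0 \<le> 1 / (2 * sqrt (w x t))"
    if "x \<in> {a..b}" "t \<in> {0..1}" for x t
    using m(1) m(2)[OF that] by (auto intro!: divide_left_mono mult_pos_pos)
  have h: "integrable ?M (\<lambda>x. v0 x / (2 * sqrt (w x 0)))"
  proof (rule Bochner_Integration.integrable_bound)
    show "integrable ?M (\<lambda>x. v0 x * (1 / (2 * sqrt m0)))" using v0 by simp
    have "(\<lambda>x. v0 x * (1 / (2 * sqrt (w x 0)))) \<in> borel_measurable ?M"
      using borel_measurable_integrable[OF v0] bm[OF csq(2)[OF order_refl]] by (rule borel_measurable_times)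
    then show "(\<lambda>x. v0 x / (2 * sqrt (w x 0))) \<in> borel_measurable ?M" by simp
    show "AE x in ?M. norm (v0 x / (2 * sqrt (w x 0))) \<le> norm (v0 x * (1 / (2 * sqrt m0)))"
    proof (rule AE_I2)
      fix x assume "x \<in> space ?M"
      then have x: "x \<in> {a..b}" by simp
      have "\<bar>v0 x\<bar> * (1 / (2 * sqrt (w x 0))) \<le> \<bar>v0 x\<bar> * (1 / (2 * sqrt m0))"
        using inv_le[OF x, of 0] by (intro mult_left_mono) auto
      then show "norm (v0 x / (2 * sqrt (w x 0))) \<le> norm (v0 x * (1 / (2 * sqrt m0)))"
        using m(1) m(2)[OF x, of 0] by (simp add: abs_mult)
    qed
  qed
  show ?thesis
    unfolding has_weak_deriv_def
  proof (intro conjI allI impI)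
    fix K assume "compact K \<and> K \<subseteq> {a<..<b}"
    then show "(\<lambda>x. sqrt (w x 0)) \<in> Lp 1 K" "(\<lambda>x. v0 x / (2 * sqrt (w x 0))) \<in> Lp 1 K"
      using h continuous_on_open_interval_integral(1)[OF csq(1)[OF order_refl]]
      by (auto simp: Lp_1_iff_integrable lmeasurable_compact fmeasurableD
          intro: integrable_lebesgue_on_subset)
  next
    fix \<phi> assume \<phi>: "test_fun a b \<phi>"
    have c\<phi>: "continuous_on {a..b} \<phi>"
      using test_fun_derivative(1)[OF \<phi>] by (intro continuous_at_imp_continuous_on ballI DERIV_isCont)
    have cd: "continuous_on {a..b} (deriv \<phi>)"
      using test_fun_derivative(2)[OF \<phi>] by (rule continuous_on_subset) simp
    obtain C where C: "\<And>x. x \<in> {a..b} \<Longrightarrow> \<bar>\<phi> x\<bar> \<le> C" "\<And>x. x \<in> {a..b} \<Longrightarrow> \<bar>deriv \<phi> x\<bar> \<le> C"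
    proof -
      have "bounded (\<phi> ` {a..b})" "bounded (deriv \<phi> ` {a..b})"
        using c\<phi> cd by (auto intro!: compact_imp_bounded compact_continuous_image)
      then obtain C1 C2 where "\<forall>x\<in>{a..b}. \<bar>\<phi> x\<bar> \<le> C1" "\<forall>x\<in>{a..b}. \<bar>deriv \<phi> x\<bar> \<le> C2"
        by (auto simp: bounded_iff)
      then show ?thesis by (intro that[of "max C1 C2"]) force+
    qed
    have C0: "0 \<le> C" using C(1)[of a] ab by force
    define k where "k t x = 1 / (2 * sqrt (w x t)) * \<phi> x" for t x
    have kb: "\<bar>k t x\<bar> \<le> 1 / (2 * sqrt m0) * C" if "x \<in> {a..b}" "t \<in> {0..1}" for x t
      using inv_le[OF that] C(1)[OF that(1)] C0 m(1) unfolding k_def abs_mult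
      by (intro mult_mono) auto
    have ck: "continuous_on {a..b} (k t)" if "0 \<le> t" for t
      unfolding k_def by (intro continuous_on_mult csq(2)[OF that] c\<phi>)
    have id: "(LINT x|?M. sqrt (w x (s n)) * deriv \<phi> x) = - (LINT x|?M. wx x (s n) * k (s n) x)" for n
    proof -
      have "((\<lambda>x. sqrt (w x (s n))) has_real_derivative wx x (s n) * (1 / (2 * sqrt (w x (s n)))))
          (at x within {a..b})" if "x \<in> {a..b}" for x
        using w_pos[OF that, of "s n"] s[of n]
        by (auto intro!: derivative_eq_intros w_dx that simp: field_simps)
      then have "has_weak_deriv a b (\<lambda>x. sqrt (w x (s n))) (\<lambda>x. wx x (s n) * (1 / (2 * sqrt (w x (s n)))))"
        using s[of n] by (intro has_weak_deriv_classical[OF ab] continuous_on_mult wx_cont csq) auto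
      then show ?thesis using \<phi> by (simp add: has_weak_deriv_def k_def mult.assoc)
    qed
    have "(\<lambda>n. LINT x|?M. sqrt (w x (s n)) * deriv \<phi> x) \<longlonglongrightarrow> (LINT x|?M. sqrt (w x 0) * deriv \<phi> x)"
    proof (rule integral_dominated_convergence[where w = "\<lambda>x. sqrt m1 * C"])
      show "(\<lambda>x. sqrt (w x 0) * deriv \<phi> x) \<in> borel_measurable ?M"
        by (intro bm continuous_on_mult csq(1) cd) simp
      show "(\<lambda>x. sqrt (w x (s n)) * deriv \<phi> x) \<in> borel_measurable ?M" for n
        using s[of n] by (intro bm continuous_on_mult csq(1) cd) simp
      show "AE x in ?M. (\<lambda>n. sqrt (w x (s n)) * deriv \<phi> x) \<longlonglongrightarrow> sqrt (w x 0) * deriv \<phi> x"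
        by (intro AE_I2 tendsto_mult tendsto_real_sqrt w_lim tendsto_const) simp
      show "AE x in ?M. norm (sqrt (w x (s n)) * deriv \<phi> x) \<le> sqrt m1 * C" for n
      proof (rule AE_I2)
        fix x assume "x \<in> space ?M"
        then have x: "x \<in> {a..b}" by simp
        have "0 < w x (s n)" "w x (s n) \<le> m1"
          using w_pos[OF x less_imp_le[OF s(1)]] m(3)[OF x s(2)] by auto
        then show "norm (sqrt (w x (s n)) * deriv \<phi> x) \<le> sqrt m1 * C"
          using C(2)[OF x] unfolding norm_mult by (intro mult_mono) auto
      qed
    qed simp
    \<comment> \<open>\<open>w_x\<close> converges in \<open>L^2\<close>, the factor \<open>k\<close> boundedly and pointwise.\<close>
    moreover have "(\<lambda>n. LINT x|?M. wx x (s n) * k (s n) x) \<longlonglongrightarrow> (LINT x|?M. v0 x * k 0 x)"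
    proof -
      have "(\<lambda>n. LINT x|?M. v0 x * k (s n) x) \<longlonglongrightarrow> (LINT x|?M. v0 x * k 0 x)"
      proof (rule integral_dominated_convergence[where w = "\<lambda>x. \<bar>v0 x\<bar> * (1 / (2 * sqrt m0) * C)"])
        show "(\<lambda>x. v0 x * k 0 x) \<in> borel_measurable ?M"
          by (intro borel_measurable_times borel_measurable_integrable[OF v0] bm ck) simp
        show "(\<lambda>x. v0 x * k (s n) x) \<in> borel_measurable ?M" for n
          using s[of n] by (intro borel_measurable_times borel_measurable_integrable[OF v0] bm ck) simp
        show "integrable ?M (\<lambda>x. \<bar>v0 x\<bar> * (1 / (2 * sqrt m0) * C))" using v0 by simp
        show "AE x in ?M. (\<lambda>n. v0 x * k (s n) x) \<longlonglongrightarrow> v0 x * k 0 x"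
        proof (rule AE_I2)
          fix x assume "x \<in> space ?M"
          then have x: "x \<in> {a..b}" by simp
          show "(\<lambda>n. v0 x * k (s n) x) \<longlonglongrightarrow> v0 x * k 0 x"
            unfolding k_def using w_lim[OF x] w_pos[OF x, of 0] by (intro tendsto_intros) auto
        qed
        show "AE x in ?M. norm (v0 x * k (s n) x) \<le> \<bar>v0 x\<bar> * (1 / (2 * sqrt m0) * C)" for n
        proof (rule AE_I2)
          fix x assume "x \<in> space ?M"
          then have "\<bar>v0 x\<bar> * \<bar>k (s n) x\<bar> \<le> \<bar>v0 x\<bar> * (1 / (2 * sqrt m0) * C)"
            by (intro mult_left_mono kb s(2)) auto
          then show "norm (v0 x * k (s n) x) \<le> \<bar>v0 x\<bar> * (1 / (2 * sqrt m0) * C)"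
            by (simp only: real_norm_def abs_mult)
        qed
      qed
      moreover have "(\<lambda>n. LINT x|?M. (wx x (s n) - v0 x) * k (s n) x) \<longlonglongrightarrow> 0"
      proof -
        have wxi: "integrable ?M (\<lambda>x. wx x (s n))" for n
          by (intro continuous_on_open_interval_integral(1) wx_cont s)
        have L2: "(\<lambda>n. \<integral>\<^sup>+x. ennreal ((wx x (s n) - v0 x)\<^sup>2) \<partial>?M) \<longlonglongrightarrow> 0"
          using filterlim_compose[OF gradient_tendsto_initial_trace s_right] .
        show ?thesis
        proof (rule tendstoI)
          fix r :: real assume r: "0 < r"
          define c where "c = 1 / (2 * sqrt m0) * C + 1"
          have c: "0 < c" using m(1) C0 by (auto simp: c_def intro!: add_nonneg_pos)
          \<comment> \<open>Young's inequality with \<open>\<delta>\<close> passes from \<open>L^2\<close> to \<open>L^1\<close>.\<close>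
          define \<delta> where "\<delta> = r / (2 * c * (b - a))"
          have \<delta>: "0 < \<delta>" using r c ab by (simp add: \<delta>_def)
          have "0 < ennreal (\<delta> * r / (2 * c))" using \<delta> r c by simp
          from order_tendstoD(2)[OF L2 this]
          have "\<forall>\<^sub>F n in sequentially. (\<integral>\<^sup>+x. ennreal ((wx x (s n) - v0 x)\<^sup>2) \<partial>?M) < ennreal (\<delta> * r / (2 * c))" .
          then show "\<forall>\<^sub>F n in sequentially. dist (LINT x|?M. (wx x (s n) - v0 x) * k (s n) x) 0 < r"
          proof eventually_elim
            case (elim n)
            let ?y = "\<lambda>x. wx x (s n) - v0 x"
            have ym: "?y \<in> borel_measurable ?M" using wxi[of n] v0 by auto
            have i2: "integrable ?M (\<lambda>x. (?y x)\<^sup>2)"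
              using elim ym by (auto simp: integrable_iff_bounded top.extremum_strict dest: order_less_trans[OF _ ennreal_less_top])
            have L: "(LINT x|?M. (?y x)\<^sup>2) < \<delta> * r / (2 * c)"
              using elim \<delta> r c by (subst (asm) nn_integral_eq_integral[OF i2])
                (auto simp: ennreal_less_iff intro!: integral_nonneg_AE)
            have iy: "integrable ?M (\<lambda>x. ?y x * k (s n) x)"
            proof (rule Bochner_Integration.integrable_bound[of _ "\<lambda>x. c * ?y x"])
              show "integrable ?M (\<lambda>x. c * ?y x)" using wxi v0 by simp
              show "(\<lambda>x. ?y x * k (s n) x) \<in> borel_measurable ?M"
                using s[of n] by (intro borel_measurable_times ym bm ck) simp
              show "AE x in ?M. norm (?y x * k (s n) x) \<le> norm (c * ?y x)"
              proof (rule AE_I2)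
                fix x assume "x \<in> space ?M"
                then have "\<bar>k (s n) x\<bar> \<le> c" using kb[of x "s n"] s[of n] by (simp add: c_def)
                then show "norm (?y x * k (s n) x) \<le> norm (c * ?y x)"
                  using c mult_left_mono[of "\<bar>k (s n) x\<bar>" c "\<bar>?y x\<bar>"] by (simp add: abs_mult mult.commute)
              qed
            qed
            have "\<bar>LINT x|?M. ?y x * k (s n) x\<bar> \<le> (LINT x|?M. \<bar>?y x * k (s n) x\<bar>)"
              by (rule integral_abs_bound)
            also have "\<dots> \<le> (LINT x|?M. c / 2 * (\<delta> + (?y x)\<^sup>2 / \<delta>))"
            proof (rule integral_mono)
              show "integrable ?M (\<lambda>x. \<bar>?y x * k (s n) x\<bar>)" using iy by simp
              show "integrable ?M (\<lambda>x. c / 2 * (\<delta> + (?y x)\<^sup>2 / \<delta>))" using i2 by simp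
              fix x assume "x \<in> space ?M"
              then have kc: "\<bar>k (s n) x\<bar> \<le> c" using kb[of x "s n"] s[of n] by (simp add: c_def)
              have "0 \<le> (\<delta> - \<bar>?y x\<bar>)\<^sup>2 / \<delta>" using \<delta> by simp
              also have "\<dots> = \<delta> + (?y x)\<^sup>2 / \<delta> - 2 * \<bar>?y x\<bar>"
                using \<delta> by (simp add: power2_diff diff_divide_distrib add_divide_distrib) (simp add: power2_eq_square)
              finally have "\<bar>?y x\<bar> \<le> 1 / 2 * (\<delta> + (?y x)\<^sup>2 / \<delta>)" by simp
              then have "\<bar>?y x\<bar> * \<bar>k (s n) x\<bar> \<le> 1 / 2 * (\<delta> + (?y x)\<^sup>2 / \<delta>) * c"
                using kc \<delta> by (intro mult_mono) auto
              then show "\<bar>?y x * k (s n) x\<bar> \<le> c / 2 * (\<delta> + (?y x)\<^sup>2 / \<delta>)"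
                by (simp add: abs_mult mult_ac)
            qed
            also have "\<dots> = c / 2 * (\<delta> * (b - a) + (LINT x|?M. (?y x)\<^sup>2) / \<delta>)"
              using i2 ab by (simp add: measure_restrict_space)
            also have "\<dots> < c / 2 * (\<delta> * (b - a) + (\<delta> * r / (2 * c)) / \<delta>)"
              using L c \<delta> by (intro mult_strict_left_mono add_strict_left_mono divide_strict_right_mono) auto
            also have "\<dots> = r / 2"
            proof -
              have "\<delta> * (b - a) = r / (2 * c)" using ab by (simp add: \<delta>_def)
              moreover have "(\<delta> * r / (2 * c)) / \<delta> = r / (2 * c)" using \<delta> by simp
              ultimately show ?thesis using c by simp
            qed
            finally show ?case using r by simp
          qed
        qed
      qed
      moreover have "(LINT x|?M. (wx x (s n) - v0 x) * k (s n) x) + (LINT x|?M. v0 x * k (s n) x)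
          = (LINT x|?M. wx x (s n) * k (s n) x)" for n
      proof -
        have "integrable ?M (\<lambda>x. wx x (s n) * k (s n) x)"
          using s[of n] by (intro continuous_on_open_interval_integral(1) continuous_on_mult wx_cont ck) auto
        moreover have "integrable ?M (\<lambda>x. v0 x * k (s n) x)"
        proof (rule Bochner_Integration.integrable_bound[of _ "\<lambda>x. v0 x * (1 / (2 * sqrt m0) * C)"])
          show "(\<lambda>x. v0 x * k (s n) x) \<in> borel_measurable ?M"
            using s[of n] by (intro borel_measurable_times borel_measurable_integrable[OF v0] bm ck) simp
          show "AE x in ?M. norm (v0 x * k (s n) x) \<le> norm (v0 x * (1 / (2 * sqrt m0) * C))"
            unfolding norm_mult using kb[OF _ s(2)] C0 m(1)
            by (intro AE_I2 mult_left_mono) (auto simp: abs_mult)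
        qed (use v0 in simp)
        ultimately show ?thesis by (simp add: left_diff_distrib)
      qed
      ultimately show ?thesis using tendsto_add[of "\<lambda>n. LINT x|?M. (wx x (s n) - v0 x) * k (s n) x" 0
          sequentially "\<lambda>n. LINT x|?M. v0 x * k (s n) x"] by simp
    qed
    ultimately have "(LINT x|?M. sqrt (w x 0) * deriv \<phi> x) = - (LINT x|?M. v0 x * k 0 x)"
      unfolding id using tendsto_minus LIMSEQ_unique by blast
    then show "(LINT x|?M. sqrt (w x 0) * deriv \<phi> x) = - (LINT x|?M. v0 x / (2 * sqrt (w x 0)) * \<phi> x)"
      by (simp add: k_def)
  qed
qed

text \<open>Both sides are four times the square of a weak derivative of \<open>sqrt w0\<close>.\<close>

lemma fisher_initial_AE:
  assumes w0: "w0 \<in> borel_measurable (lebesgue_on {a<..<b})"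
    and eq: "AE x in lebesgue_on {a<..<b}. w x 0 = w0 x"
  shows "AE x in lebesgue_on {a<..<b}. fisher a b w0 x = (v0 x)\<^sup>2 / w x 0"
proof -
  let ?M = "lebesgue_on {a<..<b}"
  have "has_weak_deriv a b (\<lambda>x. sqrt (w0 x)) (\<lambda>x. v0 x / (2 * sqrt (w x 0)))"
    unfolding has_weak_deriv_def
  proof (intro conjI allI impI)
    fix K assume K: "compact K \<and> K \<subseteq> {a<..<b}"
    show "(\<lambda>x. v0 x / (2 * sqrt (w x 0))) \<in> Lp 1 K"
      using has_weak_deriv_sqrt_initial K by (simp add: has_weak_deriv_def)
    have "continuous_on {a..b} (\<lambda>x. sqrt (w x 0))"
      using continuous_on_compose2[OF w_cont, of "{a..b}" "\<lambda>x. (x, 0)"]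
      by (force intro!: continuous_intros)
    from continuous_on_open_interval_integral(1)[OF this]
    have "integrable ?M (\<lambda>x. sqrt (w0 x))"
      by (rule integrable_cong_AE_imp) (use w0 eq in \<open>auto elim!: eventually_mono\<close>)
    then show "(\<lambda>x. sqrt (w0 x)) \<in> Lp 1 K"
      using K by (auto simp: Lp_1_iff_integrable lmeasurable_compact fmeasurableD
          intro: integrable_lebesgue_on_subset)
  next
    fix \<phi> assume \<phi>: "test_fun a b \<phi>"
    have "(LINT x|?M. sqrt (w0 x) * deriv \<phi> x) = (LINT x|?M. sqrt (w x 0) * deriv \<phi> x)"
    proof (rule integral_cong_AE)
      have "continuous_on {a..b} (\<lambda>x. w x 0)"
        using continuous_on_compose2[OF w_cont, of "{a..b}" "\<lambda>x. (x, 0)"]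
        by (force intro!: continuous_intros)
      then have c: "continuous_on {a..b} (\<lambda>x. sqrt (w x 0))" by (intro continuous_intros)
      have cd: "continuous_on {a..b} (deriv \<phi>)"
        using test_fun_derivative(2)[OF \<phi>] by (rule continuous_on_subset) simp
      note bm = borel_measurable_integrable[OF continuous_on_open_interval_integral(1)]
      show "(\<lambda>x. sqrt (w x 0) * deriv \<phi> x) \<in> borel_measurable ?M"
        by (intro bm continuous_on_mult c cd)
      show "(\<lambda>x. sqrt (w0 x) * deriv \<phi> x) \<in> borel_measurable ?M"
        using w0 bm[OF cd] by simp
      show "AE x in ?M. sqrt (w0 x) * deriv \<phi> x = sqrt (w x 0) * deriv \<phi> x"
        using eq by eventually_elim simp
    qed
    then show "(LINT x|?M. sqrt (w0 x) * deriv \<phi> x) = - (LINT x|?M. v0 x / (2 * sqrt (w x 0)) * \<phi> x)"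
      using has_weak_deriv_sqrt_initial \<phi> by (simp add: has_weak_deriv_def)
  qed
  from wderiv_eq_AE(2)[OF this] show ?thesis
    using AE_space
  proof eventually_elim
    case (elim x)
    then have "0 < w x 0" using w_pos[of x 0] by simp
    then show ?case using elim(1) by (simp add: fisher_def power_divide power_mult_distrib)
  qed
qed

end

section \<open>Classical derivatives of the regularized solutions\<close>

lemma dx_eqI:
  assumes "a < b" "x \<in> {a..b}" "(h has_real_derivative h') (at x within {a..b})"
    and "\<And>y. y \<in> {a..b} \<Longrightarrow> f y = h y"
  shows "dx a b f x = h'"
proof -
  have "(f has_real_derivative h') (at x within {a..b})"
    by (rule has_field_derivative_transform_within[OF assms(3) zero_less_one assms(2)])
      (simp add: assms(4))
  then have "(f has_vector_derivative h') (at x within {a..b})"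
    by (simp add: has_real_derivative_iff_has_vector_derivative)
  then show ?thesis
    unfolding dx_def using vector_derivative_within_closed_interval[OF assms(1,2)] by blast
qed

lemma dx_derivative:
  assumes "a < b" "Ck_on \<infinity> {a..b} d"
  obtains d2 where "\<And>x. x \<in> {a..b} \<Longrightarrow> (d has_real_derivative dx a b d x) (at x within {a..b})"
    and "\<And>x. x \<in> {a..b} \<Longrightarrow> (dx a b d has_real_derivative d2 x) (at x within {a..b})"
    and "continuous_on {a..b} (dx a b d)" and "continuous_on {a..b} d2"
proof -
  obtain D where D: "D 0 = d" "\<And>n x. x \<in> {a..b} \<Longrightarrow> (D n has_real_derivative D (Suc n) x) (at x within {a..b})"
    "\<And>n. continuous_on {a..b} (D n)"
    using assms(2) unfolding Ck_on_def by auto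
  have e: "dx a b d x = D 1 x" if "x \<in> {a..b}" for x
    using dx_eqI[OF assms(1) that D(2)[OF that, of 0]] by (simp add: D(1))
  show ?thesis
  proof (rule that[of "D 2"])
    show "(d has_real_derivative dx a b d x) (at x within {a..b})" if "x \<in> {a..b}" for x
      using D(2)[OF that, of 0] e[OF that] by (simp add: D(1))
    show "(dx a b d has_real_derivative D 2 x) (at x within {a..b})" if "x \<in> {a..b}" for x
      by (rule has_field_derivative_transform_within[OF D(2)[OF that, of 1, simplified Suc_1] zero_less_one that])
        (simp add: e)
    show "continuous_on {a..b} (dx a b d)"
      using D(3)[of 1] by (rule continuous_on_eq) (simp add: e)
  qed (rule D(3))
qed

lemma continuous_on_eq_on_closed_interval:
  fixes f h :: "real \<Rightarrow> real"
  assumes "a < b" "continuous_on {a..b} f" "continuous_on {a..b} h"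
    and "\<And>x. x \<in> {a<..<b} \<Longrightarrow> f x = h x" and "x \<in> {a..b}"
  shows "f x = h x"
proof -
  have "continuous_on (closure {a<..<b}) (\<lambda>x. f x - h x)"
    using assms(1-3) by (simp add: continuous_on_diff)
  from continuous_constant_on_closure[OF this, of 0 x] assms show ?thesis by simp
qed

lemma growth_function_bounds:
  assumes g: "Ck_on 2 {0..} g" "g 0 = 0"
    and bd: "\<forall>s\<ge>0. \<gamma>1 \<le> vector_derivative g (at s within {0..}) \<and>
                 vector_derivative g (at s within {0..}) \<le> \<gamma>2"
  shows "\<And>s. 0 < s \<Longrightarrow> (g has_real_derivative deriv g s) (at s)"
    and "continuous_on {0<..} (deriv g)"
    and "\<And>s. 0 < s \<Longrightarrow> \<gamma>1 \<le> deriv g s"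
    and "\<And>s. 0 < s \<Longrightarrow> \<gamma>1 * s \<le> g s" "\<And>s. 0 < s \<Longrightarrow> g s \<le> \<gamma>2 * s"
proof -
  obtain D where D: "D 0 = g" "\<And>n x. enat n < 2 \<Longrightarrow> x \<in> {0..} \<Longrightarrow> (D n has_real_derivative D (Suc n) x) (at x within {0..})"
    "\<And>n. enat n \<le> 2 \<Longrightarrow> continuous_on {0..} (D n)"
    using g(1) unfolding Ck_on_def by blast
  have two: "enat 0 < 2" "enat 0 \<le> 2" "enat 1 \<le> 2" by (auto simp: numeral_eq_enat)
  have at: "at s within {0..} = at s" if "0 < s" for s :: real
    using that by (intro at_within_interior) (simp add: interior_Ici)
  have d: "(g has_real_derivative D 1 s) (at s)" if "0 < s" for s
    using D(2)[OF two(1), of s] that at[OF that] by (simp add: D(1))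
  have e: "deriv g s = D 1 s" if "0 < s" for s using d[OF that] by (rule DERIV_imp_deriv)
  show d': "(g has_real_derivative deriv g s) (at s)" if "0 < s" for s
    using d[OF that] e[OF that] by simp
  have "continuous_on {0<..} (D 1)" by (rule continuous_on_subset[OF D(3)[OF two(3)]]) auto
  then show "continuous_on {0<..} (deriv g)" by (rule continuous_on_eq) (simp add: e)
  have v: "vector_derivative g (at s within {0..}) = deriv g s" if "0 < s" for s
    using d'[OF that] at[OF that]
    by (simp add: has_real_derivative_iff_has_vector_derivative vector_derivative_at)
  have b: "\<gamma>1 \<le> deriv g s" "deriv g s \<le> \<gamma>2" if "0 < s" for s
    using bd[rule_format, of s] v[OF that] that by auto
  show "\<gamma>1 \<le> deriv g s" if "0 < s" for s by (rule b(1)[OF that])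
  have m: "\<exists>z. 0 < z \<and> g s = s * deriv g z" if s: "0 < s" for s
  proof -
    have "continuous_on {0..s} g" using continuous_on_subset[OF D(3)[OF two(2)], of "{0..s}"] by (auto simp: D(1))
    moreover have "g differentiable (at x)" if "0 < x" for x
      using d[OF that] real_differentiable_def by blast
    ultimately obtain l z where z: "0 < z" "(g has_real_derivative l) (at z)" "g s - g 0 = (s - 0) * l"
      using MVT[OF s, of g] by auto
    have "l = deriv g z" using DERIV_imp_deriv[OF z(2)] by simp
    then show ?thesis using z g(2) by auto
  qed
  show "\<gamma>1 * s \<le> g s" "g s \<le> \<gamma>2 * s" if s: "0 < s" for s
  proof -
    obtain z where z: "0 < z" "g s = s * deriv g z" using m[OF s] by blast
    have "s * \<gamma>1 \<le> s * deriv g z" "s * deriv g z \<le> s * \<gamma>2"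
      using s b[OF z(1)] by (auto intro: mult_left_mono)
    then show "\<gamma>1 * s \<le> g s" "g s \<le> \<gamma>2 * s" using z(2) by (auto simp: mult.commute)
  qed
qed

lemma C21_onE:
  assumes "C21_on a b v"
  obtains vx vxx vt
  where "\<And>x t. x \<in> {a..b} \<Longrightarrow> 0 < t \<Longrightarrow> ((\<lambda>y. v y t) has_real_derivative vx x t) (at x within {a..b})"
    and "\<And>x t. x \<in> {a..b} \<Longrightarrow> 0 < t \<Longrightarrow> ((\<lambda>y. vx y t) has_real_derivative vxx x t) (at x within {a..b})"
    and "\<And>x t. x \<in> {a..b} \<Longrightarrow> 0 < t \<Longrightarrow> (v x has_real_derivative vt x t) (at t)"
    and "continuous_on ({a..b} \<times> {0<..}) (\<lambda>z. v (fst z) (snd z))"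
    and "continuous_on ({a..b} \<times> {0<..}) (\<lambda>z. vx (fst z) (snd z))"
    and "continuous_on ({a..b} \<times> {0<..}) (\<lambda>z. vxx (fst z) (snd z))"
    and "continuous_on ({a..b} \<times> {0<..}) (\<lambda>z. vt (fst z) (snd z))"
proof -
  from assms[unfolded C21_on_def case_prod_unfold] obtain vx vxx vt where
    *: "\<forall>x\<in>{a..b}. \<forall>t>0.
        ((\<lambda>y. v y t) has_real_derivative vx x t) (at x within {a..b}) \<and>
        ((\<lambda>y. vx y t) has_real_derivative vxx x t) (at x within {a..b}) \<and>
        ((\<lambda>s. v x s) has_real_derivative vt x t) (at t)"
    and c: "continuous_on ({a..b} \<times> {0<..}) (\<lambda>z. v (fst z) (snd z))"
      "continuous_on ({a..b} \<times> {0<..}) (\<lambda>z. vx (fst z) (snd z))"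
      "continuous_on ({a..b} \<times> {0<..}) (\<lambda>z. vxx (fst z) (snd z))"
      "continuous_on ({a..b} \<times> {0<..}) (\<lambda>z. vt (fst z) (snd z))"
    by blast
  show ?thesis
    by (rule that[of vx vxx vt]) (use * c in blast)+
qed

text \<open>
  The equations are stated in the open interval; by continuity of all terms up to the boundary they hold
  on the closed interval, where the integrations by parts take place.
\<close>

lemma regularized_flow_of_solution:
  assumes ab: "a < b" and e: "0 < e" and \<gamma>: "0 < \<gamma>1" "0 < \<gamma>2"
    and g: "Ck_on 2 {0..} g" "g 0 = 0"
    and bd: "\<forall>s\<ge>0. \<gamma>1 \<le> vector_derivative g (at s within {0..}) \<and>
                 vector_derivative g (at s within {0..}) \<le> \<gamma>2"
    and d: "Ck_on \<infinity> {a..b} d" and d_pos: "\<forall>x\<in>{a..b}. 0 < d x"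
    and d_bd: "dx a b d a = 0" "dx a b d b = 0"
    and sol: "regularized_solution a b e d g u0 w0 u w"
  obtains ux ut wx wt R
  where "regularized_flow a b e \<gamma>1 \<gamma>2 d (dx a b d) g (deriv g) u ux ut w wx wt R"
proof -
  note sol = sol[unfolded regularized_solution_def]
  obtain d2 where d1: "\<And>x. x \<in> {a..b} \<Longrightarrow> (d has_real_derivative dx a b d x) (at x within {a..b})"
    and d2: "\<And>x. x \<in> {a..b} \<Longrightarrow> (dx a b d has_real_derivative d2 x) (at x within {a..b})"
    and cd1: "continuous_on {a..b} (dx a b d)" and cd2: "continuous_on {a..b} d2"
    using dx_derivative[OF ab d] by blast
  have "C21_on a b u" "C21_on a b w" using sol by auto
  obtain ux uxx ut where
    u: "\<And>x t. x \<in> {a..b} \<Longrightarrow> 0 < t \<Longrightarrow> ((\<lambda>y. u y t) has_real_derivative ux x t) (at x within {a..b})"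
       "\<And>x t. x \<in> {a..b} \<Longrightarrow> 0 < t \<Longrightarrow> ((\<lambda>y. ux y t) has_real_derivative uxx x t) (at x within {a..b})"
       "\<And>x t. x \<in> {a..b} \<Longrightarrow> 0 < t \<Longrightarrow> (u x has_real_derivative ut x t) (at t)"
    and cu: "continuous_on ({a..b} \<times> {0<..}) (\<lambda>z. u (fst z) (snd z))"
      "continuous_on ({a..b} \<times> {0<..}) (\<lambda>z. ux (fst z) (snd z))"
      "continuous_on ({a..b} \<times> {0<..}) (\<lambda>z. uxx (fst z) (snd z))"
      "continuous_on ({a..b} \<times> {0<..}) (\<lambda>z. ut (fst z) (snd z))"
    by (rule C21_onE[OF \<open>C21_on a b u\<close>]) blast
  obtain wx wxx wt where
    w: "\<And>x t. x \<in> {a..b} \<Longrightarrow> 0 < t \<Longrightarrow> ((\<lambda>y. w y t) has_real_derivative wx x t) (at x within {a..b})"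
       "\<And>x t. x \<in> {a..b} \<Longrightarrow> 0 < t \<Longrightarrow> ((\<lambda>y. wx y t) has_real_derivative wxx x t) (at x within {a..b})"
       "\<And>x t. x \<in> {a..b} \<Longrightarrow> 0 < t \<Longrightarrow> (w x has_real_derivative wt x t) (at t)"
    and cw: "continuous_on ({a..b} \<times> {0<..}) (\<lambda>z. w (fst z) (snd z))"
      "continuous_on ({a..b} \<times> {0<..}) (\<lambda>z. wx (fst z) (snd z))"
      "continuous_on ({a..b} \<times> {0<..}) (\<lambda>z. wxx (fst z) (snd z))"
      "continuous_on ({a..b} \<times> {0<..}) (\<lambda>z. wt (fst z) (snd z))"
    by (rule C21_onE[OF \<open>C21_on a b w\<close>]) blast
  note gb = growth_function_bounds[OF g bd]
  have w_pos: "0 < w x t" if "x \<in> {a..b}" "0 < t" for x t using sol that by auto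
  have g_pos: "0 < g s" if "0 < s" for s using gb(4)[OF that] \<gamma>(1) that by (smt (verit) mult_pos_pos)
  have cd: "continuous_on {a..b} d" by (rule DERIV_continuous_on[OF d1])
  have cg: "continuous_on {0<..} g"
    by (rule DERIV_continuous_on[where D = "deriv g"]) (simp add: gb(1) has_field_derivative_at_within)
  define J where "J x t = dx a b d x * u x t + d x * ux x t - d x * u x t * wx x t" for x t
  \<comment> \<open>\<open>J\<close> is the flux, \<open>Jx\<close> its space derivative written out.\<close>
  define Jx where "Jx x t = d2 x * u x t + 2 * (dx a b d x * ux x t) + d x * uxx x t
      - (dx a b d x * u x t * wx x t + d x * ux x t * wx x t + d x * u x t * wxx x t)" for x t
  define R where "R x t = dx a b d x * (wx x t / sqrt (g (w x t)))
      + d x * ((wxx x t * sqrt (g (w x t)) - wx x t * (deriv g (w x t) * wx x t / (2 * sqrt (g (w x t)))))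
          / g (w x t))" for x t
  have R: "((\<lambda>y. d y * (wx y t / sqrt (g (w y t)))) has_real_derivative R x t) (at x within {a..b})"
    if x: "x \<in> {a..b}" and t: "0 < t" for x t
  proof -
    have gp: "0 < g (w x t)" using g_pos[OF w_pos[OF x t]] .
    have "((\<lambda>y. g (w y t)) has_real_derivative deriv g (w x t) * wx x t) (at x within {a..b})"
      using DERIV_chain2[OF gb(1)[OF w_pos[OF x t]] w(1)[OF x t]] .
    then show ?thesis
      unfolding R_def using gp
      by (auto intro!: derivative_eq_intros d1[OF x] w(2)[OF x t] simp: field_simps)
  qed
  have J: "((\<lambda>y. J y t) has_real_derivative Jx x t) (at x within {a..b})"
    if x: "x \<in> {a..b}" and t: "0 < t" for x t
    unfolding J_def Jx_def
    by (auto intro!: derivative_eq_intros d1[OF x] d2[OF x] u(1,2)[OF x t] w(2)[OF x t] simp: algebra_simps)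
  have slice: "continuous_on {a..b} (\<lambda>x. f x t)"
    if "continuous_on ({a..b} \<times> {0<..}) (\<lambda>z. f (fst z) (snd z))" "0 < t" for f :: "real \<Rightarrow> real \<Rightarrow> real" and t
    using continuous_on_compose2[OF that(1), of "{a..b}" "\<lambda>x. (x, t)"] that(2)
    by (force intro!: continuous_intros)
  have lift: "continuous_on ({a..b} \<times> {0<..}) (\<lambda>z. f (fst z))" if "continuous_on {a..b} f"
    for f :: "real \<Rightarrow> real"
    by (rule continuous_on_compose2[OF that]) (auto intro!: continuous_intros)
  have cg2: "continuous_on ({a..b} \<times> {0<..}) (\<lambda>z. g (w (fst z) (snd z)))"
    "continuous_on ({a..b} \<times> {0<..}) (\<lambda>z. deriv g (w (fst z) (snd z)))"
    by (rule continuous_on_compose2[OF cg cw(1)] continuous_on_compose2[OF gb(2) cw(1)];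
        auto intro!: w_pos)+
  have gnz: "g (w x t) \<noteq> 0" if "x \<in> {a..b}" "0 < t" for x t
    using g_pos[OF w_pos[OF that]] by simp
  have cR: "continuous_on ({a..b} \<times> {0<..}) (\<lambda>z. R (fst z) (snd z))"
    unfolding R_def
    by (intro continuous_intros lift cd cd1 cw cg2) (auto simp: gnz)
  have cJx: "continuous_on ({a..b} \<times> {0<..}) (\<lambda>z. Jx (fst z) (snd z))"
    unfolding Jx_def by (intro continuous_intros lift cd cd1 cd2 cw cu)
  have pde: "ut x t = Jx x t" "wt x t = e * R x t - u x t * g (w x t)"
    if x: "x \<in> {a<..<b}" and t: "0 < t" for x t
  proof -
    have x': "x \<in> {a..b}" using x by auto
    have 1: "dx a b (\<lambda>y. d y * u y t) y = dx a b d y * u y t + d y * ux y t" if "y \<in> {a..b}" for y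
      by (rule dx_eqI[OF ab that _ refl]) (auto intro!: derivative_eq_intros d1[OF that] u(1)[OF that t])
    have 2: "dx a b (\<lambda>z. w z t) y = wx y t" if "y \<in> {a..b}" for y
      by (rule dx_eqI[OF ab that w(1)[OF that t] refl])
    have 3: "dx a b (dx a b (\<lambda>y. d y * u y t)) x
        = d2 x * u x t + 2 * (dx a b d x * ux x t) + d x * uxx x t"
      by (rule dx_eqI[OF ab x' _ 1])
        (auto intro!: derivative_eq_intros d1[OF x'] d2[OF x'] u(1,2)[OF x' t] simp: algebra_simps)
    have 4: "dx a b (\<lambda>y. d y * u y t * dx a b (\<lambda>z. w z t) y) x
        = dx a b d x * u x t * wx x t + d x * ux x t * wx x t + d x * u x t * wxx x t"
    proof (rule dx_eqI[OF ab x'])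
      show "((\<lambda>y. d y * u y t * wx y t) has_real_derivative
          dx a b d x * u x t * wx x t + d x * ux x t * wx x t + d x * u x t * wxx x t) (at x within {a..b})"
        by (auto intro!: derivative_eq_intros d1[OF x'] u(1)[OF x' t] w(2)[OF x' t] simp: algebra_simps)
    qed (simp add: 2)
    have 5: "dx a b (\<lambda>y. d y * (dx a b (\<lambda>z. w z t) y / sqrt (g (w y t)))) x = R x t"
      by (rule dx_eqI[OF ab x' R[OF x' t]]) (simp add: 2)
    have "deriv (u x) t = ut x t" "deriv (w x) t = wt x t"
      using u(3)[OF x' t] w(3)[OF x' t] by (auto intro: DERIV_imp_deriv)
    moreover have "deriv (\<lambda>s. u x s) t =
          dx a b (dx a b (\<lambda>y. d y * u y t)) x
          - dx a b (\<lambda>y. d y * u y t * dx a b (\<lambda>z. w z t) y) x \<and>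
        deriv (\<lambda>s. w x s) t =
          e * dx a b (\<lambda>y. d y * (dx a b (\<lambda>z. w z t) y / sqrt (g (w y t)))) x
          - u x t * g (w x t)"
      using sol x t by blast
    ultimately show "ut x t = Jx x t" "wt x t = e * R x t - u x t * g (w x t)"
      unfolding 3 4 5 Jx_def by auto
  qed
  have pde': "ut x t = Jx x t" "wt x t = e * R x t - u x t * g (w x t)"
    if x: "x \<in> {a..b}" and t: "0 < t" for x t
  proof -
    show "ut x t = Jx x t"
      by (rule continuous_on_eq_on_closed_interval[OF ab slice[OF cu(4) t] slice[OF cJx t] pde(1)[OF _ t] x])
    have "continuous_on {a..b} (\<lambda>x. e * R x t - u x t * g (w x t))"
      by (intro continuous_intros slice[OF cR t] slice[OF cu(1) t] slice[OF cg2(1) t])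
    from continuous_on_eq_on_closed_interval[OF ab slice[OF cw(4) t] this pde(2)[OF _ t] x]
    show "wt x t = e * R x t - u x t * g (w x t)" .
  qed
  have ends: "a \<in> {a..b}" "b \<in> {a..b}" using ab by auto
  have bnd: "ux a t = 0" "ux b t = 0" "wx a t = 0" "wx b t = 0" if t: "0 < t" for t
  proof -
    have *: "dx a b (\<lambda>y. u y t) x = ux x t" "dx a b (\<lambda>y. w y t) x = wx x t" if "x \<in> {a..b}" for x
      by (rule dx_eqI[OF ab that _ refl], rule u(1)[OF that t] w(1)[OF that t])+
    have "\<forall>x\<in>{a, b}. dx a b (\<lambda>y. u y t) x = 0 \<and> dx a b (\<lambda>y. w y t) x = 0" using sol t by blast
    then show "ux a t = 0" "ux b t = 0" "wx a t = 0" "wx b t = 0"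
      using *[OF ends(1)] *[OF ends(2)] by auto
  qed
  show ?thesis
  proof (rule that[of ux ut wx wt R])
    show "regularized_flow a b e \<gamma>1 \<gamma>2 d (dx a b d) g (deriv g) u ux ut w wx wt R"
    proof
      show "((\<lambda>y. dx a b d y * u y t + d y * ux y t - d y * u y t * wx y t)
          has_real_derivative ut x t) (at x within {a..b})" if "x \<in> {a..b}" "0 < t" for x t
        using J[OF that] pde'(1)[OF that] by (simp add: J_def)
      show "0 < u x t" if "x \<in> {a..b}" "0 < t" for x t using sol that by auto
    qed (fact ab e \<gamma> d1 cd1 gb u w cu cw cR R pde'(2) d_bd bnd w_pos | use d_pos in simp)+
  qed
qed

section \<open>The energy of the initial data\<close>

text \<open>
  Close to \<open>t = 0\<close> the function \<open>w\<close> is comparable with its initial value up to the factor \<open>2\<close>, which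
  costs a constant factor. The square of \<open>w_x\<close> is split into those of the
  initial trace, for which the Fisher information of \<open>w0\<close> is available, and of a difference that
  tends to \<open>0\<close> in \<open>L^2\<close>.
\<close>

lemma (in regularized_flow) initial_energy_bound:
  assumes cu: "continuous_on ({a..b} \<times> {0..}) (\<lambda>z. u (fst z) (snd z))"
    and cw: "continuous_on ({a..b} \<times> {0..}) (\<lambda>z. w (fst z) (snd z))"
    and wpos: "\<And>x t. x \<in> {a..b} \<Longrightarrow> 0 \<le> t \<Longrightarrow> 0 < w x t"
    and W: "C0_W12 a b w"
    and Dm: "\<And>x. x \<in> {a..b} \<Longrightarrow> d x \<le> Dm" and B: "\<And>x. x \<in> {a..b} \<Longrightarrow> u x 0 \<le> B"
    and w0: "w0 \<in> borel_measurable (lebesgue_on {a<..<b})"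
    and eq: "AE x in lebesgue_on {a<..<b}. w x 0 = w0 x"
    and F1: "(\<integral>\<^sup>+x. ennreal (d x * fisher a b w0 x) \<partial>lebesgue_on {a<..<b}) \<le> ennreal F1" "0 \<le> F1"
    and F2: "(\<integral>\<^sup>+x. ennreal ((d1 x)\<^sup>2 / d x * w0 x) \<partial>lebesgue_on {a<..<b}) \<le> ennreal F2" "0 \<le> F2"
  shows "\<forall>\<^sub>F t in at_right 0. energy t \<le> (b - a) * (Dm * (B + 1)\<^sup>2) + (4 * F1 + 1) / (2 * \<gamma>1) + 2 * F2 / \<gamma>1"
proof -
  let ?M = "lebesgue_on {a<..<b}"
  let ?v0 = "wderiv a b (\<lambda>x. w x 0)"
  have cw0: "continuous_on {a..b} (\<lambda>x. w x 0)"
    using continuous_on_compose2[OF cw, of "{a..b}" "\<lambda>x. (x, 0)"]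
    by (force intro!: continuous_intros)
  obtain p where p: "p \<in> {a..b}" "\<And>x. x \<in> {a..b} \<Longrightarrow> w p 0 \<le> w x 0"
    using continuous_attains_inf[OF compact_Icc _ cw0] endpoints by blast
  define m where "m = w p 0"
  have m: "0 < m" using wpos[OF p(1)] by (simp add: m_def)
  have Dm0: "0 < Dm" using Dm[OF endpoints(1)] d_pos[OF endpoints(1)] by linarith
  have trace: "((\<lambda>t. \<integral>\<^sup>+x. ennreal ((wx x t - ?v0 x)\<^sup>2) \<partial>?M) \<longlongrightarrow> 0) (at_right 0)"
    using ab w_dx wx_cont[THEN slice] cw wpos W by (rule gradient_tendsto_initial_trace)
  have fish: "AE x in ?M. fisher a b w0 x = (?v0 x)\<^sup>2 / w x 0"
    using ab w_dx wx_cont[THEN slice] cw wpos W w0 eq by (rule fisher_initial_AE)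
  have v0m: "?v0 \<in> borel_measurable ?M"
    using ab w_dx wx_cont[THEN slice] cw wpos W by (rule initial_trace_square_integrable(1))
  \<comment> \<open>With this bound for the difference, its contribution below is at most \<open>1/\<gamma>1\<close>.\<close>
  have "0 < ennreal (m / (4 * Dm))" using m Dm0 by simp
  from order_tendstoD(2)[OF trace this]
  have ev3: "\<forall>\<^sub>F t in at_right 0. (\<integral>\<^sup>+x. ennreal ((wx x t - ?v0 x)\<^sup>2) \<partial>?M) < ennreal (m / (4 * Dm))" .
  have ev1: "\<forall>\<^sub>F t in at_right 0. \<forall>x\<in>{a..b}. \<bar>u x t - u x 0\<bar> \<le> 1"
    by (rule uniform_initial_continuity[OF cu]) simp
  have ev2: "\<forall>\<^sub>F t in at_right 0. \<forall>x\<in>{a..b}. \<bar>w x t - w x 0\<bar> \<le> m / 2"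
    by (rule uniform_initial_continuity[OF cw]) (use m in simp)
  show ?thesis
    using ev1 ev2 ev3 eventually_at_right_less[of 0]
  proof eventually_elim
    case (elim t)
    note t = elim(4)
    have wb: "w x 0 / 2 \<le> w x t" "w x t \<le> 2 * w x 0" "m \<le> w x 0" if x: "x \<in> {a..b}" for x
      using elim(2)[rule_format, OF x] p(2)[OF x] m unfolding m_def by linarith+
    have ent: "integral {a..b} (\<lambda>x. u x t * ln (d x * u x t)) \<le> (b - a) * (Dm * (B + 1)\<^sup>2)"
    proof -
      have "integral {a..b} (\<lambda>x. u x t * ln (d x * u x t)) \<le> integral {a..b} (\<lambda>x. Dm * (B + 1)\<^sup>2)"
      proof (rule integral_le[OF integrable_continuous_interval[OF entropy_continuous[OF t]]])
        fix x assume x: "x \<in> {a..b}"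
        have U: "0 < u x t" "u x t \<le> B + 1" "0 < d x" "d x \<le> Dm"
          using u_pos[OF x t] elim(1)[rule_format, OF x] B[OF x] d_pos[OF x] Dm[OF x] by (auto simp: abs_le_iff)
        have "ln (d x * u x t) \<le> d x * u x t - 1" using U by (intro ln_le_minus_one) simp
        then have "u x t * ln (d x * u x t) \<le> u x t * (d x * u x t)" using U by (intro mult_left_mono) auto
        also have "\<dots> \<le> (B + 1) * (Dm * (B + 1))" using U by (intro mult_mono) auto
        finally show "u x t * ln (d x * u x t) \<le> Dm * (B + 1)\<^sup>2" by (simp add: power2_eq_square mult_ac)
      qed (intro integrable_continuous_interval continuous_intros)
      then show ?thesis using ab by (simp add: mult_ac)
    qed
    have gr: "integral {a..b} (\<lambda>x. d x * (wx x t)\<^sup>2 / g (w x t)) \<le> (4 * F1 + 1) / \<gamma>1"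
    proof -
      let ?f = "\<lambda>x. d x * (wx x t)\<^sup>2 / g (w x t)"
      have cf: "continuous_on {a..b} ?f" by (intro continuous_intros conts t) (auto simp: nonzero t)
      have f0: "0 \<le> ?f x" if "x \<in> {a..b}" for x
        using d_pos[OF that] g_pos[OF w_pos[OF that t]] by simp
      have "ennreal (integral {a..b} ?f) = (\<integral>\<^sup>+x. ennreal (?f x) \<partial>?M)"
        by (rule nn_integral_open_interval_eq_integral[OF cf f0, symmetric])
      also have "\<dots> \<le> (\<integral>\<^sup>+x. ennreal (4 / \<gamma>1) * ennreal (d x * ((?v0 x)\<^sup>2 / w x 0))
          + ennreal (4 * Dm / (\<gamma>1 * m)) * ennreal ((wx x t - ?v0 x)\<^sup>2) \<partial>?M)"
      proof (rule nn_integral_mono)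
        fix x assume "x \<in> space ?M"
        then have x: "x \<in> {a..b}" by (simp add: atLeastAtMost_iff)
        let ?W = "w x t" and ?Winit = "w x 0"
        have pos: "0 < ?Winit" "0 < ?W" "0 < d x" "d x \<le> Dm"
          using wpos[OF x] w_pos[OF x t] d_pos[OF x] Dm[OF x] by auto
        have "0 \<le> (wx x t - 2 * ?v0 x)\<^sup>2" by simp
        then have sq: "(wx x t)\<^sup>2 \<le> 2 * (?v0 x)\<^sup>2 + 2 * (wx x t - ?v0 x)\<^sup>2"
          by (simp add: power2_eq_square algebra_simps)
        have "?f x \<le> d x * (wx x t)\<^sup>2 / (\<gamma>1 * ?W)"
          using g_bounds(1)[OF pos(2)] pos \<gamma>_pos by (intro divide_left_mono) (auto simp: g_pos)
        also have "\<dots> \<le> d x * (wx x t)\<^sup>2 / (\<gamma>1 * (?Winit / 2))"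
          using wb(1)[OF x] pos \<gamma>_pos by (intro divide_left_mono) auto
        also have "\<dots> \<le> d x * (2 * (?v0 x)\<^sup>2 + 2 * (wx x t - ?v0 x)\<^sup>2) / (\<gamma>1 * (?Winit / 2))"
          using sq pos \<gamma>_pos by (intro divide_right_mono mult_left_mono) auto
        also have "\<dots> = 4 / \<gamma>1 * (d x * ((?v0 x)\<^sup>2 / ?Winit)) + 4 / \<gamma>1 * (d x * ((wx x t - ?v0 x)\<^sup>2 / ?Winit))"
          using pos \<gamma>_pos by (simp add: field_simps)
        also have "\<dots> \<le> 4 / \<gamma>1 * (d x * ((?v0 x)\<^sup>2 / ?Winit)) + 4 / \<gamma>1 * (Dm * ((wx x t - ?v0 x)\<^sup>2 / m))"
          using pos m wb(3)[OF x] \<gamma>_pos Dm0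
          by (intro add_left_mono mult_left_mono mult_mono divide_left_mono) auto
        also have "\<dots> = 4 / \<gamma>1 * (d x * ((?v0 x)\<^sup>2 / ?Winit)) + 4 * Dm / (\<gamma>1 * m) * (wx x t - ?v0 x)\<^sup>2"
          by simp
        finally have le: "?f x \<le> 4 / \<gamma>1 * (d x * ((?v0 x)\<^sup>2 / ?Winit)) + 4 * Dm / (\<gamma>1 * m) * (wx x t - ?v0 x)\<^sup>2" .
        have sum: "ennreal p * ennreal q + ennreal r * ennreal s = ennreal (p * q + r * s)"
          if "0 \<le> p" "0 \<le> q" "0 \<le> r" "0 \<le> s" for p q r s :: real
          using that by (simp add: ennreal_mult ennreal_plus)
        show "ennreal (?f x) \<le> ennreal (4 / \<gamma>1) * ennreal (d x * ((?v0 x)\<^sup>2 / w x 0))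
          + ennreal (4 * Dm / (\<gamma>1 * m)) * ennreal ((wx x t - ?v0 x)\<^sup>2)"
          using pos \<gamma>_pos m Dm0 by (subst sum) (simp_all only: ennreal_leI[OF le], auto)
      qed
      also have "\<dots> = ennreal (4 / \<gamma>1) * (\<integral>\<^sup>+x. ennreal (d x * ((?v0 x)\<^sup>2 / w x 0)) \<partial>?M)
          + ennreal (4 * Dm / (\<gamma>1 * m)) * (\<integral>\<^sup>+x. ennreal ((wx x t - ?v0 x)\<^sup>2) \<partial>?M)"
      proof -
        have bm: "k \<in> borel_measurable ?M" if "continuous_on {a..b} k" for k :: "real \<Rightarrow> real"
          by (rule borel_measurable_integrable[OF continuous_on_open_interval_integral(1)[OF that]])
        have "(\<lambda>x. d x * ((?v0 x)\<^sup>2 / w x 0)) \<in> borel_measurable ?M"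
          using v0m bm[OF d_cont] bm[OF cw0] by simp
        moreover have "(\<lambda>x. (wx x t - ?v0 x)\<^sup>2) \<in> borel_measurable ?M"
          using v0m bm[OF wx_cont[THEN slice, OF t]] by simp
        ultimately show ?thesis by (simp add: nn_integral_add nn_integral_cmult)
      qed
      also have "(\<integral>\<^sup>+x. ennreal (d x * ((?v0 x)\<^sup>2 / w x 0)) \<partial>?M)
          = (\<integral>\<^sup>+x. ennreal (d x * fisher a b w0 x) \<partial>?M)"
        using fish by (intro nn_integral_cong_AE) (auto elim!: eventually_mono)
      also have "ennreal (4 / \<gamma>1) * (\<integral>\<^sup>+x. ennreal (d x * fisher a b w0 x) \<partial>?M)
          + ennreal (4 * Dm / (\<gamma>1 * m)) * (\<integral>\<^sup>+x. ennreal ((wx x t - ?v0 x)\<^sup>2) \<partial>?M)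
        \<le> ennreal (4 / \<gamma>1) * ennreal F1 + ennreal (4 * Dm / (\<gamma>1 * m)) * ennreal (m / (4 * Dm))"
        using F1(1) elim(3) by (intro add_mono mult_left_mono) (auto simp: less_imp_le)
      also have "\<dots> = ennreal ((4 * F1 + 1) / \<gamma>1)"
        using m Dm0 \<gamma>_pos F1(2)
        by (simp add: ennreal_mult[symmetric] ennreal_plus[symmetric] field_simps del: ennreal_plus)
      finally show ?thesis using F1(2) \<gamma>_pos by (simp add: ennreal_le_iff)
    qed
    have nu: "integral {a..b} (\<lambda>x. (d1 x)\<^sup>2 / d x * w x t) \<le> 2 * F2"
    proof -
      have c: "continuous_on {a..b} (\<lambda>x. (d1 x)\<^sup>2 / d x * w x s)" if "s = 0 \<or> s = t" for s
      proof (rule continuous_on_mult)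
        show "continuous_on {a..b} (\<lambda>x. (d1 x)\<^sup>2 / d x)"
          by (intro continuous_intros conts) (auto simp: nonzero)
        show "continuous_on {a..b} (\<lambda>x. w x s)" using that cw0 w_cont[THEN slice, OF t] by auto
      qed
      have P0: "0 \<le> (d1 x)\<^sup>2 / d x" if "x \<in> {a..b}" for x using d_pos[OF that] by simp
      have "ennreal (integral {a..b} (\<lambda>x. (d1 x)\<^sup>2 / d x * w x 0)) = (\<integral>\<^sup>+x. ennreal ((d1 x)\<^sup>2 / d x * w x 0) \<partial>?M)"
        using c P0 wpos by (intro nn_integral_open_interval_eq_integral[symmetric] mult_nonneg_nonneg) (auto simp: less_imp_le)
      also have "\<dots> = (\<integral>\<^sup>+x. ennreal ((d1 x)\<^sup>2 / d x * w0 x) \<partial>?M)"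
        using eq by (intro nn_integral_cong_AE) (auto elim!: eventually_mono)
      also note F2(1)
      finally have 1: "integral {a..b} (\<lambda>x. (d1 x)\<^sup>2 / d x * w x 0) \<le> F2" using F2(2) by (simp add: ennreal_le_iff)
      have "integral {a..b} (\<lambda>x. (d1 x)\<^sup>2 / d x * w x t) \<le> integral {a..b} (\<lambda>x. 2 * ((d1 x)\<^sup>2 / d x * w x 0))"
      proof (rule integral_le[OF integrable_continuous_interval integrable_on_mult_right[OF integrable_continuous_interval]])
        fix x assume x: "x \<in> {a..b}"
        show "(d1 x)\<^sup>2 / d x * w x t \<le> 2 * ((d1 x)\<^sup>2 / d x * w x 0)"
          using mult_left_mono[OF wb(2)[OF x] P0[OF x]] by (simp add: mult_ac)
      qed (rule c, simp)+
      also have "\<dots> = 2 * integral {a..b} (\<lambda>x. (d1 x)\<^sup>2 / d x * w x 0)" by (rule integral_mult_right)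
      finally show ?thesis using 1 by linarith
    qed
    have "energy t \<le> (b - a) * (Dm * (B + 1)\<^sup>2) + 1 / 2 * ((4 * F1 + 1) / \<gamma>1) + 1 / \<gamma>1 * (2 * F2)"
      unfolding energy_def using \<gamma>_pos by (intro add_mono mult_left_mono ent gr nu) auto
    then show ?case by simp
  qed
qed

section \<open>Essential bounds of continuous functions\<close>

text \<open>
  A continuous function exceeds its essential supremum only on an open null set, which is empty.
\<close>

lemma abs_le_Linf_norm:
  fixes f :: "'a::euclidean_space \<Rightarrow> real"
  assumes S: "open S" and f: "continuous_on (closure S) f" and x: "x \<in> closure S"
  shows "ennreal \<bar>f x\<bar> \<le> Linf_norm S f"
proof (cases "Linf_norm S f")
  case (real r)
  have AE: "AE y in lebesgue_on S. ennreal \<bar>f y\<bar> \<le> Linf_norm S f"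
    unfolding Linf_norm_def by (rule esssup_AE)
  have Sl: "S \<in> sets lebesgue" using S by simp
  let ?A = "{y \<in> S. r < \<bar>f y\<bar>}"
  have "open ?A"
  proof -
    have "continuous_on S (\<lambda>y. \<bar>f y\<bar>)"
      using continuous_on_subset[OF f closure_subset] by (intro continuous_intros)
    then have "open (S \<inter> (\<lambda>y. \<bar>f y\<bar>) -` {r<..})" using S by (intro continuous_open_preimage) auto
    moreover have "S \<inter> (\<lambda>y. \<bar>f y\<bar>) -` {r<..} = ?A" by auto
    ultimately show ?thesis by simp
  qed
  moreover have "negligible ?A"
  proof -
    have "AE y in lebesgue. y \<notin> ?A"
      using AE Sl real by (simp add: AE_restrict_space_iff) (auto elim!: eventually_mono)
    then have "?A \<in> null_sets lebesgue"
      using \<open>open ?A\<close> by (subst AE_iff_null_sets) auto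
    then show ?thesis by (simp add: negligible_iff_null_sets)
  qed
  ultimately have "?A = {}" using open_not_negligible by blast
  then have "\<bar>f y\<bar> \<le> r" if "y \<in> S" for y using that by (auto simp: not_less)
  then have "\<bar>f x\<bar> \<le> r"
    by (intro continuous_le_on_closure[OF _ x, of "\<lambda>y. \<bar>f y\<bar>"] continuous_intros f)
  then show ?thesis using real by (simp add: ennreal_leI)
qed simp

lemma Linf_norm_le:
  fixes f :: "'a::euclidean_space \<Rightarrow> real"
  assumes "f \<in> borel_measurable (lebesgue_on S)" "AE x in lebesgue_on S. \<bar>f x\<bar> \<le> B"
  shows "Linf_norm S f \<le> ennreal B"
  unfolding Linf_norm_def
  by (rule esssup_I) (use assms in \<open>auto elim!: eventually_mono intro: ennreal_leI\<close>)

lemma borel_measurable_lebesgue_on_AE_cong: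
  fixes f h :: "real \<Rightarrow> real"
  assumes f: "f \<in> borel_measurable (lebesgue_on S)" and S: "S \<in> sets lebesgue"
    and eq: "AE x in lebesgue_on S. h x = f x"
  shows "h \<in> borel_measurable (lebesgue_on S)"
proof -
  have "AE x in lebesgue. x \<in> S \<longrightarrow> h x = f x" using eq S by (simp add: AE_restrict_space_iff)
  then obtain N where N: "\<And>x. x \<in> space lebesgue - N \<Longrightarrow> x \<in> S \<longrightarrow> h x = f x" "N \<in> null_sets lebesgue"
    by (erule AE_E3)
  have "f measurable_on S" using f S by (simp add: measurable_on_iff_borel_measurable)
  then have "h measurable_on S"
    by (rule measurable_on_spike[where S = N])
      (use N in \<open>auto simp: negligible_iff_null_sets\<close>)
  then show ?thesis using S by (simp add: measurable_on_iff_borel_measurable)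
qed

section \<open>Testing with polynomials\<close>

lemma poly_bounds:
  fixes p :: "real poly"
  obtains B where "0 < B" "\<And>x. x \<in> {a..b} \<Longrightarrow> \<bar>poly p x\<bar> \<le> B" "\<And>x. x \<in> {a..b} \<Longrightarrow> \<bar>poly (pderiv p) x\<bar> \<le> B"
proof -
  have "bounded (poly p ` {a..b})" "bounded (poly (pderiv p) ` {a..b})"
    by (intro compact_imp_bounded compact_continuous_image continuous_intros compact_Icc)+
  then obtain C1 C2 where "\<forall>x\<in>{a..b}. \<bar>poly p x\<bar> \<le> C1" "\<forall>x\<in>{a..b}. \<bar>poly (pderiv p) x\<bar> \<le> C2"
    by (auto simp: bounded_iff)
  then show ?thesis by (intro that[of "max 1 (max C1 C2)"]) force+
qed

text \<open>
  A multiple of the polynomial belongs to the unit ball of \<open>W^{1,\<infinity>}\<close>. Its norm there is defined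
  with the chosen representative of the weak derivative, which agrees with the classical derivative
  almost everywhere.
\<close>

lemma W1inf_dual_norm_tendsto_0_imp:
  fixes f :: "nat \<Rightarrow> real \<Rightarrow> real"
  assumes ab: "a < b" and lim: "(\<lambda>k. W1inf_dual_norm a b (f k)) \<longlonglongrightarrow> 0"
  shows "(\<lambda>k. LINT x|lebesgue_on {a<..<b}. f k x * poly p x) \<longlonglongrightarrow> 0"
proof -
  obtain B where B: "0 < B" "\<And>x. x \<in> {a..b} \<Longrightarrow> \<bar>poly p x\<bar> \<le> B"
    "\<And>x. x \<in> {a..b} \<Longrightarrow> \<bar>poly (pderiv p) x\<bar> \<le> B"
    using poly_bounds[of a b p] by metis
  \<comment> \<open>The two essential suprema in the norm add up to \<open>1\<close>.\<close>
  define c where "c = 1 / (2 * B)"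
  have c: "0 < c" "c * B = 1 / 2" using B(1) by (auto simp: c_def)
  let ?\<phi> = "\<lambda>x. c * poly p x" and ?v = "\<lambda>x. c * poly (pderiv p) x"
  let ?M = "lebesgue_on {a<..<b}"
  have bm: "k \<in> borel_measurable ?M" if "continuous_on {a..b} k" for k :: "real \<Rightarrow> real"
    by (rule borel_measurable_integrable[OF continuous_on_open_interval_integral(1)[OF that]])
  have wd: "has_weak_deriv a b ?\<phi> ?v"
    by (rule has_weak_deriv_classical[OF ab]) (auto intro!: derivative_eq_intros continuous_intros)
  note wd' = wderiv_eq_AE(2)[OF wd]
  have m: "?\<phi> \<in> borel_measurable ?M" "?v \<in> borel_measurable ?M"
    by (intro bm continuous_intros)+
  have mw: "wderiv a b ?\<phi> \<in> borel_measurable ?M"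
    by (rule borel_measurable_lebesgue_on_AE_cong[OF m(2) _ wd']) simp
  have bd: "AE x in ?M. \<bar>?\<phi> x\<bar> \<le> 1 / 2" "AE x in ?M. \<bar>?v x\<bar> \<le> 1 / 2"
    using mult_left_mono[OF B(2) less_imp_le[OF c(1)]] mult_left_mono[OF B(3) less_imp_le[OF c(1)]] c
    by (auto simp: abs_mult intro!: AE_I2)
  have n: "Linf_norm {a<..<b} ?\<phi> \<le> ennreal (1 / 2)" "Linf_norm {a<..<b} ?v \<le> ennreal (1 / 2)"
    "Linf_norm {a<..<b} (wderiv a b ?\<phi>) \<le> ennreal (1 / 2)"
    using bd wd' by (intro Linf_norm_le m mw; auto elim: eventually_elim2)+
  have fin: "y < \<infinity>" if "y \<le> ennreal (1 / 2)" for y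
    using that ennreal_less_top order_le_less_trans infinity_ennreal_def by metis
  have mem: "?\<phi> \<in> {\<phi> \<in> W1inf a b. W1inf_norm a b \<phi> \<le> 1}"
  proof -
    have "W1inf_norm a b ?\<phi> \<le> ennreal (1 / 2) + ennreal (1 / 2)"
      unfolding W1inf_norm_def by (intro add_mono n)
    also have "\<dots> = 1" by (subst ennreal_plus[symmetric]) auto
    finally show ?thesis
      using wd m n fin by (auto simp: W1inf_def Linf_def)
  qed
  have le: "ennreal \<bar>LINT x|?M. f k x * ?\<phi> x\<bar> \<le> W1inf_dual_norm a b (f k)" for k
    unfolding W1inf_dual_norm_def by (rule SUP_upper[OF mem])
  have "(\<lambda>k. ennreal \<bar>LINT x|?M. f k x * ?\<phi> x\<bar>) \<longlonglongrightarrow> 0"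
    by (rule tendsto_sandwich[OF _ _ tendsto_const lim]) (auto simp: le)
  then have "(\<lambda>k. \<bar>LINT x|?M. f k x * ?\<phi> x\<bar>) \<longlonglongrightarrow> 0"
    by (simp add: ennreal_tendsto_0_iff)
  then have "(\<lambda>k. (LINT x|?M. c * (f k x * poly p x)) / c) \<longlonglongrightarrow> 0 / c"
    using c(1) by (intro tendsto_divide tendsto_const) (auto simp: mult_ac tendsto_rabs_zero_iff)
  then show ?thesis using c(1) by simp
qed

section \<open>Drops of bounded monotone functionals\<close>

text \<open>
  If \<open>h\<close> does not tend to \<open>0\<close>, then for some \<open>r > 0\<close> it is at least \<open>r\<close> in absolute value at infinitely many times
  with gaps of length at least \<open>1\<close>. For the first \<open>n\<close> of these times some approximation \<open>hk k\<close> is still at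
  least \<open>r/2\<close>, and the drops of its functional over the disjoint unit intervals before them add up
  to at most \<open>2 K\<close>. This bounds \<open>n\<close>.
\<close>

lemma tendsto_zero_of_lyapunov_drop:
  fixes h :: "real \<Rightarrow> real" and hk :: "nat \<Rightarrow> real \<Rightarrow> real"
  assumes C: "0 \<le> C"
    and lim: "\<And>t. 1 < t \<Longrightarrow> (\<lambda>k. hk k t) \<longlonglongrightarrow> h t"
    and drop: "\<And>T. 0 < T \<Longrightarrow> \<forall>\<^sub>F k in sequentially. \<exists>E.
      (\<forall>t. 1 < t \<and> t \<le> T \<longrightarrow> (hk k t)\<^sup>2 \<le> C * (E (t - 1) - E t)) \<and>
      (\<forall>s t. 0 < s \<and> s \<le> t \<and> t \<le> T \<longrightarrow> E t \<le> E s) \<and>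
      (\<forall>t. 0 < t \<and> t \<le> T \<longrightarrow> - K \<le> E t \<and> E t \<le> K)"
  shows "(h \<longlongrightarrow> 0) at_top"
proof (rule tendstoI, rule ccontr)
  fix r :: real assume r: "0 < r" and nev: "\<not> (\<forall>\<^sub>F t in at_top. dist (h t) 0 < r)"
  have far: "\<exists>t\<ge>T. r \<le> \<bar>h t\<bar>" for T
    using nev unfolding eventually_at_top_linorder by (auto simp: not_less)
  obtain \<tau> :: "nat \<Rightarrow> real" where \<tau>: "\<And>n. 2 \<le> \<tau> n" "\<And>n. r \<le> \<bar>h (\<tau> n)\<bar>" "\<And>n. \<tau> n + 1 \<le> \<tau> (Suc n)"
  proof -
    have "\<exists>\<tau>. \<forall>n. (2 \<le> \<tau> n \<and> r \<le> \<bar>h (\<tau> n)\<bar>) \<and> \<tau> n + 1 \<le> \<tau> (Suc n)"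
    proof (rule dependent_nat_choice)
      show "\<exists>t. 2 \<le> t \<and> r \<le> \<bar>h t\<bar>" using far by blast
      show "\<exists>t'. (2 \<le> t' \<and> r \<le> \<bar>h t'\<bar>) \<and> t + 1 \<le> t'" if "2 \<le> t \<and> r \<le> \<bar>h t\<bar>" for t and n :: nat
        using far[of "t + 1"] that by (metis add_increasing2 order_trans zero_le_one)
    qed
    then show ?thesis using that by blast
  qed
  have bound: "real (Suc n) * (r / 2)\<^sup>2 \<le> C * (2 * K)" for n
  proof -
    have "\<forall>\<^sub>F k in sequentially. \<forall>i\<in>{..n}. r / 2 < \<bar>hk k (\<tau> i)\<bar>"
    proof (intro eventually_ball_finite ballI finite_atMost)
      fix i
      have "1 < \<tau> i" using \<tau>(1)[of i] by linarith
      then have "(\<lambda>k. \<bar>hk k (\<tau> i)\<bar>) \<longlonglongrightarrow> \<bar>h (\<tau> i)\<bar>" by (intro tendsto_rabs lim)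
      moreover have "r / 2 < \<bar>h (\<tau> i)\<bar>" using \<tau>(2)[of i] r by linarith
      ultimately show "\<forall>\<^sub>F k in sequentially. r / 2 < \<bar>hk k (\<tau> i)\<bar>" by (rule order_tendstoD(1))
    qed
    moreover have "0 < \<tau> n" using \<tau>(1)[of n] by linarith
    note drop[OF this]
    ultimately have "\<forall>\<^sub>F k in sequentially. real (Suc n) * (r / 2)\<^sup>2 \<le> C * (2 * K)"
    proof eventually_elim
      case (elim k)
      then obtain E where E: "\<And>t. 1 < t \<Longrightarrow> t \<le> \<tau> n \<Longrightarrow> (hk k t)\<^sup>2 \<le> C * (E (t - 1) - E t)"
        "\<And>s t. 0 < s \<Longrightarrow> s \<le> t \<Longrightarrow> t \<le> \<tau> n \<Longrightarrow> E t \<le> E s"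
        "\<And>t. 0 < t \<Longrightarrow> t \<le> \<tau> n \<Longrightarrow> - K \<le> E t" "\<And>t. 0 < t \<Longrightarrow> t \<le> \<tau> n \<Longrightarrow> E t \<le> K" by blast
      have mono: "\<tau> i \<le> \<tau> j" if "i \<le> j" for i j
        using that
      proof (induction rule: dec_induct)
        case (step j) then show ?case using \<tau>(3)[of j] by linarith
      qed simp
      have "real (Suc i) * (r / 2)\<^sup>2 \<le> C * (E (\<tau> 0 - 1) - E (\<tau> i))" if "i \<le> n" for i
        using that
      proof (induction i)
        case 0
        have "(r / 2)\<^sup>2 \<le> \<bar>hk k (\<tau> 0)\<bar>\<^sup>2" using elim(1) r by (intro power_mono) (auto simp: less_imp_le)
        then show ?case using E(1)[of "\<tau> 0"] \<tau>(1)[of 0] mono[of 0 n] by simp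
      next
        case (Suc i)
        have le: "\<tau> (Suc i) \<le> \<tau> n" by (rule mono[OF Suc.prems])
        have "(r / 2)\<^sup>2 \<le> \<bar>hk k (\<tau> (Suc i))\<bar>\<^sup>2"
          using elim(1) Suc.prems r by (intro power_mono) (auto simp: less_imp_le)
        also have "\<dots> \<le> C * (E (\<tau> (Suc i) - 1) - E (\<tau> (Suc i)))"
          using E(1)[of "\<tau> (Suc i)"] \<tau>(1)[of "Suc i"] le by simp
        also have "\<dots> \<le> C * (E (\<tau> i) - E (\<tau> (Suc i)))"
          using E(2)[of "\<tau> i" "\<tau> (Suc i) - 1"] \<tau>(1)[of i] \<tau>(3)[of i] le C
          by (intro mult_left_mono) auto
        finally show ?case using Suc by (simp add: algebra_simps)
      qed
      from this[of n] have "real (Suc n) * (r / 2)\<^sup>2 \<le> C * (E (\<tau> 0 - 1) - E (\<tau> n))" by simp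
      also have "\<dots> \<le> C * (2 * K)"
        using E(4)[of "\<tau> 0 - 1"] E(3)[of "\<tau> n"] \<tau>(1)[of 0] \<tau>(1)[of n] mono[of 0 n] C
        by (intro mult_left_mono) auto
      finally show ?case .
    qed
    then show ?thesis by (simp add: eventually_const_iff)
  qed
  obtain n where "C * (2 * K) / (r / 2)\<^sup>2 < real n" using reals_Archimedean2 by blast
  then have "C * (2 * K) < real n * (r / 2)\<^sup>2" using r by (simp add: divide_less_eq)
  also have "\<dots> \<le> real (Suc n) * (r / 2)\<^sup>2" by (intro mult_right_mono) auto
  finally show False using bound[of n] by simp
qed

section \<open>Uniform smallness from small mean\<close>

lemma integral_le_AE:
  fixes f k :: "real \<Rightarrow> real"
  assumes ab: "a < b" and f: "continuous_on {a..b} f" and k: "integrable (lebesgue_on {a<..<b}) k"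
    and le: "AE x in lebesgue_on {a<..<b}. f x \<le> k x" and xy: "a \<le> y" "x \<le> b"
  shows "integral {y..x} f \<le> integral {y..x} k"
proof -
  have "AE x in lebesgue. x \<in> {a<..<b} \<longrightarrow> f x \<le> k x" using le by (simp add: AE_restrict_space_iff)
  then obtain N where N: "\<And>x. x \<in> space lebesgue - N \<Longrightarrow> x \<in> {a<..<b} \<longrightarrow> f x \<le> k x"
    "N \<in> null_sets lebesgue"
    by (erule AE_E3)
  then have neg: "negligible (N \<union> {a, b})" by (simp add: negligible_iff_null_sets[symmetric])
  have sub: "{y..x} \<subseteq> {a..b}" using xy by auto
  have "k integrable_on {a<..<b}"
    using k by (intro integrable_on_lebesgue_on) auto
  then have ki: "k integrable_on {y..x}"
    using sub by (metis integrable_on_Icc_iff_Ioo integrable_on_subinterval)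
  let ?k = "\<lambda>x. if x \<in> N \<union> {a, b} then f x else k x"
  have "integral {y..x} f \<le> integral {y..x} ?k"
  proof (rule integral_le)
    show "f integrable_on {y..x}"
      using continuous_on_subset[OF f sub] by (rule integrable_continuous_interval)
    show "?k integrable_on {y..x}" by (rule integrable_spike[OF ki neg]) auto
    show "f s \<le> ?k s" if "s \<in> {y..x}" for s using that N(1)[of s] sub by force
  qed
  also have "\<dots> = integral {y..x} k" by (rule integral_spike[OF neg]) auto
  finally show ?thesis .
qed

text \<open>
  The modulus of continuity is that of \<open>x \<mapsto> \<integral> k\<close> over \<open>[a, x]\<close> and does not depend on time. If \<open>w\<close>
  exceeds \<open>r\<close> somewhere, then it exceeds \<open>r/2\<close> on an interval whose length is bounded from below.
\<close>

lemma uniform_limit_zero_of_mean: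
  fixes w :: "real \<Rightarrow> real \<Rightarrow> real"
  assumes ab: "a < b" and k: "k integrable_on {a..b}"
    and w: "\<And>t. 0 < t \<Longrightarrow> continuous_on {a..b} (\<lambda>x. w x t)"
    and w0: "\<And>x t. x \<in> {a..b} \<Longrightarrow> 0 < t \<Longrightarrow> 0 \<le> w x t"
    and mod: "\<And>x y t. a \<le> y \<Longrightarrow> y \<le> x \<Longrightarrow> x \<le> b \<Longrightarrow> 0 < t \<Longrightarrow> (w x t - w y t)\<^sup>2 \<le> integral {y..x} k"
    and mean: "((\<lambda>t. integral {a..b} (\<lambda>x. w x t)) \<longlongrightarrow> 0) at_top" and r: "0 < r"
  shows "\<forall>\<^sub>F t in at_top. \<forall>x\<in>{a..b}. w x t \<le> r"
proof -
  have "uniformly_continuous_on {a..b} (\<lambda>x. integral {a..x} k)"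
    by (intro compact_uniformly_continuous indefinite_integral_continuous_1 k) auto
  then obtain \<delta> where \<delta>: "0 < \<delta>" "\<And>x y. x \<in> {a..b} \<Longrightarrow> y \<in> {a..b} \<Longrightarrow> \<bar>x - y\<bar> < \<delta>
      \<Longrightarrow> \<bar>integral {a..x} k - integral {a..y} k\<bar> < (r / 2)\<^sup>2"
    unfolding uniformly_continuous_on_def using r by (metis dist_real_def half_gt_zero zero_less_power)
  \<comment> \<open>Half of the length of the interval leaves room on at least one side of every point.\<close>
  define l where "l = min (\<delta> / 2) ((b - a) / 2)"
  have l: "0 < l" "l < \<delta>" using \<delta>(1) ab by (auto simp: l_def)
  have "l \<le> (b - a) / 2" unfolding l_def by (rule min.cobounded2)
  note l = l this
  have close: "\<bar>w x t - w y t\<bar> \<le> r / 2" if "x \<in> {a..b}" "y \<in> {a..b}" "\<bar>x - y\<bar> \<le> l" "0 < t" for x y t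
  proof -
    have *: "\<bar>w x t - w y t\<bar> \<le> r / 2" if "x \<in> {a..b}" "y \<in> {a..b}" "\<bar>x - y\<bar> \<le> l" "y \<le> x" for x y
    proof -
      have "integral {a..y} k + integral {y..x} k = integral {a..x} k"
        using that integrable_on_subinterval[OF k, of a x]
        by (intro Henstock_Kurzweil_Integration.integral_combine) auto
      then have "integral {y..x} k \<le> (r / 2)\<^sup>2" using \<delta>(2)[of x y] that l by auto
      with mod[of y x t] that \<open>0 < t\<close> have "\<bar>w x t - w y t\<bar>\<^sup>2 \<le> (r / 2)\<^sup>2" by auto
      then show ?thesis using r by (simp add: abs_le_square_iff[symmetric])
    qed
    show ?thesis using *[of x y] *[of y x] that by (cases "y \<le> x") (auto simp: abs_minus_commute)
  qed
  have "\<forall>\<^sub>F t in at_top. integral {a..b} (\<lambda>x. w x t) < l * (r / 2)"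
    by (rule order_tendstoD(2)[OF mean]) (use l r in simp)
  then show ?thesis
    using eventually_gt_at_top[of 0]
  proof eventually_elim
    case (elim t)
    show ?case
    proof (rule ccontr)
      assume "\<not> (\<forall>x\<in>{a..b}. w x t \<le> r)"
      then obtain x where x: "x \<in> {a..b}" "r < w x t" by (auto simp: not_le)
      define c where "c = (if x \<le> (a + b) / 2 then x else x - l)"
      have c: "{c..c + l} \<subseteq> {a..b}" "\<And>y. y \<in> {c..c + l} \<Longrightarrow> \<bar>x - y\<bar> \<le> l"
        using x l by (auto simp: c_def field_simps split: if_splits)
      have "r / 2 * l = integral {c..c + l} (\<lambda>_. r / 2)" using l by simp
      also have "\<dots> \<le> integral {c..c + l} (\<lambda>y. w y t)"
      proof (rule integral_le)
        show "(\<lambda>y. w y t) integrable_on {c..c + l}"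
          by (intro integrable_continuous_interval continuous_on_subset[OF w[OF elim(2)] c(1)])
        show "r / 2 \<le> w y t" if "y \<in> {c..c + l}" for y
          using close[OF x(1) subsetD[OF c(1) that] c(2)[OF that] elim(2)] x(2) by linarith
      qed (intro integrable_continuous_interval continuous_intros)
      also have "\<dots> \<le> integral {a..b} (\<lambda>y. w y t)"
        using w0 elim(2)
        by (intro integral_subset_le c integrable_continuous_interval w
            continuous_on_subset[OF w[OF elim(2)] c(1)]) auto
      finally show False using elim(1) by (simp add: mult.commute)
    qed
  qed
qed

section \<open>Passing to the limit\<close>

lemma (in regularized_flow) mass_eq_initial:
  assumes cu: "continuous_on ({a..b} \<times> {0..}) (\<lambda>z. u (fst z) (snd z))" and t: "0 < t"
  shows "mass t = integral {a..b} (\<lambda>x. u x 0)"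
proof -
  have "continuous_on ({0..t} \<times> cbox a b) (\<lambda>(s, x). u x s)"
    using continuous_on_compose2[OF cu, of "{0..t} \<times> cbox a b" "\<lambda>z. (snd z, fst z)"]
    by (force simp: case_prod_unfold atLeastAtMost_iff intro!: continuous_intros)
  from integral_continuous_on_param[OF this]
  have c: "continuous_on {0..t} mass" by (simp add: mass_def[abs_def])
  have "mass t = mass 0"
  proof (rule DERIV_isconst_end[OF t c])
    show "(mass has_real_derivative 0) (at s)" if "0 < s" "s < t" for s
      using mass_derivative[OF that(1)] by (simp add: mass_def[abs_def])
  qed
  then show ?thesis by (simp add: mass_def)
qed

text \<open>The constructed solution together with the approximations from which it arises.\<close>

locale constructed_limit =
  fixes a b \<gamma>1 \<gamma>2 :: real and d g u0 w0 :: "real \<Rightarrow> real" and u w :: "real \<Rightarrow> real \<Rightarrow> real"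
    and de :: "real \<Rightarrow> real \<Rightarrow> real" and w0j :: "nat \<Rightarrow> real \<Rightarrow> real" and eps :: "nat \<Rightarrow> real"
    and ue we :: "nat \<Rightarrow> real \<Rightarrow> real \<Rightarrow> real" and r :: "nat \<Rightarrow> nat"
  assumes ab: "a < b"
    and d_cont: "continuous_on {a..b} d" and d_nonneg: "\<forall>x\<in>{a..b}. 0 \<le> d x"
    and inv_d: "(\<integral>\<^sup>+x. inverse (ennreal (d x)) \<partial>lebesgue_on {a<..<b}) < \<infinity>"
    and g: "Ck_on 2 {0..} g" "g 0 = 0"
    and \<gamma>_pos: "0 < \<gamma>1" "0 < \<gamma>2"
    and g_bounds: "\<forall>s\<ge>0. \<gamma>1 \<le> vector_derivative g (at s within {0..}) \<and>
                 vector_derivative g (at s within {0..}) \<le> \<gamma>2"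
    and u0: "continuous_on {a..b} u0" "\<forall>x\<in>{a..b}. 0 \<le> u0 x" "\<exists>x\<in>{a..b}. u0 x \<noteq> 0"
    and u_cont: "Cw_L1 a b u"
    and w_nonneg: "\<forall>x\<in>{a..b}. \<forall>t\<ge>0. 0 \<le> w x t"
    and w_cont: "continuous_on ({a..b} \<times> {0..}) (\<lambda>(x, t). w x t)"
    and w_bounded: "(\<lambda>(x, t). w x t) \<in> Linf ({a<..<b} \<times> {0<..})"
    and approx: "approx_d a b d de" "approx_w0 a b d w0 w0j" "approx_eps a b de w0j eps"
    and sol: "\<And>j. regularized_solution a b (eps j) (de (eps j)) g u0 (w0_reg w0j eps j) (ue j) (we j)"
    and r: "strict_mono r"
    and u_lim: "\<And>K. compact K \<Longrightarrow> K \<subseteq> {0..} \<Longrightarrow>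
      (\<lambda>k. SUP t\<in>K. W1inf_dual_norm a b (\<lambda>x. ue (r k) x t - u x t)) \<longlonglongrightarrow> 0"
    and w_lim: "\<And>K. compact K \<Longrightarrow> K \<subseteq> {a..b} \<times> {0..} \<Longrightarrow>
      uniform_limit K (\<lambda>k (x, t). we (r k) x t) (\<lambda>(x, t). w x t) sequentially"
begin

abbreviation "\<Omega> \<equiv> lebesgue_on {a<..<b}"

definition ek :: "nat \<Rightarrow> real" where "ek k = eps (r k)"
definition dk :: "nat \<Rightarrow> real \<Rightarrow> real" where "dk k = de (ek k)"
definition N :: real where "N = (LINT x|\<Omega>. 1 / d x)"
definition m :: real where "m = integral {a..b} u0"

lemma ek_range: "0 < ek k" "ek k < 1"
  using approx(3) by (auto simp: approx_eps_def ek_def image_subset_iff)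

lemma ek_antimono: "k \<le> j \<Longrightarrow> ek j \<le> ek k"
  using approx(3) r by (auto simp: approx_eps_def ek_def decseq_def strict_mono_leD)

lemma ek_lim: "ek \<longlonglongrightarrow> 0"
  using LIMSEQ_subseq_LIMSEQ[OF _ r, of eps 0] approx(3) by (auto simp: approx_eps_def ek_def[abs_def] o_def)

lemma ek_right: "filterlim ek (at_right 0) sequentially"
proof -
  have "ek k \<noteq> 0" for k using ek_range(1)[of k] by simp
  then show ?thesis using ek_lim ek_range(1) by (auto simp: filterlim_at intro!: always_eventually)
qed

lemma dk_props:
  "Ck_on \<infinity> {a..b} (dk k)" "\<forall>x\<in>{a..b}. 0 < dk k x" "dx a b (dk k) a = 0" "dx a b (dk k) b = 0"
  "ennreal (sqrt (ek k)) * (\<integral>\<^sup>+x. ennreal (dx a b (dk k) x ^ 4 / (dk k x)\<^sup>2) \<partial>\<Omega>) \<le> 1"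
proof -
  have e: "ek k \<in> {0<..<1}" using ek_range by simp
  have "\<forall>e\<in>{0<..<1}. Ck_on \<infinity> {a..b} (de e)" using approx(1) unfolding approx_d_def by blast
  then show "Ck_on \<infinity> {a..b} (dk k)" using e unfolding dk_def by blast
  have *: "\<forall>e\<in>{0<..<1}. (\<forall>x\<in>{a..b}. 0 < de e x) \<and> dx a b (de e) a = 0 \<and> dx a b (de e) b = 0 \<and>
    ennreal (sqrt e) * (\<integral>\<^sup>+x. ennreal (dx a b (de e) x ^ 4 / (de e x)\<^sup>2) \<partial>\<Omega>) \<le> 1"
    using approx(1) unfolding approx_d_def by blast
  show "\<forall>x\<in>{a..b}. 0 < dk k x" "dx a b (dk k) a = 0" "dx a b (dk k) b = 0"
    "ennreal (sqrt (ek k)) * (\<integral>\<^sup>+x. ennreal (dx a b (dk k) x ^ 4 / (dk k x)\<^sup>2) \<partial>\<Omega>) \<le> 1"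
    using *[rule_format, OF e] unfolding dk_def by blast+
qed

lemma dk_cont: "continuous_on {a..b} (dk k)"
  using dx_derivative[OF ab dk_props(1)] DERIV_continuous_on by metis

lemma dk_lim:
  assumes x: "x \<in> {a..b}"
  shows "(\<lambda>k. dk k x) \<longlonglongrightarrow> d x"
proof -
  have "((\<lambda>e. Linf_norm {a<..<b} (\<lambda>x. de e x - d x)) \<longlongrightarrow> 0) (at_right 0)"
    using approx(1) unfolding approx_d_def by blast
  from filterlim_compose[OF this ek_right]
  have lim: "(\<lambda>k. Linf_norm {a<..<b} (\<lambda>x. dk k x - d x)) \<longlonglongrightarrow> 0" by (simp add: dk_def)
  have "ennreal \<bar>dk k x - d x\<bar> \<le> Linf_norm {a<..<b} (\<lambda>x. dk k x - d x)" for k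
    using ab x by (intro abs_le_Linf_norm[of _ "\<lambda>x. dk k x - d x"]) (auto intro!: continuous_on_diff dk_cont d_cont)
  then have "(\<lambda>k. ennreal \<bar>dk k x - d x\<bar>) \<longlonglongrightarrow> 0"
    by (intro tendsto_sandwich[OF _ _ tendsto_const lim]) auto
  then have "(\<lambda>k. dk k x - d x) \<longlonglongrightarrow> 0" by (simp add: ennreal_tendsto_0_iff tendsto_rabs_zero_iff)
  from tendsto_add[OF this tendsto_const[of "d x"]] show ?thesis by simp
qed

lemma dk_antimono: "x \<in> {a..b} \<Longrightarrow> k \<le> j \<Longrightarrow> dk j x \<le> dk k x"
  using approx(1) ek_antimono[of k j] ek_range(1)[of j] ek_range(2)[of k] unfolding approx_d_def dk_def by blast

lemma d_le_dk: "x \<in> {a..b} \<Longrightarrow> d x \<le> dk k x"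
  by (rule LIMSEQ_le_const2[OF dk_lim]) (auto intro!: exI[of _ k] dk_antimono)

text \<open>The approximations of \<open>d\<close> decrease with the index, so that the first one bounds all of them.\<close>

definition Dm :: real where "Dm = (SUP x\<in>{a..b}. dk 0 x)"

lemma dk_le_Dm: "x \<in> {a..b} \<Longrightarrow> dk k x \<le> Dm"
proof -
  assume x: "x \<in> {a..b}"
  have "bdd_above (dk 0 ` {a..b})"
    by (intro bounded_imp_bdd_above compact_imp_bounded compact_continuous_image dk_cont compact_Icc)
  then have "dk 0 x \<le> Dm" unfolding Dm_def by (intro cSUP_upper x)
  with dk_antimono[OF x, of 0 k] show ?thesis by simp
qed

lemma d_pos_AE: "AE x in \<Omega>. 0 < d x"
proof -
  have m: "d \<in> borel_measurable \<Omega>"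
    by (rule borel_measurable_integrable[OF continuous_on_open_interval_integral(1)[OF d_cont]])
  have "AE x in \<Omega>. inverse (ennreal (d x)) \<noteq> \<infinity>"
    using inv_d m by (intro nn_integral_PInf_AE) auto
  then show ?thesis
    using AE_space
  proof eventually_elim
    case (elim x)
    then have "0 \<le> d x" using d_nonneg by auto
    moreover have "d x \<noteq> 0" using elim(1) by auto
    ultimately show ?case by simp
  qed
qed

lemma inv_d_integrable: "integrable \<Omega> (\<lambda>x. 1 / d x)"
proof -
  have m: "d \<in> borel_measurable \<Omega>"
    by (rule borel_measurable_integrable[OF continuous_on_open_interval_integral(1)[OF d_cont]])
  have "(\<integral>\<^sup>+x. ennreal (norm (1 / d x)) \<partial>\<Omega>) = (\<integral>\<^sup>+x. inverse (ennreal (d x)) \<partial>\<Omega>)"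
  proof (rule nn_integral_cong_AE)
    show "AE x in \<Omega>. ennreal (norm (1 / d x)) = inverse (ennreal (d x))"
      using d_pos_AE by eventually_elim (simp add: inverse_ennreal inverse_eq_divide)
  qed
  then show ?thesis using inv_d m by (simp add: integrable_iff_bounded)
qed

lemma inv_dk_cont: "continuous_on {a..b} (\<lambda>x. 1 / dk k x)"
proof (intro continuous_intros dk_cont ballI)
  show "dk k x \<noteq> 0" if "x \<in> {a..b}" for x using dk_props(2)[of k] that by force
qed

lemma inv_dk_le_AE: "AE x in \<Omega>. 1 / dk k x \<le> 1 / d x"
  using d_pos_AE AE_space
proof eventually_elim
  case (elim x)
  then show ?case using d_le_dk[of x k] by (simp add: frac_le)
qed

lemma inv_d_HK: "(\<lambda>x. 1 / d x) integrable_on {a..b}" "integral {a..b} (\<lambda>x. 1 / d x) = N"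
proof -
  show "(\<lambda>x. 1 / d x) integrable_on {a..b}"
    using integrable_on_lebesgue_on[OF inv_d_integrable] by (simp add: integrable_on_Icc_iff_Ioo)
  show "integral {a..b} (\<lambda>x. 1 / d x) = N"
    using lebesgue_integral_eq_integral[OF inv_d_integrable]
    by (simp add: N_def integral_open_interval_real)
qed

lemma inv_dk_integral_le:
  assumes "a \<le> y" "x \<le> b"
  shows "integral {y..x} (\<lambda>x. 1 / dk k x) \<le> integral {y..x} (\<lambda>x. 1 / d x)"
  by (rule integral_le_AE[OF ab inv_dk_cont inv_d_integrable inv_dk_le_AE assms])

lemma N_pos: "0 < N"
proof -
  have "0 < integral {a..b} (\<lambda>x. 1 / dk 0 x)"
  proof -
    have "integral (cbox a b) (\<lambda>x. 0) < integral (cbox a b) (\<lambda>x. 1 / dk 0 x)"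
    proof (rule integral_less)
      show "continuous_on (cbox a b) (\<lambda>x. 1 / dk 0 x)" using inv_dk_cont by simp
      show "0 < 1 / dk 0 x" if "x \<in> box a b" for x using dk_props(2)[of 0] that by simp
    qed (use ab in auto)
    then show ?thesis by simp
  qed
  also have "\<dots> \<le> N" using inv_dk_integral_le[of a b 0] by (simp add: inv_d_HK)
  finally show ?thesis .
qed

lemma m_pos: "0 < m"
proof -
  have "0 \<le> m" unfolding m_def
    using u0 by (intro Henstock_Kurzweil_Integration.integral_nonneg integrable_continuous_interval) auto
  moreover have "m \<noteq> 0"
    unfolding m_def using integral_eq_0_iff[OF u0(1) ab] u0(2,3) by auto
  ultimately show ?thesis by simp
qed

lemma u_integrable: "0 \<le> t \<Longrightarrow> integrable \<Omega> (\<lambda>x. u x t)"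
  using u_cont unfolding Cw_L1_def weak_L1_tendsto_def Lp_1_iff_integrable by blast

lemma w_cont': "continuous_on ({a..b} \<times> {0..}) (\<lambda>z. w (fst z) (snd z))"
  using w_cont by (simp add: case_prod_unfold)

lemma w_bound:
  obtains M0 where "0 \<le> M0" "\<And>x t. x \<in> {a..b} \<Longrightarrow> 0 \<le> t \<Longrightarrow> w x t \<le> M0"
proof -
  let ?S = "{a<..<b} \<times> {0::real<..}" and ?f = "\<lambda>z. w (fst z) (snd z)"
  have fin: "Linf_norm ?S ?f < \<infinity>"
    using w_bounded by (simp add: Linf_def case_prod_unfold)
  have cl: "closure ?S = {a..b} \<times> {0..}" using ab by (simp add: closure_Times)
  show ?thesis
  proof (rule that[of "enn2real (Linf_norm ?S ?f)"])
    fix x t assume x: "x \<in> {a..b}" and t: "(0::real) \<le> t"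
    have "ennreal \<bar>?f (x, t)\<bar> \<le> Linf_norm ?S ?f"
      using x t by (intro abs_le_Linf_norm) (auto simp: cl w_cont' intro: open_Times)
    also have "\<dots> = ennreal (enn2real (Linf_norm ?S ?f))" using fin by simp
    finally have "\<bar>w x t\<bar> \<le> enn2real (Linf_norm ?S ?f)" by (subst (asm) ennreal_le_iff) auto
    then show "w x t \<le> enn2real (Linf_norm ?S ?f)" by linarith
  qed simp
qed

lemma SUP_finite_bound:
  fixes F :: "nat \<Rightarrow> ennreal"
  assumes "(SUP j. F j) < \<infinity>"
  obtains B where "0 \<le> B" "\<And>j. F j \<le> ennreal B"
proof (rule that[of "enn2real (SUP j. F j)"])
  show "F j \<le> ennreal (enn2real (SUP j. F j))" for j
    using assms by (simp add: SUP_upper)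
qed simp

abbreviation "bounded_flow M C0 T k ux ut wx wt R \<equiv>
  bounded_regularized_flow a b (ek k) \<gamma>1 \<gamma>2 (dk k) (dx a b (dk k)) g (deriv g)
    (ue (r k)) ux ut (we (r k)) wx wt R T M N Dm m C0"

text \<open>
  The constants do not depend on \<open>T\<close>; only the index from which on the bounds hold does. The bound \<open>M\<close>
  for the approximations is that of the limit plus \<open>1\<close>.
\<close>

lemma eventually_bounded_flow:
  obtains M C0 where "0 < M" and "0 \<le> C0"
    and "\<And>T. 0 < T \<Longrightarrow> \<forall>\<^sub>F k in sequentially. \<exists>ux ut wx wt R. bounded_flow M C0 T k ux ut wx wt R"
proof -
  obtain M0 where M0: "0 \<le> M0" "\<And>x t. x \<in> {a..b} \<Longrightarrow> 0 \<le> t \<Longrightarrow> w x t \<le> M0"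
    using w_bound by blast
  define M where "M = M0 + 1"
  have "(SUP j. \<integral>\<^sup>+x. ennreal (de (eps j) x * fisher a b (w0_reg w0j eps j) x) \<partial>\<Omega>) < \<infinity>"
    using approx(3) unfolding approx_eps_def by blast
  then obtain F1 where F1: "0 \<le> F1"
    "\<And>j. (\<integral>\<^sup>+x. ennreal (de (eps j) x * fisher a b (w0_reg w0j eps j) x) \<partial>\<Omega>) \<le> ennreal F1"
    using SUP_finite_bound by blast
  have "(SUP j. \<integral>\<^sup>+x. ennreal ((dx a b (de (eps j)) x)\<^sup>2 / de (eps j) x * w0_reg w0j eps j x) \<partial>\<Omega>) < \<infinity>"
    using approx(3) unfolding approx_eps_def by blast
  then obtain F2 where F2: "0 \<le> F2"
    "\<And>j. (\<integral>\<^sup>+x. ennreal ((dx a b (de (eps j)) x)\<^sup>2 / de (eps j) x * w0_reg w0j eps j x) \<partial>\<Omega>) \<le> ennreal F2"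
    using SUP_finite_bound by blast
  obtain B where B: "\<And>x. x \<in> {a..b} \<Longrightarrow> u0 x \<le> B"
  proof -
    have "bounded (u0 ` {a..b})" by (intro compact_imp_bounded compact_continuous_image u0 compact_Icc)
    then obtain B where "\<forall>x\<in>{a..b}. \<bar>u0 x\<bar> \<le> B" by (auto simp: bounded_iff)
    then show ?thesis by (intro that[of B]) force
  qed
  define C0 where "C0 = (b - a) * (Dm * (B + 1)\<^sup>2) + (4 * F1 + 1) / (2 * \<gamma>1) + 2 * F2 / \<gamma>1"
  have Dm0: "0 < Dm"
    using dk_le_Dm[of a 0] dk_props(2)[of 0] ab by (smt (verit) atLeastAtMost_iff)
  have C0: "0 \<le> C0"
    using ab Dm0 F1(1) F2(1) \<gamma>_pos by (simp add: C0_def)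
  show ?thesis
  proof (rule that[of M C0])
    show "0 < M" using M0(1) by (simp add: M_def)
    fix T :: real assume T: "0 < T"
    have "uniform_limit ({a..b} \<times> {0..T}) (\<lambda>k (x, t). we (r k) x t) (\<lambda>(x, t). w x t) sequentially"
      by (intro w_lim compact_Times compact_Icc) auto
    then have ev1: "\<forall>\<^sub>F k in sequentially. \<forall>z\<in>{a..b} \<times> {0..T}. dist (we (r k) (fst z) (snd z)) (w (fst z) (snd z)) < 1"
      unfolding uniform_limit_iff case_prod_unfold by (rule allE[of _ 1]) auto
    define c where "c = sqrt (\<gamma>2 * M) / (4 * \<gamma>1\<^sup>2)"
    have c: "0 \<le> c" using \<gamma>_pos M0(1) by (simp add: c_def M_def)
    have "(\<lambda>k. c * sqrt (ek k) * T) \<longlonglongrightarrow> c * sqrt 0 * T"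
      by (intro tendsto_intros ek_lim)
    then have ev2: "\<forall>\<^sub>F k in sequentially. c * sqrt (ek k) * T < 1"
      by (rule order_tendstoD) simp
    show "\<forall>\<^sub>F k in sequentially. \<exists>ux ut wx wt R. bounded_flow M C0 T k ux ut wx wt R"
      using ev1 ev2
    proof eventually_elim
      case (elim k)
      have solk: "regularized_solution a b (ek k) (dk k) g u0 (w0_reg w0j eps (r k)) (ue (r k)) (we (r k))"
        using sol[of "r k"] by (simp add: ek_def dk_def)
      obtain ux ut wx wt R where
        "regularized_flow a b (ek k) \<gamma>1 \<gamma>2 (dk k) (dx a b (dk k)) g (deriv g) (ue (r k)) ux ut (we (r k)) wx wt R"
        using regularized_flow_of_solution[OF ab ek_range(1) \<gamma>_pos g g_bounds dk_props(1-4) solk] by blast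
      then interpret F: regularized_flow a b "ek k" \<gamma>1 \<gamma>2 "dk k" "dx a b (dk k)" g "deriv g"
        "ue (r k)" ux ut "we (r k)" wx wt R .
      note s = solk[unfolded regularized_solution_def]
      have cu: "continuous_on ({a..b} \<times> {0..}) (\<lambda>z. ue (r k) (fst z) (snd z))"
        and cw: "continuous_on ({a..b} \<times> {0..}) (\<lambda>z. we (r k) (fst z) (snd z))"
        using s by (simp_all add: case_prod_unfold)
      have "bounded_flow M C0 T k ux ut wx wt R"
      proof
        show "we (r k) x t \<le> M" if "x \<in> {a..b}" "0 < t" "t \<le> T" for x t
        proof -
          have "(x, t) \<in> {a..b} \<times> {0..T}" using that by (auto simp: atLeastAtMost_iff)
          from elim(1)[rule_format, OF this] have "\<bar>we (r k) x t - w x t\<bar> < 1" by (simp add: dist_real_def)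
          then show ?thesis using M0(2)[of x t] that by (simp add: M_def)
        qed
        show "F.inv_mass \<le> N"
          using inv_dk_integral_le[of a b k] by (simp add: F.inv_mass_def inv_d_HK)
        show "F.mass t = m" if "0 < t" for t
        proof -
          have "integral {a..b} (\<lambda>x. ue (r k) x 0) = m"
            unfolding m_def using s by (intro integral_cong) auto
          then show ?thesis using F.mass_eq_initial[OF cu that] by simp
        qed
        show "F.remainder M * T \<le> 1"
        proof -
          let ?I = "integral {a..b} (\<lambda>x. ((dx a b (dk k) x)\<^sup>2 / dk k x)\<^sup>2)"
          have cI: "continuous_on {a..b} (\<lambda>x. ((dx a b (dk k) x)\<^sup>2 / dk k x)\<^sup>2)"
            by (intro continuous_intros F.conts) (auto simp: F.nonzero)
          have I0: "0 \<le> ?I" by (intro Henstock_Kurzweil_Integration.integral_nonneg integrable_continuous_interval cI) auto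
          have "ennreal (sqrt (ek k) * ?I)
              = ennreal (sqrt (ek k)) * (\<integral>\<^sup>+x. ennreal (((dx a b (dk k) x)\<^sup>2 / dk k x)\<^sup>2) \<partial>\<Omega>)"
            using I0 ek_range(1)[of k] by (subst nn_integral_open_interval_eq_integral[OF cI]) (auto simp: ennreal_mult)
          also have "\<dots> = ennreal (sqrt (ek k)) * (\<integral>\<^sup>+x. ennreal (dx a b (dk k) x ^ 4 / (dk k x)\<^sup>2) \<partial>\<Omega>)"
            by (simp add: power_divide flip: power_mult)
          also note dk_props(5)[of k]
          finally have "sqrt (ek k) * ?I \<le> 1" by simp
          then have "sqrt (ek k) * (sqrt (ek k) * ?I) \<le> sqrt (ek k) * 1"
            using ek_range(1)[of k] by (intro mult_left_mono) auto
          then have "ek k * ?I \<le> sqrt (ek k)" using ek_range(1)[of k] by (simp add: mult.assoc[symmetric])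
          then have "c * (ek k * ?I) * T \<le> c * sqrt (ek k) * T"
            using c T by (intro mult_right_mono mult_left_mono) auto
          then show ?thesis using elim(2) by (simp add: F.remainder_def c_def)
        qed
        show "\<forall>\<^sub>F t in at_right 0. F.energy t \<le> C0"
          unfolding C0_def
        proof (rule F.initial_energy_bound[OF cu cw])
          show "0 < we (r k) x t" if "x \<in> {a..b}" "0 \<le> t" for x t using s that by auto
          show "C0_W12 a b (we (r k))" using s by auto
          show "ue (r k) x 0 \<le> B" if "x \<in> {a..b}" for x using s B that by auto
          show "AE x in \<Omega>. we (r k) x 0 = w0_reg w0j eps (r k) x" using s by blast
          have "w0j (r k) \<in> borel_measurable \<Omega>"
            using approx(2) unfolding approx_w0_def Linf_def by blast
          then show "w0_reg w0j eps (r k) \<in> borel_measurable \<Omega>"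
            unfolding w0_reg_def[abs_def] by simp
          show "(\<integral>\<^sup>+x. ennreal (dk k x * fisher a b (w0_reg w0j eps (r k)) x) \<partial>\<Omega>) \<le> ennreal F1"
            using F1(2)[of "r k"] by (simp add: dk_def ek_def)
          show "(\<integral>\<^sup>+x. ennreal ((dx a b (dk k) x)\<^sup>2 / dk k x * w0_reg w0j eps (r k) x) \<partial>\<Omega>) \<le> ennreal F2"
            using F2(2)[of "r k"] by (simp add: dk_def ek_def)
        qed (use F1(1) F2(1) dk_le_Dm in auto)
      qed (use T m_pos dk_le_Dm in auto)
      then show ?case by blast
    qed
  qed (rule C0)
qed

end

section \<open>Long-time behaviour of the limit\<close>

context constructed_limit begin

definition mu_inf :: real where "mu_inf = m / N"

lemma ue_cont: "0 \<le> t \<Longrightarrow> continuous_on {a..b} (\<lambda>x. ue k x t)"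
proof -
  assume t: "0 \<le> t"
  have "continuous_on ({a..b} \<times> {0..}) (\<lambda>z. ue k (fst z) (snd z))"
    using sol[of k] unfolding regularized_solution_def by (simp add: case_prod_unfold)
  from continuous_on_compose2[OF this, of "{a..b}" "\<lambda>x. (x, t)"] t show ?thesis
    by (force intro!: continuous_intros)
qed

lemma u_tested_integrable: "0 \<le> t \<Longrightarrow> h \<in> borel_measurable \<Omega> \<Longrightarrow> AE x in \<Omega>. \<bar>h x\<bar> \<le> B \<Longrightarrow> integrable \<Omega> (\<lambda>x. u x t * h x)"
proof (rule Bochner_Integration.integrable_bound[of _ "\<lambda>x. B * u x t"])
  assume t: "0 \<le> t" and h: "h \<in> borel_measurable \<Omega>" and B: "AE x in \<Omega>. \<bar>h x\<bar> \<le> B"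
  show "integrable \<Omega> (\<lambda>x. B * u x t)" using u_integrable[OF t] by simp
  show "(\<lambda>x. u x t * h x) \<in> borel_measurable \<Omega>"
    using borel_measurable_integrable[OF u_integrable[OF t]] h by simp
  show "AE x in \<Omega>. norm (u x t * h x) \<le> norm (B * u x t)"
    using B
  proof eventually_elim
    case (elim x)
    then have "\<bar>u x t\<bar> * \<bar>h x\<bar> \<le> \<bar>u x t\<bar> * \<bar>B\<bar>" by (intro mult_left_mono) auto
    then show ?case by (simp add: abs_mult mult.commute)
  qed
qed

lemma poly_measurable: "poly p \<in> borel_measurable \<Omega>" for p :: "real poly"
  by (rule borel_measurable_integrable[OF continuous_on_open_interval_integral(1)])
    (intro continuous_intros)

lemma u_poly_lim:
  assumes t: "0 \<le> t"
  shows "(\<lambda>k. integral {a..b} (\<lambda>x. ue (r k) x t * poly p x)) \<longlonglongrightarrow> (LINT x|\<Omega>. u x t * poly p x)"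
proof -
  have "(\<lambda>k. SUP t\<in>{t}. W1inf_dual_norm a b (\<lambda>x. ue (r k) x t - u x t)) \<longlonglongrightarrow> 0"
    using t by (intro u_lim) auto
  then have "(\<lambda>k. W1inf_dual_norm a b (\<lambda>x. ue (r k) x t - u x t)) \<longlonglongrightarrow> 0" by simp
  from W1inf_dual_norm_tendsto_0_imp[OF ab this, of p]
  have lim: "(\<lambda>k. LINT x|\<Omega>. (ue (r k) x t - u x t) * poly p x) \<longlonglongrightarrow> 0" .
  obtain B where B: "\<And>x. x \<in> {a..b} \<Longrightarrow> \<bar>poly p x\<bar> \<le> B" using poly_bounds[of a b p] by metis
  have i: "integrable \<Omega> (\<lambda>x. u x t * poly p x)"
    by (rule u_tested_integrable[OF t poly_measurable, of _ B]) (auto intro!: AE_I2 B)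
  have c: "continuous_on {a..b} (\<lambda>x. ue (r k) x t * poly p x)" for k
    by (intro continuous_on_mult ue_cont t continuous_intros)
  have "(LINT x|\<Omega>. (ue (r k) x t - u x t) * poly p x)
      = integral {a..b} (\<lambda>x. ue (r k) x t * poly p x) - (LINT x|\<Omega>. u x t * poly p x)" for k
    using continuous_on_open_interval_integral[OF c[of k]] i
    by (simp add: left_diff_distrib)
  with lim show ?thesis by (simp add: LIM_zero_iff)
qed

lemma inv_dk_tested_lim:
  assumes "continuous_on {a..b} h"
  shows "(\<lambda>k. integral {a..b} (\<lambda>x. h x / dk k x)) \<longlonglongrightarrow> (LINT x|\<Omega>. h x / d x)"
proof -
  have c: "continuous_on {a..b} (\<lambda>x. h x / dk k x)" for k
    using continuous_on_mult[OF assms inv_dk_cont[of k]] by simp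
  have hm: "h \<in> borel_measurable \<Omega>"
    by (rule borel_measurable_integrable[OF continuous_on_open_interval_integral(1)[OF assms]])
  obtain B where B: "\<And>x. x \<in> {a..b} \<Longrightarrow> \<bar>h x\<bar> \<le> B"
  proof -
    have "bounded (h ` {a..b})" by (intro compact_imp_bounded compact_continuous_image assms compact_Icc)
    then obtain B where "\<forall>x\<in>{a..b}. \<bar>h x\<bar> \<le> B" by (auto simp: bounded_iff)
    then show ?thesis by (intro that[of B]) blast
  qed
  have "(\<lambda>k. LINT x|\<Omega>. h x / dk k x) \<longlonglongrightarrow> (LINT x|\<Omega>. h x / d x)"
  proof (rule integral_dominated_convergence[where w = "\<lambda>x. B * (1 / d x)"])
    show "(\<lambda>x. h x / d x) \<in> borel_measurable \<Omega>"
      using borel_measurable_times[OF hm borel_measurable_integrable[OF inv_d_integrable]] by simp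
    show "(\<lambda>x. h x / dk k x) \<in> borel_measurable \<Omega>" for k
      by (rule borel_measurable_integrable[OF continuous_on_open_interval_integral(1)[OF c]])
    show "integrable \<Omega> (\<lambda>x. B * (1 / d x))" by (rule integrable_mult_right[OF inv_d_integrable])
    show "AE x in \<Omega>. (\<lambda>k. h x / dk k x) \<longlonglongrightarrow> h x / d x"
      using d_pos_AE AE_space
      by eventually_elim (auto intro!: tendsto_divide dk_lim)
    show "AE x in \<Omega>. norm (h x / dk k x) \<le> B * (1 / d x)" for k
      using inv_dk_le_AE[of k] AE_space
    proof eventually_elim
      case (elim x)
      then have x: "x \<in> {a..b}" by simp
      have p: "0 < dk k x" using dk_props(2) x by blast
      have "\<bar>h x\<bar> * (1 / dk k x) \<le> B * (1 / d x)"
        using elim(1) B[OF x] p by (intro mult_mono) auto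
      then show ?case using p by (simp add: abs_mult abs_divide)
    qed
  qed
  then show ?thesis using continuous_on_open_interval_integral(2)[OF c] by simp
qed

lemma inv_mass_lim: "(\<lambda>k. integral {a..b} (\<lambda>x. 1 / dk k x)) \<longlonglongrightarrow> N"
  using inv_dk_tested_lim[of "\<lambda>_. 1"] by (simp add: N_def)

lemma u_tested_with_polynomials:
  "((\<lambda>t. (LINT x|\<Omega>. u x t * poly p x) - mu_inf * (LINT x|\<Omega>. poly p x / d x)) \<longlongrightarrow> 0) at_top"
proof -
  obtain M C0 where M: "0 < M" and C0: "0 \<le> C0"
    and flow: "\<And>T. 0 < T \<Longrightarrow> \<forall>\<^sub>F k in sequentially. \<exists>ux ut wx wt R. bounded_flow M C0 T k ux ut wx wt R"
    using eventually_bounded_flow by blast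
  obtain B where B: "\<And>x. x \<in> {a..b} \<Longrightarrow> \<bar>poly p x\<bar> \<le> B" "\<And>x. x \<in> {a..b} \<Longrightarrow> \<bar>poly (pderiv p) x\<bar> \<le> B"
    using poly_bounds[of a b p] by metis
  let ?C = "(B * (1 + 1 / sqrt (\<gamma>1 / (4 * \<gamma>2 * M)) + N) * sqrt (Dm * m))\<^sup>2"
  let ?hk = "\<lambda>k t. integral {a..b} (\<lambda>x. ue (r k) x t * poly p x)
      - m / integral {a..b} (\<lambda>x. 1 / dk k x) * integral {a..b} (\<lambda>x. poly p x / dk k x)"
  show ?thesis
  proof (rule tendsto_zero_of_lyapunov_drop[where C = ?C and K = "C0 + N + 1" and hk = ?hk])
    show "(\<lambda>k. ?hk k t) \<longlonglongrightarrow> (LINT x|\<Omega>. u x t * poly p x) - mu_inf * (LINT x|\<Omega>. poly p x / d x)"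
      if "1 < t" for t
      unfolding mu_inf_def using that N_pos
      by (intro tendsto_diff tendsto_mult tendsto_divide tendsto_const inv_mass_lim u_poly_lim
          inv_dk_tested_lim continuous_intros) auto
    fix T :: real assume T: "0 < T"
    show "\<forall>\<^sub>F k in sequentially. \<exists>E.
      (\<forall>t. 1 < t \<and> t \<le> T \<longrightarrow> (?hk k t)\<^sup>2 \<le> ?C * (E (t - 1) - E t)) \<and>
      (\<forall>s t. 0 < s \<and> s \<le> t \<and> t \<le> T \<longrightarrow> E t \<le> E s) \<and>
      (\<forall>t. 0 < t \<and> t \<le> T \<longrightarrow> - (C0 + N + 1) \<le> E t \<and> E t \<le> C0 + N + 1)"
      using flow[OF T]
    proof eventually_elim
      case (elim k)
      then obtain ux ut wx wt R where
        "bounded_flow M C0 T k ux ut wx wt R" by blast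
      then interpret F: bounded_regularized_flow a b "ek k" \<gamma>1 \<gamma>2 "dk k" "dx a b (dk k)" g "deriv g"
        "ue (r k)" ux ut "we (r k)" wx wt R T M N Dm m C0 .
      show ?case
      proof (intro exI[of _ F.lyapunov] conjI allI impI)
        fix t assume t: "1 < t \<and> t \<le> T"
        show "(?hk k t)\<^sup>2 \<le> ?C * (F.lyapunov (t - 1) - F.lyapunov t)"
          using F.weak_distance_le_lyapunov_drop[of "poly p" "poly (pderiv p)" B t] t B
          by (simp add: F.inv_mass_def F.\<kappa>_def poly_DERIV has_field_derivative_at_within continuous_on_poly)
      next
        show "F.lyapunov t \<le> F.lyapunov s" if "0 < s \<and> s \<le> t \<and> t \<le> T" for s t
          using F.lyapunov_antimono that by blast
      next
        fix t assume t: "0 < t \<and> t \<le> T"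
        then show "- (C0 + N + 1) \<le> F.lyapunov t" "F.lyapunov t \<le> C0 + N + 1"
          using F.lyapunov_bounds(1,2)[of t] C0 N_pos by auto
      qed
    qed
  qed simp
qed

lemma u_uniform_integrability:
  obtains C1 where "0 \<le> C1"
    and "\<And>t p B L. 0 < t \<Longrightarrow> (\<And>x. x \<in> {a..b} \<Longrightarrow> \<bar>poly p x\<bar> \<le> B) \<Longrightarrow> 1 < L \<Longrightarrow>
      \<bar>LINT x|\<Omega>. u x t * poly p x\<bar> \<le> L * (LINT x|\<Omega>. \<bar>poly p x\<bar> / d x) + B * C1 / ln L"
proof -
  obtain M C0 where M: "0 < M" and C0: "0 \<le> C0"
    and flow: "\<And>T. 0 < T \<Longrightarrow> \<forall>\<^sub>F k in sequentially. \<exists>ux ut wx wt R. bounded_flow M C0 T k ux ut wx wt R"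
    using eventually_bounded_flow by blast
  show ?thesis
  proof (rule that[of "C0 + N + 1"])
    show "0 \<le> C0 + N + 1" using C0 N_pos by simp
    fix t B L :: real and p :: "real poly"
    assume t: "0 < t" and B: "\<And>x. x \<in> {a..b} \<Longrightarrow> \<bar>poly p x\<bar> \<le> B" and L: "1 < L"
    have cp: "continuous_on {a..b} (poly p)" by (intro continuous_intros)
    have "(\<lambda>k. \<bar>integral {a..b} (\<lambda>x. ue (r k) x t * poly p x)\<bar>) \<longlonglongrightarrow> \<bar>LINT x|\<Omega>. u x t * poly p x\<bar>"
      using t by (intro tendsto_rabs u_poly_lim) simp
    moreover have "(\<lambda>k. L * integral {a..b} (\<lambda>x. \<bar>poly p x\<bar> / dk k x) + B * (C0 + N + 1) / ln L)
        \<longlonglongrightarrow> L * (LINT x|\<Omega>. \<bar>poly p x\<bar> / d x) + B * (C0 + N + 1) / ln L"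
      by (intro tendsto_intros inv_dk_tested_lim continuous_intros)
    moreover have "\<forall>\<^sub>F k in sequentially. \<bar>integral {a..b} (\<lambda>x. ue (r k) x t * poly p x)\<bar>
        \<le> L * integral {a..b} (\<lambda>x. \<bar>poly p x\<bar> / dk k x) + B * (C0 + N + 1) / ln L"
      using flow[OF t]
    proof eventually_elim
      case (elim k)
      then obtain ux ut wx wt R where
        "bounded_flow M C0 t k ux ut wx wt R" by blast
      then interpret F: bounded_regularized_flow a b "ek k" \<gamma>1 \<gamma>2 "dk k" "dx a b (dk k)" g "deriv g"
        "ue (r k)" ux ut "we (r k)" wx wt R t M N Dm m C0 .
      have "\<bar>integral {a..b} (\<lambda>x. ue (r k) x t * poly p x)\<bar> \<le> integral {a..b} (\<lambda>x. ue (r k) x t * \<bar>poly p x\<bar>)"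
        unfolding real_norm_def[symmetric]
        using F.u_pos[OF _ t]
        by (intro integral_norm_bound_integral integrable_continuous_interval continuous_intros
            F.u_cont[THEN F.slice] t) (auto simp: abs_mult less_imp_le)
      also have "\<dots> \<le> L * integral {a..b} (\<lambda>x. \<bar>poly p x\<bar> / dk k x) + B * (C0 + N + 1) / ln L"
        by (rule F.uniform_integrability[OF t order_refl cp B L])
      finally show ?case .
    qed
    ultimately show "\<bar>LINT x|\<Omega>. u x t * poly p x\<bar>
        \<le> L * (LINT x|\<Omega>. \<bar>poly p x\<bar> / d x) + B * (C0 + N + 1) / ln L"
      by (intro tendsto_le[OF sequentially_bot])
  qed
qed

text \<open>
  Uniform integrability of the family \<open>u(t)\<close> enters as a bound for polynomial test functions. The
  error of replacing \<open>\<phi>\<close> by the polynomial \<open>p n\<close> is the limit, as \<open>j\<close> tends to infinity, of the error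
  of replacing \<open>p j\<close> by \<open>p n\<close>, and is therefore small uniformly in time if \<open>n\<close> is large.
\<close>

lemma u_weak_limit:
  assumes \<phi>: "\<phi> \<in> Linf {a<..<b}"
  shows "((\<lambda>t. LINT x|\<Omega>. u x t * \<phi> x) \<longlongrightarrow> (LINT x|\<Omega>. mu_inf / d x * \<phi> x)) at_top"
proof -
  obtain C1 where C1: "0 \<le> C1"
    and ui: "\<And>t p B L. 0 < t \<Longrightarrow> (\<And>x. x \<in> {a..b} \<Longrightarrow> \<bar>poly p x\<bar> \<le> B) \<Longrightarrow> 1 < L \<Longrightarrow>
      \<bar>LINT x|\<Omega>. u x t * poly p x\<bar> \<le> L * (LINT x|\<Omega>. \<bar>poly p x\<bar> / d x) + B * C1 / ln L"
    using u_uniform_integrability by blast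
  have \<phi>m: "\<phi> \<in> borel_measurable \<Omega>" and fin: "Linf_norm {a<..<b} \<phi> < \<infinity>"
    using \<phi> by (auto simp: Linf_def)
  define C where "C = enn2real (Linf_norm {a<..<b} \<phi>)"
  have C: "0 \<le> C" by (simp add: C_def)
  have \<phi>C: "AE x in \<Omega>. \<bar>\<phi> x\<bar> \<le> C"
  proof -
    have "AE x in \<Omega>. ennreal \<bar>\<phi> x\<bar> \<le> Linf_norm {a<..<b} \<phi>"
      unfolding Linf_norm_def by (rule esssup_AE)
    moreover have "Linf_norm {a<..<b} \<phi> = ennreal C" using fin by (simp add: C_def)
    ultimately show ?thesis using C by (auto elim!: eventually_mono)
  qed
  obtain p where p: "\<And>n x. x \<in> {a..b} \<Longrightarrow> \<bar>poly (p n) x\<bar> \<le> C + 1"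
    and plim: "AE x in \<Omega>. (\<lambda>n. poly (p n) x) \<longlonglongrightarrow> \<phi> x"
    using bounded_polynomial_approximation[OF \<phi>m C \<phi>C] by blast
  have pAE: "AE x in \<Omega>. \<bar>poly (p n) x\<bar> \<le> C + 1" for n by (rule AE_I2) (simp add: p)
  have \<phi>AE: "AE x in \<Omega>. \<bar>\<phi> x\<bar> \<le> C + 1" using \<phi>C by eventually_elim simp
  define B where "B = 2 * (C + 1)"
  have B: "0 < B" using C by (simp add: B_def)
  have dom: "integrable \<Omega> (\<lambda>x. B * (1 / d x))" by (rule integrable_mult_right[OF inv_d_integrable])
  have inv_m: "(\<lambda>x. 1 / d x) \<in> borel_measurable \<Omega>" by (rule borel_measurable_integrable[OF inv_d_integrable])
  have quot: "AE x in \<Omega>. norm (h x / d x) \<le> B * (1 / d x)" if "AE x in \<Omega>. \<bar>h x\<bar> \<le> B" for h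
    using that d_pos_AE
  proof eventually_elim
    case (elim x) then show ?case by (simp add: abs_divide divide_right_mono)
  qed
  have qm: "(\<lambda>x. h x / d x) \<in> borel_measurable \<Omega>" if "h \<in> borel_measurable \<Omega>" for h
    using borel_measurable_times[OF that inv_m] by simp
  have diffB: "AE x in \<Omega>. \<bar>h x - k x\<bar> \<le> B" if "AE x in \<Omega>. \<bar>h x\<bar> \<le> C + 1" "AE x in \<Omega>. \<bar>k x\<bar> \<le> C + 1" for h k
    using that by eventually_elim (auto simp: B_def)
  have tail: "\<bar>(LINT x|\<Omega>. u x t * poly (p n) x) - (LINT x|\<Omega>. u x t * \<phi> x)\<bar>
      \<le> L * (LINT x|\<Omega>. \<bar>poly (p n) x - \<phi> x\<bar> / d x) + B * C1 / ln L"
    if t: "0 < t" and L: "1 < L" for t n L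
  proof (rule LIMSEQ_le)
    have ui_u: "integrable \<Omega> (\<lambda>x. u x t * poly (p j) x)" for j
      using t by (intro u_tested_integrable[OF _ poly_measurable pAE]) simp
    have "(\<lambda>j. LINT x|\<Omega>. u x t * poly (p j) x) \<longlonglongrightarrow> (LINT x|\<Omega>. u x t * \<phi> x)"
    proof (rule integral_dominated_convergence[where w = "\<lambda>x. (C + 1) * \<bar>u x t\<bar>"])
      show "(\<lambda>x. u x t * \<phi> x) \<in> borel_measurable \<Omega>"
        using borel_measurable_integrable[OF u_integrable] t \<phi>m by simp
      show "integrable \<Omega> (\<lambda>x. (C + 1) * \<bar>u x t\<bar>)" using u_integrable[of t] t by simp
      show "AE x in \<Omega>. (\<lambda>j. u x t * poly (p j) x) \<longlonglongrightarrow> u x t * \<phi> x"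
        using plim by eventually_elim (intro tendsto_intros)
      show "AE x in \<Omega>. norm (u x t * poly (p j) x) \<le> (C + 1) * \<bar>u x t\<bar>" for j
        using pAE[of j]
      proof eventually_elim
        case (elim x)
        from mult_left_mono[OF elim, of "\<bar>u x t\<bar>"] show ?case by (simp add: abs_mult mult.commute)
      qed
    qed (rule borel_measurable_integrable[OF ui_u])
    then show "(\<lambda>j. \<bar>(LINT x|\<Omega>. u x t * poly (p n) x) - (LINT x|\<Omega>. u x t * poly (p j) x)\<bar>)
        \<longlonglongrightarrow> \<bar>(LINT x|\<Omega>. u x t * poly (p n) x) - (LINT x|\<Omega>. u x t * \<phi> x)\<bar>"
      by (intro tendsto_intros)
    have "(\<lambda>j. LINT x|\<Omega>. \<bar>poly (p n) x - poly (p j) x\<bar> / d x) \<longlonglongrightarrow> (LINT x|\<Omega>. \<bar>poly (p n) x - \<phi> x\<bar> / d x)"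
    proof (rule integral_dominated_convergence[OF _ _ dom])
      show "(\<lambda>x. \<bar>poly (p n) x - \<phi> x\<bar> / d x) \<in> borel_measurable \<Omega>"
        using poly_measurable \<phi>m by (intro qm) simp
      show "(\<lambda>x. \<bar>poly (p n) x - poly (p j) x\<bar> / d x) \<in> borel_measurable \<Omega>" for j
        using poly_measurable by (intro qm) simp
      show "AE x in \<Omega>. (\<lambda>j. \<bar>poly (p n) x - poly (p j) x\<bar> / d x) \<longlonglongrightarrow> \<bar>poly (p n) x - \<phi> x\<bar> / d x"
        using plim d_pos_AE by eventually_elim (auto intro!: tendsto_intros)
      show "AE x in \<Omega>. norm (\<bar>poly (p n) x - poly (p j) x\<bar> / d x) \<le> B * (1 / d x)" for j
        using diffB[OF pAE pAE] by (intro quot) simp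
    qed
    then show "(\<lambda>j. L * (LINT x|\<Omega>. \<bar>poly (p n) x - poly (p j) x\<bar> / d x) + B * C1 / ln L)
        \<longlonglongrightarrow> L * (LINT x|\<Omega>. \<bar>poly (p n) x - \<phi> x\<bar> / d x) + B * C1 / ln L"
      by (intro tendsto_intros)
    show "\<exists>N. \<forall>j\<ge>N. \<bar>(LINT x|\<Omega>. u x t * poly (p n) x) - (LINT x|\<Omega>. u x t * poly (p j) x)\<bar>
        \<le> L * (LINT x|\<Omega>. \<bar>poly (p n) x - poly (p j) x\<bar> / d x) + B * C1 / ln L"
    proof (intro exI allI impI)
      fix j
      have "\<bar>poly (p n - p j) x\<bar> \<le> B" if "x \<in> {a..b}" for x
        using p[OF that, of n] p[OF that, of j] by (simp add: B_def)
      from ui[OF t this L] show "\<bar>(LINT x|\<Omega>. u x t * poly (p n) x) - (LINT x|\<Omega>. u x t * poly (p j) x)\<bar>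
        \<le> L * (LINT x|\<Omega>. \<bar>poly (p n) x - poly (p j) x\<bar> / d x) + B * C1 / ln L"
        using ui_u[of n] ui_u[of j] by (simp add: right_diff_distrib)
    qed
  qed
  have small: "(\<lambda>n. LINT x|\<Omega>. \<bar>poly (p n) x - \<phi> x\<bar> / d x) \<longlonglongrightarrow> (LINT x|\<Omega>. 0)"
  proof (rule integral_dominated_convergence[OF _ _ dom])
    show "(\<lambda>x. \<bar>poly (p n) x - \<phi> x\<bar> / d x) \<in> borel_measurable \<Omega>" for n
      using poly_measurable \<phi>m by (intro qm) simp
    show "AE x in \<Omega>. (\<lambda>n. \<bar>poly (p n) x - \<phi> x\<bar> / d x) \<longlonglongrightarrow> 0"
      using plim d_pos_AE
    proof eventually_elim
      case (elim x)
      have "(\<lambda>n. \<bar>poly (p n) x - \<phi> x\<bar> / d x) \<longlonglongrightarrow> \<bar>\<phi> x - \<phi> x\<bar> / d x"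
        using elim by (intro tendsto_intros) auto
      then show ?case by simp
    qed
    show "AE x in \<Omega>. norm (\<bar>poly (p n) x - \<phi> x\<bar> / d x) \<le> B * (1 / d x)" for n
      using diffB[OF pAE \<phi>AE] by (intro quot) simp
  qed simp
  have small2: "(\<lambda>n. mu_inf * (LINT x|\<Omega>. poly (p n) x / d x)) \<longlonglongrightarrow> mu_inf * (LINT x|\<Omega>. \<phi> x / d x)"
  proof (intro tendsto_mult tendsto_const integral_dominated_convergence[OF _ _ dom])
    show "(\<lambda>x. \<phi> x / d x) \<in> borel_measurable \<Omega>" using \<phi>m by (rule qm)
    show "(\<lambda>x. poly (p n) x / d x) \<in> borel_measurable \<Omega>" for n using poly_measurable by (rule qm)
    show "AE x in \<Omega>. (\<lambda>n. poly (p n) x / d x) \<longlonglongrightarrow> \<phi> x / d x"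
      using plim d_pos_AE by eventually_elim (auto intro!: tendsto_intros)
    show "AE x in \<Omega>. norm (poly (p n) x / d x) \<le> B * (1 / d x)" for n
      using pAE[of n] C by (intro quot) (auto simp: B_def elim!: eventually_mono)
  qed
  have target: "(LINT x|\<Omega>. mu_inf / d x * \<phi> x) = mu_inf * (LINT x|\<Omega>. \<phi> x / d x)"
    by (subst integral_mult_right_zero[symmetric]) (simp add: mult_ac)
  show ?thesis
    unfolding target
  proof (rule tendstoI)
    fix \<eta> :: real assume \<eta>: "0 < \<eta>"
    \<comment> \<open>The level \<open>L\<close> makes the part of \<open>u\<close> above it small; only then is \<open>n\<close> chosen.\<close>
    define L where "L = exp (4 * B * C1 / \<eta> + 1)"
    have "0 \<le> 4 * B * C1 / \<eta>" using \<eta> B C1 by simp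
    then have L: "1 < L" by (simp add: L_def)
    have "B * C1 / ln L \<le> \<eta> / 4"
    proof -
      have "4 * B * C1 / \<eta> \<le> ln L" by (simp add: L_def)
      then have "4 * B * C1 \<le> \<eta> * ln L" using \<eta> by (simp add: field_simps)
      then show ?thesis using L by (simp add: field_simps)
    qed
    note LB = this
    have "\<forall>\<^sub>F n in sequentially. (LINT x|\<Omega>. \<bar>poly (p n) x - \<phi> x\<bar> / d x) < \<eta> / (4 * L)"
      using small \<eta> L by (intro order_tendstoD(2)) auto
    moreover have "\<forall>\<^sub>F n in sequentially. dist (mu_inf * (LINT x|\<Omega>. poly (p n) x / d x)) (mu_inf * (LINT x|\<Omega>. \<phi> x / d x)) < \<eta> / 4"
      using small2 \<eta> by (intro tendstoD) auto
    ultimately have "\<forall>\<^sub>F n in sequentially. (LINT x|\<Omega>. \<bar>poly (p n) x - \<phi> x\<bar> / d x) < \<eta> / (4 * L) \<and>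
        dist (mu_inf * (LINT x|\<Omega>. poly (p n) x / d x)) (mu_inf * (LINT x|\<Omega>. \<phi> x / d x)) < \<eta> / 4"
      by (rule eventually_conj)
    from eventually_happens'[OF sequentially_bot this]
    obtain n where n1: "(LINT x|\<Omega>. \<bar>poly (p n) x - \<phi> x\<bar> / d x) < \<eta> / (4 * L)"
      and n2: "dist (mu_inf * (LINT x|\<Omega>. poly (p n) x / d x)) (mu_inf * (LINT x|\<Omega>. \<phi> x / d x)) < \<eta> / 4" by blast
    have n1': "L * (LINT x|\<Omega>. \<bar>poly (p n) x - \<phi> x\<bar> / d x) < \<eta> / 4"
      using mult_strict_left_mono[OF n1, of L] L by simp
    have "\<forall>\<^sub>F t in at_top. dist ((LINT x|\<Omega>. u x t * poly (p n) x) - mu_inf * (LINT x|\<Omega>. poly (p n) x / d x)) 0 < \<eta> / 4"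
      using u_tested_with_polynomials \<eta> by (intro tendstoD) auto
    then show "\<forall>\<^sub>F t in at_top. dist (LINT x|\<Omega>. u x t * \<phi> x) (mu_inf * (LINT x|\<Omega>. \<phi> x / d x)) < \<eta>"
      using eventually_gt_at_top[of 0]
    proof eventually_elim
      case (elim t)
      then show ?case using tail[OF elim(2) L, of n] n1' n2 LB unfolding dist_real_def by linarith
    qed
  qed
qed

lemma nutrient_mean_lim: "((\<lambda>t. integral {a..b} (\<lambda>x. w x t)) \<longlongrightarrow> 0) at_top"
  and nutrient_modulus: "\<exists>C\<ge>0. \<forall>x y t. a \<le> y \<longrightarrow> y \<le> x \<longrightarrow> x \<le> b \<longrightarrow> 0 < t \<longrightarrow>
    (w x t - w y t)\<^sup>2 \<le> C * integral {y..x} (\<lambda>z. 1 / d z)"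
proof -
  obtain M C0 where M: "0 < M" and C0: "0 \<le> C0"
    and flow: "\<And>T. 0 < T \<Longrightarrow> \<forall>\<^sub>F k in sequentially. \<exists>ux ut wx wt R. bounded_flow M C0 T k ux ut wx wt R"
    using eventually_bounded_flow by blast
  have ulim: "uniform_limit {a..b} (\<lambda>k x. we (r k) x t) (\<lambda>x. w x t) sequentially" if t: "0 < t" for t
  proof -
    have "uniform_limit ({a..b} \<times> {t}) (\<lambda>k (x, t). we (r k) x t) (\<lambda>(x, t). w x t) sequentially"
      using t by (intro w_lim compact_Times compact_Icc) auto
    then show ?thesis unfolding uniform_limit_iff by auto
  qed
  have plim: "(\<lambda>k. we (r k) x t) \<longlonglongrightarrow> w x t" if "x \<in> {a..b}" "0 < t" for x t
    by (rule tendsto_uniform_limitI[OF ulim[OF that(2)] that(1)])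
  have wec: "continuous_on {a..b} (\<lambda>x. we k x t)" if t: "0 < t" for k t
  proof -
    have "continuous_on ({a..b} \<times> {0..}) (\<lambda>z. we k (fst z) (snd z))"
      using sol[of k] unfolding regularized_solution_def by (simp add: case_prod_unfold)
    from continuous_on_compose2[OF this, of "{a..b}" "\<lambda>x. (x, t)"] t show ?thesis
      by (force intro!: continuous_intros)
  qed
  define Q where "Q t = Dm * N / (\<gamma>1 * m) * (2 * (M * (b - a) + C0 + N + 1) / t
        + \<gamma>2 * M * N * sqrt (Dm * m) * sqrt (2 * (M * (b - a) + C0 + N + 1) / t))" for t
  have le: "integral {a..b} (\<lambda>x. w x t) \<le> Q t" if t: "0 < t" for t
  proof -
    have "(\<lambda>k. integral {a..b} (\<lambda>x. we (r k) x t)) \<longlonglongrightarrow> integral {a..b} (\<lambda>x. w x t)"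
    proof -
      obtain I J where I: "\<And>n. ((\<lambda>x. we (r n) x t) has_integral I n) {a..b}"
        and J: "((\<lambda>x. w x t) has_integral J) {a..b}" and lim: "I \<longlonglongrightarrow> J"
        using uniform_limit_integral[OF ulim[OF t] wec[OF t]] by auto
      show ?thesis unfolding integral_unique[OF I] integral_unique[OF J] by (rule lim)
    qed
    moreover have "\<forall>\<^sub>F k in sequentially. integral {a..b} (\<lambda>x. we (r k) x t) \<le> Q t"
      using flow[OF t]
    proof eventually_elim
      case (elim k)
      then obtain ux ut wx wt R where
        "bounded_flow M C0 t k ux ut wx wt R" by blast
      then interpret F: bounded_regularized_flow a b "ek k" \<gamma>1 \<gamma>2 "dk k" "dx a b (dk k)" g "deriv g"
        "ue (r k)" ux ut "we (r k)" wx wt R t M N Dm m C0 .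
      show ?case using F.nutrient_decay by (simp add: Q_def)
    qed
    ultimately show ?thesis by (rule tendsto_upperbound) simp
  qed
  have inv: "((\<lambda>t::real. A / t) \<longlongrightarrow> 0) at_top" for A :: real
    by (intro tendsto_divide_0[OF tendsto_const] filterlim_at_top_imp_at_infinity filterlim_ident)
  have "(Q \<longlongrightarrow> Dm * N / (\<gamma>1 * m) * (0 + \<gamma>2 * M * N * sqrt (Dm * m) * sqrt 0)) at_top"
    unfolding Q_def[abs_def] by (intro tendsto_intros inv)
  then have Q0: "(Q \<longlongrightarrow> 0) at_top" by simp
  show "((\<lambda>t. integral {a..b} (\<lambda>x. w x t)) \<longlongrightarrow> 0) at_top"
  proof (rule tendsto_sandwich[OF _ _ tendsto_const Q0])
    show "\<forall>\<^sub>F t in at_top. integral {a..b} (\<lambda>x. w x t) \<le> Q t"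
      using eventually_gt_at_top[of 0] by eventually_elim (rule le)
    show "\<forall>\<^sub>F t in at_top. 0 \<le> integral {a..b} (\<lambda>x. w x t)"
      using eventually_gt_at_top[of 0]
    proof eventually_elim
      case (elim t)
      have "continuous_on {a..b} (\<lambda>x. w x t)"
      proof (rule uniform_limit_theorem[OF _ ulim[OF elim]])
        show "\<forall>\<^sub>F k in sequentially. continuous_on {a..b} (\<lambda>x. we (r k) x t)"
          by (intro always_eventually allI wec[OF elim])
      qed simp
      then show ?case
        using w_nonneg elim
        by (intro Henstock_Kurzweil_Integration.integral_nonneg integrable_continuous_interval) auto
    qed
  qed
  let ?C = "2 * (C0 + N + 1) * (\<gamma>2 * M)"
  have C: "0 \<le> ?C" using C0 N_pos \<gamma>_pos M by simp
  have "(w x t - w y t)\<^sup>2 \<le> ?C * integral {y..x} (\<lambda>z. 1 / d z)"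
    if xy: "a \<le> y" "y \<le> x" "x \<le> b" and t: "0 < t" for x y t
  proof (rule tendsto_upperbound)
    show "(\<lambda>k. (we (r k) x t - we (r k) y t)\<^sup>2) \<longlonglongrightarrow> (w x t - w y t)\<^sup>2"
      using xy t by (intro tendsto_intros plim) auto
    show "\<forall>\<^sub>F k in sequentially. (we (r k) x t - we (r k) y t)\<^sup>2 \<le> ?C * integral {y..x} (\<lambda>z. 1 / d z)"
      using flow[OF t]
    proof eventually_elim
      case (elim k)
      then obtain ux ut wx wt R where
        "bounded_flow M C0 t k ux ut wx wt R" by blast
      then interpret F: bounded_regularized_flow a b "ek k" \<gamma>1 \<gamma>2 "dk k" "dx a b (dk k)" g "deriv g"
        "ue (r k)" ux ut "we (r k)" wx wt R t M N Dm m C0 .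
      have "(we (r k) x t - we (r k) y t)\<^sup>2 \<le> ?C * integral {y..x} (\<lambda>z. 1 / dk k z)"
        by (rule F.bounded_nutrient_equicontinuity[OF t order_refl xy])
      also have "\<dots> \<le> ?C * integral {y..x} (\<lambda>z. 1 / d z)"
        by (intro mult_left_mono inv_dk_integral_le xy C)
      finally show ?case .
    qed
  qed simp
  with C show "\<exists>C\<ge>0. \<forall>x y t. a \<le> y \<longrightarrow> y \<le> x \<longrightarrow> x \<le> b \<longrightarrow> 0 < t \<longrightarrow>
    (w x t - w y t)\<^sup>2 \<le> C * integral {y..x} (\<lambda>z. 1 / d z)" by blast
qed

lemma nutrient_limit: "((\<lambda>t. Linf_norm {a<..<b} (\<lambda>x. w x t)) \<longlongrightarrow> 0) at_top"
proof -
  obtain C where C: "\<And>x y t. a \<le> y \<Longrightarrow> y \<le> x \<Longrightarrow> x \<le> b \<Longrightarrow> 0 < t \<Longrightarrow>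
      (w x t - w y t)\<^sup>2 \<le> C * integral {y..x} (\<lambda>z. 1 / d z)"
    using nutrient_modulus by blast
  have wc: "continuous_on {a..b} (\<lambda>x. w x t)" if "0 < t" for t
    using continuous_on_compose2[OF w_cont', of "{a..b}" "\<lambda>x. (x, t)"] that
    by (force intro!: continuous_intros)
  have unif: "\<forall>\<^sub>F t in at_top. \<forall>x\<in>{a..b}. w x t \<le> \<rho>" if "0 < \<rho>" for \<rho>
  proof (rule uniform_limit_zero_of_mean[OF ab, where k = "\<lambda>z. C * (1 / d z)"])
    show "(\<lambda>z. C * (1 / d z)) integrable_on {a..b}"
      by (rule integrable_on_mult_right[OF inv_d_HK(1)])
    show "(w x t - w y t)\<^sup>2 \<le> integral {y..x} (\<lambda>z. C * (1 / d z))"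
      if "a \<le> y" "y \<le> x" "x \<le> b" "0 < t" for x y t
      using C[OF that] by (simp only: integral_mult_right)
    show "((\<lambda>t. integral {a..b} (\<lambda>x. w x t)) \<longlongrightarrow> 0) at_top" by (rule nutrient_mean_lim)
  qed (use w_nonneg wc that in auto)
  show ?thesis
  proof (rule order_tendstoI)
    fix y :: ennreal assume "0 < y"
    then obtain \<rho> where \<rho>: "0 < \<rho>" "ennreal \<rho> < y"
    proof (cases y)
      case (real s)
      then show ?thesis using \<open>0 < y\<close> by (intro that[of "s / 2"]) (auto simp: ennreal_less_iff)
    next
      case top
      then show ?thesis by (intro that[of 1]) auto
    qed
    show "\<forall>\<^sub>F t in at_top. Linf_norm {a<..<b} (\<lambda>x. w x t) < y"
      using unif[OF \<rho>(1)] eventually_gt_at_top[of 0]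
    proof eventually_elim
      case (elim t)
      have "Linf_norm {a<..<b} (\<lambda>x. w x t) \<le> ennreal \<rho>"
      proof (rule Linf_norm_le)
        show "(\<lambda>x. w x t) \<in> borel_measurable \<Omega>"
          by (rule borel_measurable_integrable[OF continuous_on_open_interval_integral(1)[OF wc[OF elim(2)]]])
        show "AE x in \<Omega>. \<bar>w x t\<bar> \<le> \<rho>"
          using elim w_nonneg by (intro AE_I2) auto
      qed
      then show ?case using \<rho>(2) by (rule order_le_less_trans)
    qed
  qed simp
qed

end

theorem theorem1p2:
  fixes a b \<gamma>1 \<gamma>2 \<mu> :: real and d g u0 w0 :: "real \<Rightarrow> real" and u w :: "real \<Rightarrow> real \<Rightarrow> real"
  assumes "a < b"
    and "continuous_on {a..b} d" and "\<forall>x\<in>{a..b}. 0 \<le> d x"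
    and "Ck_on 1 (pos_set a b d) d"
    and "(\<integral>\<^sup>+x. inverse (ennreal (d x)) \<partial>lebesgue_on {a<..<b}) < \<infinity>"
    and "Ck_on 2 {0..} g" and "g 0 = 0"
    and "0 < \<gamma>1" and "0 < \<gamma>2"
    and "\<forall>s\<ge>0. \<gamma>1 \<le> vector_derivative g (at s within {0..}) \<and>
                 vector_derivative g (at s within {0..}) \<le> \<gamma>2"
    and "continuous_on {a..b} u0" and "\<forall>x\<in>{a..b}. 0 \<le> u0 x" and "\<exists>x\<in>{a..b}. u0 x \<noteq> 0"
    and "continuous_on {a..b} w0" and "\<forall>x\<in>{a..b}. 0 \<le> w0 x"
    and "(\<lambda>x. sqrt (w0 x)) \<in> W1p 2 a b"
    and "(\<integral>\<^sup>+x. ennreal ((dx a b d x)\<^sup>2 / d x * w0 x) \<partial>lebesgue_on (pos_set a b d)) < \<infinity>"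
    and "constructed_solution a b d g u0 w0 u w"
    and "\<mu> = (LINT x|lebesgue_on {a<..<b}. u0 x) / (LINT x|lebesgue_on {a<..<b}. 1 / d x)"
  shows "0 < \<mu> \<and>
    weak_L1_tendsto {a<..<b} (\<lambda>t x. u x t) (\<lambda>x. \<mu> / d x) at_top \<and>
    ((\<lambda>t. Linf_norm {a<..<b} (\<lambda>x. w x t)) \<longlongrightarrow> 0) at_top"
proof -
  note sol = assms(18)[unfolded constructed_solution_def]
  from sol obtain wx de w0j eps ue we r where
    A: "approx_d a b d de" "approx_w0 a b d w0 w0j" "approx_eps a b de w0j eps"
    and S: "\<forall>j. regularized_solution a b (eps j) (de (eps j)) g u0 (w0_reg w0j eps j) (ue j) (we j)"
    and r: "strict_mono (r :: nat \<Rightarrow> nat)"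
    and U: "\<forall>K. compact K \<and> K \<subseteq> {0..} \<longrightarrow>
      (\<lambda>k. SUP t\<in>K. W1inf_dual_norm a b (\<lambda>x. ue (r k) x t - u x t)) \<longlonglongrightarrow> 0"
    and W: "\<forall>K. compact K \<and> K \<subseteq> {a..b} \<times> {0..} \<longrightarrow>
      uniform_limit K (\<lambda>k (x, t). we (r k) x t) (\<lambda>(x, t). w x t) sequentially"
    by (elim exE conjE) (rule that; assumption)
  interpret constructed_limit a b \<gamma>1 \<gamma>2 d g u0 w0 u w de w0j eps ue we r
  proof
    show "Cw_L1 a b u" using sol by (elim conjE)
    show "\<forall>x\<in>{a..b}. \<forall>t\<ge>0. 0 \<le> w x t" using sol by (elim conjE)
    show "continuous_on ({a..b} \<times> {0..}) (\<lambda>(x, t). w x t)" using sol by (elim conjE)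
    show "(\<lambda>(x, t). w x t) \<in> Linf ({a<..<b} \<times> {0<..})" using sol by (elim conjE)
    show "regularized_solution a b (eps j) (de (eps j)) g u0 (w0_reg w0j eps j) (ue j) (we j)" for j
      using S by blast
    show "(\<lambda>k. SUP t\<in>K. W1inf_dual_norm a b (\<lambda>x. ue (r k) x t - u x t)) \<longlonglongrightarrow> 0"
      if "compact K" "K \<subseteq> {0..}" for K
      using U that by blast
    show "uniform_limit K (\<lambda>k (x, t). we (r k) x t) (\<lambda>(x, t). w x t) sequentially"
      if "compact K" "K \<subseteq> {a..b} \<times> {0..}" for K
      using W that by blast
  qed (fact assms A r)+
  have \<mu>: "\<mu> = mu_inf"
    unfolding assms(19) mu_inf_def m_def N_def
    by (simp add: continuous_on_open_interval_integral(2)[OF assms(11)])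
  show ?thesis
    unfolding \<mu> weak_L1_tendsto_def
  proof (intro conjI ballI)
    show "0 < mu_inf" using m_pos N_pos by (simp add: mu_inf_def)
    show "(\<lambda>x. mu_inf / d x) \<in> Lp 1 {a<..<b}"
      using integrable_mult_right[OF inv_d_integrable, of "mu_inf"] by (simp add: Lp_1_iff_integrable)
    show "\<forall>\<^sub>F t in at_top. (\<lambda>x. u x t) \<in> Lp 1 {a<..<b}"
      using eventually_ge_at_top[of 0] by eventually_elim (simp add: Lp_1_iff_integrable u_integrable)
  qed (rule u_weak_limit nutrient_limit; assumption?)+
qed

end
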